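(* Let $f:\mathbb{R}\to\mathbb{R}$ be smooth, and let $H:\mathbb{R}\to\mathbb{R}$ be Lipschitz with Lipschitz constant $1$ and smooth on an open dense set $S\subset\mathbb{R}$. Let $h=H'$ and assume that for all integers $m\ge 0$, $k\ge 0$ and $\ell_1,\dots,\ell_m\ge 0$, $$f^{(k)}(x)\,h^{(\ell_1)}(x)\cdots h^{(\ell_m)}(x)\to 0$$ on $\mathbb{R}\setminus S$, i.e. as $x\in S$ tends to any point of $\mathbb{R}\setminus S$. Let $(x,u,v)$ be the Lipschitz coordinates on $\mathbb{H}^2\times\mathbb{R}$ determined by $H$ described in the context. Then the metric $g$ of the form $$g = (\cosh u - h(x)\sinh u)^2\,dx^2 + (du - f(x)\,v\,dx)^2 + (dv + f(x)\,u\,dx)^2$$ in the coordinates $(x,u,v)$ (i.e. $g$ is given by this formula on the open dense set $\{x\in S\}$ and extended to all of $\mathbb{H}^2\times\mathbb{R}$) is a smooth, complete Riemannian metric and has Ricci eigenvalues $(-1,-1,0)$.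
   Context: "Ricci eigenvalues $(-1,-1,0)$" means that at every point the Ricci tensor has eigenvalues $-1,-1,0$ (with multiplicity). Coordinates: let $\gamma:\mathbb{R}\to\mathbb{H}^2$ be the unit-speed $C^{1,1}$ curve with turning angle $H$ (i.e., up to the additive constant $H(0)$, $H(x)$ is the signed angle from the parallel translate of $\gamma'(0)$ along $\gamma$ to $\gamma'(x)$), so that $h=H'$ is its geodesic curvature where defined; let $U$ be the unit vector field along $\gamma$ orthogonal to $\gamma'$ obtained by rotating $\gamma'$ by $+\pi/2$. The map $(x,u,v)\mapsto(\exp_{\gamma(x)}(uU(x)),v)$ gives Lipschitz coordinates on the smooth manifold $\mathbb{H}^2\times\mathbb{R}$, smooth over $x\in S$; for $f\equiv0$ the formula for $g$ gives the product metric. The function $h$ need not be continuous, or defined, outside $S$. *)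

theory Defs
  imports "HOL-Analysis.Analysis" "HOL-Library.Multiset"
begin

section \<open>Smooth functions\<close>

definition smooth_real_on :: "real set \<Rightarrow> (real \<Rightarrow> real) \<Rightarrow> bool" where
  "smooth_real_on S f \<longleftrightarrow> (\<forall>k. \<forall>x\<in>S. (deriv ^^ k) f differentiable (at x))"

primrec C_k :: "nat \<Rightarrow> ('a::euclidean_space \<Rightarrow> real) \<Rightarrow> bool" where
  "C_k 0 F \<longleftrightarrow> continuous_on UNIV F"
| "C_k (Suc k) F \<longleftrightarrow>
     (\<forall>p. F differentiable (at p)) \<and> (\<forall>a. C_k k (\<lambda>p. frechet_derivative F (at p) a))"

definition smooth :: "('a::euclidean_space \<Rightarrow> real) \<Rightarrow> bool" where
  "smooth F \<longleftrightarrow> (\<forall>k. C_k k F)"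


section \<open>Riemannian geometry in a global chart\<close>

text \<open>All manifolds here are diffeomorphic to a Euclidean space and are identified with it by a
  global chart. A covariant 2-tensor \<open>g\<close> takes a point and two tangent vectors.\<close>

type_synonym 'a tensor2 = "'a \<Rightarrow> 'a \<Rightarrow> 'a \<Rightarrow> real"

definition symmetric_tensor :: "'a::euclidean_space tensor2 \<Rightarrow> bool" where
  "symmetric_tensor g \<longleftrightarrow> (\<forall>p. bilinear (g p) \<and> (\<forall>a b. g p a b = g p b a))"

definition continuous_tensor :: "'a::euclidean_space tensor2 \<Rightarrow> bool" where
  "continuous_tensor g \<longleftrightarrow> (\<forall>a b. continuous_on UNIV (\<lambda>p. g p a b))"

definition smooth_riemannian_metric :: "'a::euclidean_space tensor2 \<Rightarrow> bool" where
  "smooth_riemannian_metric g \<longleftrightarrow>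
     symmetric_tensor g \<and> (\<forall>p a. a \<noteq> 0 \<longrightarrow> g p a a > 0) \<and> (\<forall>a b. smooth (\<lambda>p. g p a b))"

text \<open>The requirement that the speed be integrable is needed: \<open>valid_path\<close> allows the derivative
  to be unbounded near the exceptional points, so a valid path may have infinite length, and
  \<open>integral\<close> would then return 0.\<close>

definition riem_dist :: "'a::euclidean_space tensor2 \<Rightarrow> 'a \<Rightarrow> 'a \<Rightarrow> real" where
  "riem_dist g p q = Inf {L. \<exists>c. valid_path c \<and> pathstart c = p \<and> pathfinish c = q \<and>
     ((\<lambda>t. sqrt (g (c t) (vector_derivative c (at t)) (vector_derivative c (at t))))
        has_integral L) {0..1}}"

definition riem_complete :: "'a::euclidean_space tensor2 \<Rightarrow> bool" where
  "riem_complete g \<longleftrightarrow>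
     Metric_space UNIV (riem_dist g) \<and> Metric_space.mcomplete UNIV (riem_dist g)"

text \<open>\<open>christoffel g p a b\<close> is the value at \<open>p\<close> of the Levi-Civita derivative of the
  constant field \<open>b\<close> in direction \<open>a\<close>, given by the Koszul formula for constant fields.\<close>

definition christoffel :: "'a::euclidean_space tensor2 \<Rightarrow> 'a \<Rightarrow> 'a \<Rightarrow> 'a \<Rightarrow> 'a" where
  "christoffel g p a b = (THE c. \<forall>d. 2 * g p c d =
     frechet_derivative (\<lambda>q. g q b d) (at p) a
     + frechet_derivative (\<lambda>q. g q a d) (at p) b
     - frechet_derivative (\<lambda>q. g q a b) (at p) d)"

text \<open>\<open>riem_curv g p a b c\<close> is \<open>\<nabla>\<^sub>a \<nabla>\<^sub>b c - \<nabla>\<^sub>b \<nabla>\<^sub>a c\<close> for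
  constant fields \<open>a\<close>, \<open>b\<close>, \<open>c\<close>.\<close>

definition riem_curv :: "'a::euclidean_space tensor2 \<Rightarrow> 'a \<Rightarrow> 'a \<Rightarrow> 'a \<Rightarrow> 'a \<Rightarrow> 'a" where
  "riem_curv g p a b c =
     frechet_derivative (\<lambda>q. christoffel g q b c) (at p) a
     - frechet_derivative (\<lambda>q. christoffel g q a c) (at p) b
     + christoffel g p a (christoffel g p b c)
     - christoffel g p b (christoffel g p a c)"

text \<open>The trace of \<open>a \<mapsto> R(a,b)c\<close>; it does not depend on the basis, so using the standard
  one of the chart is harmless.\<close>

definition ricci :: "'a::euclidean_space tensor2 \<Rightarrow> 'a tensor2" where
  "ricci g p b c = (\<Sum>e\<in>Basis. riem_curv g p e b c \<bullet> e)"

definition ricci_op :: "'a::euclidean_space tensor2 \<Rightarrow> 'a \<Rightarrow> 'a \<Rightarrow> 'a" where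
  "ricci_op g p b = (THE w. \<forall>c. g p w c = ricci g p b c)"

text \<open>The Ricci operator is self-adjoint with respect to \<open>g\<close>, so the multiplicity of an
  eigenvalue is the dimension of its eigenspace.\<close>

definition has_ricci_eigenvalues :: "'a::euclidean_space tensor2 \<Rightarrow> real multiset \<Rightarrow> bool" where
  "has_ricci_eigenvalues g E \<longleftrightarrow>
     (\<forall>p r. dim {w. ricci_op g p w = r *\<^sub>R w} = count E r)"

definition parallel_along ::
    "'a::euclidean_space tensor2 \<Rightarrow> (real \<Rightarrow> 'a) \<Rightarrow> (real \<Rightarrow> 'a) \<Rightarrow> bool" where
  "parallel_along g c V \<longleftrightarrow> (\<forall>t. (V has_vector_derivative
     - christoffel g (c t) (vector_derivative c (at t)) (V t)) (at t))"

definition geodesic :: "'a::euclidean_space tensor2 \<Rightarrow> (real \<Rightarrow> 'a) \<Rightarrow> bool" where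
  "geodesic g c \<longleftrightarrow> (\<forall>t. c differentiable (at t)) \<and>
     parallel_along g c (\<lambda>t. vector_derivative c (at t))"

definition riem_exp :: "'a::euclidean_space tensor2 \<Rightarrow> 'a \<Rightarrow> 'a \<Rightarrow> 'a" where
  "riem_exp g p w = (THE q. \<exists>c. geodesic g c \<and> c 0 = p \<and>
     vector_derivative c (at 0) = w \<and> q = c 1)"


section \<open>The hyperbolic plane and the coordinates\<close>

text \<open>The hyperbolic plane is the sheet \<open>z\<^sup>2 = 1 + |y|\<^sup>2\<close>, \<open>z > 0\<close> of the hyperboloid in
  Minkowski space, with global chart \<open>(z, y) \<mapsto> y\<close>; here \<open>\<real>\<^sup>2\<close> is the type
  \<^typ>\<open>complex\<close>. Restricting \<open>|dy|\<^sup>2 - dz\<^sup>2\<close> to the sheet gives the formula below.\<close>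

definition hyp_metric :: "complex tensor2" where
  "hyp_metric y a b = a \<bullet> b - (y \<bullet> a) * (y \<bullet> b) / (1 + y \<bullet> y)"

text \<open>Rotation by \<open>+\<pi>/2\<close>; \<open>Im (cnj w * z)\<close> is the determinant of \<open>(w, z)\<close>.\<close>

definition hyp_rot :: "complex \<Rightarrow> complex \<Rightarrow> complex" where
  "hyp_rot y w = (THE z. hyp_metric y z z = hyp_metric y w w \<and> hyp_metric y w z = 0 \<and>
     Im (cnj w * z) \<ge> 0)"

definition curve_with_turning_angle :: "(real \<Rightarrow> real) \<Rightarrow> (real \<Rightarrow> complex) \<Rightarrow> bool" where
  "curve_with_turning_angle H \<gamma> \<longleftrightarrow>
     (\<forall>x. \<gamma> differentiable (at x)) \<and>
     (\<forall>a b. \<exists>C. C-lipschitz_on {a..b} (\<lambda>x. vector_derivative \<gamma> (at x))) \<and>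
     (\<forall>x. hyp_metric (\<gamma> x) (vector_derivative \<gamma> (at x)) (vector_derivative \<gamma> (at x)) = 1) \<and>
     (\<exists>P. parallel_along hyp_metric \<gamma> P \<and> P 0 = vector_derivative \<gamma> (at 0) \<and>
       (\<forall>x. vector_derivative \<gamma> (at x) =
          cos (H x - H 0) *\<^sub>R P x + sin (H x - H 0) *\<^sub>R hyp_rot (\<gamma> x) (P x)))"

definition coords :: "(real \<Rightarrow> complex) \<Rightarrow> real \<times> real \<times> real \<Rightarrow> complex \<times> real" where
  "coords \<gamma> = (\<lambda>(x, u, v).
     (riem_exp hyp_metric (\<gamma> x) (u *\<^sub>R hyp_rot (\<gamma> x) (vector_derivative \<gamma> (at x))), v))"

text \<open>A continuous symmetric tensor whose pullback under the coordinates \<open>(x, u, v)\<close> is the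
  prescribed expression for \<open>x \<in> S\<close>. It suffices to prescribe the quadratic form.\<close>

definition extends_coord_formula ::
    "(real \<Rightarrow> real) \<Rightarrow> (real \<Rightarrow> real) \<Rightarrow> real set \<Rightarrow> (real \<Rightarrow> complex) \<Rightarrow> (complex \<times> real) tensor2 \<Rightarrow> bool"
  where
  "extends_coord_formula f h S \<gamma> g \<longleftrightarrow> symmetric_tensor g \<and> continuous_tensor g \<and>
     (\<forall>x\<in>S. \<forall>u v. \<exists>D. (coords \<gamma> has_derivative D) (at (x, u, v)) \<and>
        (\<forall>dx du dv. g (coords \<gamma> (x, u, v)) (D (dx, du, dv)) (D (dx, du, dv)) =
           (cosh u - h x * sinh u)\<^sup>2 * dx\<^sup>2 + (du - f x * v * dx)\<^sup>2 + (dv + f x * u * dx)\<^sup>2))"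

end

theory Submission
  imports Defs
begin

text \<open>
  Lifted to the hyperboloid, the curve \<open>G\<close>, its tangent \<open>T\<close> and its normal \<open>U\<close> form a Lorentz frame.
  Since \<open>H\<close> is 1-Lipschitz, the Minkowski product of \<open>lift y\<close> and \<open>T x\<close> is strictly decreasing in \<open>x\<close>,
  and its unique zero \<open>foot y\<close> is the coordinate \<open>x\<close> of \<open>y\<close>; it is locally Lipschitz, while the
  coordinate \<open>u = height y\<close> is differentiable everywhere. Both are smooth where \<open>x \<in> S\<close>.

  The metric is the product metric plus terms containing the factor \<open>f(x) dx\<close>. These terms and all
  their derivatives lie in the ideal generated by the \<open>f\<^sup>(\<^sup>k\<^sup>)(x)\<close> in an algebra generated by the
  \<open>h\<^sup>(\<^sup>l\<^sup>)(x)\<close> and by locally bounded functions. By the hypothesis the elements of this ideal tend to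
  zero outside \<open>S\<close>, so that they extend by zero to differentiable functions.

  With \<open>w = cosh u - h sinh u\<close>, the coframe \<open>w dx\<close>, \<open>du - f v dx\<close>, \<open>dv + f u dx\<close> has the connection forms
  \<open>\<omega>\<^sub>1\<^sub>2 = (\<partial>w/\<partial>u) dx\<close>, \<open>\<omega>\<^sub>2\<^sub>3 = - f dx\<close> and \<open>\<omega>\<^sub>1\<^sub>3 = 0\<close>, all multiples of \<open>dx\<close>, so its curvature
  is the same as for \<open>f = 0\<close>. For completeness, \<open>sqrt (1 + u\<^sup>2 + v\<^sup>2)\<close> is 1-Lipschitz along curves, and
  where \<open>u\<close> is bounded \<open>dx\<close> is bounded by a multiple of \<open>w dx\<close>.
\<close>

section \<open>Calculus\<close>

text \<open>The obstacle is that smoothness is measured in the chart of the hyperbolic plane,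
  whereas \<open>foot\<close>, and with it every form built from dx, may be merely Lipschitz off
  \<open>S\<close>. That \<open>height\<close> is differentiable everywhere has one reason: the
  irregular rotation of the normal \<open>U\<close> is along \<open>T\<close>, and \<open>T\<close>
  is orthogonal to \<open>lift y\<close> at the foot point. The forms \<open>\<tau>\<close> = (cosh
  u - h sinh u) dx and \<open>\<nu>\<close> = du need not be smooth one by one; the sum of their
  squares is the hyperbolic metric, a rational expression of the chart without \<open>foot\<close>.
  The connection is split in the same way, into the product connection and a tensor
  \<open>Adiff\<close> with components in the ideal. Hence the Christoffel symbols are
  differentiable also over the complement of \<open>S\<close>, and the curvature there is that of
  the product. The Lipschitz constant 1 meets the strict inequality between the \<open>U\<close> and
  \<open>G\<close> components of \<open>lift y\<close>: this makes the foot point unique and keeps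
  cosh u - h sinh u at least exp(-|u|).\<close>

text \<open>A chain rule for an inner map that is only Lipschitz at \<open>y\<close>: the remainder
  of \<open>F\<close> is small compared with \<open>k z - k y\<close>, hence with
  \<open>z - y\<close>. It is applied to \<open>foot\<close> and to the pair of \<open>foot\<close>
  and \<open>H \<circ> foot\<close>, which need not be differentiable.\<close>

lemma has_derivative_zero_comp:
  fixes F :: "'b::real_normed_vector \<Rightarrow> 'c::real_normed_vector"
    and k :: "'a::real_normed_vector \<Rightarrow> 'b"
  assumes F: "(F has_derivative F') (at (k y))"
    and lip: "\<forall>\<^sub>F z in nhds y. norm (k z - k y) \<le> C * norm (z - y)"
  shows "((\<lambda>z. F (k z) - F' (k z)) has_derivative (\<lambda>_. 0)) (at y)"
  unfolding has_derivative_at_alt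
proof (intro conjI allI impI)
  fix e :: real assume e: "e > 0"
  interpret F': bounded_linear F' using F by (rule has_derivative_bounded_linear)
  define C' where "C' = max C 1"
  have C': "C' > 0" "C \<le> C'" by (auto simp: C'_def)
  from F have "\<forall>e>0. \<exists>d>0. \<forall>z. norm (z - k y) < d \<longrightarrow>
      norm (F z - F (k y) - F' (z - k y)) \<le> e * norm (z - k y)"
    unfolding has_derivative_at_alt by auto
  then obtain d where d: "d > 0" "\<And>z. norm (z - k y) < d \<Longrightarrow>
      norm (F z - F (k y) - F' (z - k y)) \<le> (e / C') * norm (z - k y)"
    using e C' by (meson divide_pos_pos)
  obtain d2 where d2: "d2 > 0" "\<And>z. norm (z - y) < d2 \<Longrightarrow> norm (k z - k y) \<le> C * norm (z - y)"
    using lip unfolding eventually_nhds_metric dist_norm by auto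
  show "\<exists>d>0. \<forall>z. norm (z - y) < d \<longrightarrow>
      norm (F (k z) - F' (k z) - (F (k y) - F' (k y)) - 0) \<le> e * norm (z - y)"
  proof (intro exI[of _ "min d2 (d / C')"] conjI allI impI)
    show "min d2 (d / C') > 0" using d d2 C' by auto
    fix z assume z: "norm (z - y) < min d2 (d / C')"
    have k: "norm (k z - k y) \<le> C' * norm (z - y)"
      using d2(2)[of z] z C'(2) mult_right_mono[OF C'(2), of "norm (z - y)"] by force
    also have "\<dots> < d" using z C' by (auto simp: field_simps)
    finally have "norm (F (k z) - F (k y) - F' (k z - k y)) \<le> (e / C') * norm (k z - k y)"
      by (rule d(2))
    also have "\<dots> \<le> (e / C') * (C' * norm (z - y))"
      using k e C' by (intro mult_left_mono) auto
    also have "\<dots> = e * norm (z - y)" using C' by simp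
    finally show "norm (F (k z) - F' (k z) - (F (k y) - F' (k y)) - 0) \<le> e * norm (z - y)"
      by (simp add: F'.diff algebra_simps)
  qed
qed auto

text \<open>At a zero of \<open>A\<close> continuity of \<open>B\<close> is enough for the product
  rule: \<open>A z\<close> is of order \<open>z - y\<close>, so its product with
  \<open>B z - B y\<close> is of smaller order. In the applications \<open>B\<close> is a frame
  vector at the foot point.\<close>

lemma has_derivative_mult_vanishing:
  fixes A :: "'a::real_normed_vector \<Rightarrow> 'b::real_normed_vector"
  assumes bb: "bounded_bilinear pr" and A: "(A has_derivative A') (at y)" and "A y = 0"
    and B: "isCont B y"
  shows "((\<lambda>z. pr (A z) (B z)) has_derivative (\<lambda>v. pr (A' v) (B y))) (at y)"
proof -
  interpret bounded_bilinear pr by fact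
  obtain K where K: "\<And>a b. norm (pr a b) \<le> norm a * norm b * K" "K > 0" using pos_bounded by blast
  have bl: "bounded_linear A'" using A by (rule has_derivative_bounded_linear)
  have 1: "((\<lambda>z. pr (A z) (B y)) has_derivative (\<lambda>v. pr (A' v) (B y))) (at y)"
    using bounded_linear.has_derivative[OF bounded_linear_left A] .
  have 2: "((\<lambda>z. pr (A z) (B z - B y)) has_derivative (\<lambda>v. 0)) (at y)"
    unfolding has_derivative_at_alt
  proof (intro conjI allI impI)
    fix e :: real assume e: "e > 0"
    obtain L where L: "L > 0" "\<And>v. norm (A' v) \<le> norm v * L"
      using bounded_linear.pos_bounded[OF bl] by blast
    obtain d1 where d1: "d1 > 0" "\<And>z. norm (z - y) < d1 \<Longrightarrow>
       norm (A z - A y - A' (z - y)) \<le> 1 * norm (z - y)"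
      using A unfolding has_derivative_at_alt by (meson zero_less_one)
    have "e / ((L + 1) * K) > 0" using e L K by auto
    then obtain d2 where d2: "d2 > 0" "\<And>z. dist z y < d2 \<Longrightarrow> dist (B z) (B y) < e / ((L + 1) * K)"
      using B unfolding continuous_at_eps_delta by blast
    show "\<exists>d>0. \<forall>z. norm (z - y) < d \<longrightarrow>
       norm (pr (A z) (B z - B y) - pr (A y) (B y - B y) - 0) \<le> e * norm (z - y)"
    proof (intro exI[of _ "min d1 d2"] conjI allI impI)
      fix z assume z: "norm (z - y) < min d1 d2"
      have "norm (A z) \<le> norm (A' (z - y)) + 1 * norm (z - y)"
        using d1(2)[of z] z \<open>A y = 0\<close> norm_triangle_ineq2[of "A z" "A' (z - y)"] by auto
      also have "\<dots> \<le> (L + 1) * norm (z - y)" using L(2)[of "z - y"] by (simp add: algebra_simps)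
      finally have a: "norm (A z) \<le> (L + 1) * norm (z - y)" .
      have b: "norm (B z - B y) \<le> e / ((L + 1) * K)" using d2(2)[of z] z by (auto simp: dist_norm)
      have "norm (pr (A z) (B z - B y)) \<le> norm (A z) * norm (B z - B y) * K" by (rule K)
      also have "\<dots> \<le> ((L + 1) * norm (z - y)) * (e / ((L + 1) * K)) * K"
        using a b K(2) L(1) by (intro mult_right_mono mult_mono) auto
      also have "\<dots> = e * norm (z - y)"
      proof -
        have "K + K * L \<noteq> 0" using K(2) L(1) by (simp add: add_pos_pos less_imp_neq[symmetric])
        then show ?thesis using K(2) L(1) by (simp add: field_simps)
      qed
      finally show "norm (pr (A z) (B z - B y) - pr (A y) (B y - B y) - 0) \<le> e * norm (z - y)"
        by (simp add: \<open>A y = 0\<close> zero_left)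
    qed (use d1 d2 in auto)
  qed auto
  have "((\<lambda>z. pr (A z) (B y) + pr (A z) (B z - B y)) has_derivative (\<lambda>v. pr (A' v) (B y) + 0)) (at y)"
    by (rule has_derivative_add[OF 1 2])
  then show ?thesis by (simp add: diff_right)
qed

text \<open>Monotonicity from one-sided local decrease, tolerating finitely many exceptional points.
  It serves both the merely Lipschitz \<open>H\<close> and piecewise smooth curves.\<close>

lemma right_decreasing_imp_le:
  fixes \<xi> :: "real \<Rightarrow> real"
  assumes cont: "continuous_on {a..b} \<xi>" and "finite E" and ab: "a \<le> b"
    and dec: "\<And>t. a < t \<Longrightarrow> t < b \<Longrightarrow> t \<notin> E \<Longrightarrow> \<forall>\<^sub>F s in at_right t. \<xi> s < \<xi> t"
  shows "\<xi> b \<le> \<xi> a"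
proof (rule ccontr)
  assume "\<not> \<xi> b \<le> \<xi> a"
  then have less: "\<xi> a < \<xi> b" by simp
  \<comment> \<open>A level between \<open>\<xi> a\<close> and \<open>\<xi> b\<close> that avoids
    the finitely many values on \<open>E\<close>: the last time at which \<open>\<xi>\<close> is at
    most \<open>l\<close> has value \<open>l\<close>, so it is not exceptional and violates the
    decrease.\<close>
  have "infinite {\<xi> a<..<\<xi> b}" using less by (simp add: infinite_Ioo)
  then have "\<not> {\<xi> a<..<\<xi> b} \<subseteq> \<xi> ` E" using \<open>finite E\<close> finite_subset by blast
  then obtain l where "l \<in> {\<xi> a<..<\<xi> b}" and lE: "l \<notin> \<xi> ` E" by blast
  then have l: "\<xi> a < l" "l < \<xi> b" "l \<notin> \<xi> ` E" by auto
  define Z where "Z = {t \<in> {a..b}. \<xi> t \<le> l}"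
  have "closed Z" unfolding Z_def
    by (intro continuous_on_closed_Collect_le cont continuous_intros)
  moreover have Zb: "Z \<subseteq> {a..b}" by (auto simp: Z_def)
  moreover have "a \<in> Z" using l ab by (auto simp: Z_def)
  ultimately have c: "Sup Z \<in> Z" by (intro closed_contains_Sup) (auto intro: bdd_above_mono)
  define c where "c = Sup Z"
  have cZ: "a \<le> c" "c \<le> b" "\<xi> c \<le> l" using c by (auto simp: Z_def c_def)
  have up: "t \<le> c" if "t \<in> Z" for t
    unfolding c_def using that Zb by (intro cSup_upper) (auto intro: bdd_above_mono)
  have cb: "c < b" using cZ l by (metis less_eq_real_def linorder_not_le)
  have gt: "\<xi> t > l" if "c < t" "t \<le> b" for t
    using up[of t] that cZ by (force simp: Z_def)
  have "\<xi> c = l"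
  proof (rule ccontr)
    assume "\<xi> c \<noteq> l"
    then have cl: "\<xi> c < l" using cZ by auto
    have "continuous_on {c..b} \<xi>" using cont cZ by (auto intro: continuous_on_subset)
    then obtain t where t: "c \<le> t" "t \<le> b" "\<xi> t = l"
      using IVT'[of \<xi> c l b] cl l cb by auto
    with cl have "c < t" by (metis less_eq_real_def order_less_irrefl)
    with gt[of t] t show False by auto
  qed
  then have "c \<notin> E" "a < c" using l cZ by (auto simp: less_le)
  then have "\<forall>\<^sub>F s in at_right c. \<xi> s < \<xi> c" using dec cb by auto
  moreover have "\<forall>\<^sub>F s in at_right c. s < b" using cb by (rule eventually_at_right_real[THEN eventually_mono]) auto
  moreover have "\<forall>\<^sub>F s in at_right c. c < s" by (simp add: eventually_at_right_less)
  ultimately have "\<forall>\<^sub>F s in at_right c. False"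
    by eventually_elim (use gt \<open>\<xi> c = l\<close> in force)
  then show False by simp
qed

text \<open>Only the derivative on \<open>W\<close> is controlled. On the segment from
  \<open>p\<close> to \<open>q\<close> the part after the last point outside \<open>W\<close> lies
  in \<open>W\<close>; \<open>F\<close> vanishes at that point, and the mean value theorem bounds
  \<open>F q\<close> by the small derivative near \<open>p\<close>.\<close>

lemma has_derivative_zero_extension:
  fixes F :: "'a::euclidean_space \<Rightarrow> real" and D :: "'a \<Rightarrow> 'a \<Rightarrow> real"
  assumes "open W" and cont: "continuous_on UNIV F" and zero: "\<And>q. q \<notin> W \<Longrightarrow> F q = 0"
    and D: "\<And>q. q \<in> W \<Longrightarrow> (F has_derivative D q) (at q)"
    and lim: "\<And>a. ((\<lambda>q. D q a) \<longlongrightarrow> 0) (at p within W)" and p: "p \<notin> W"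
  shows "(F has_derivative (\<lambda>_. 0)) (at p)"
  unfolding has_derivative_at_alt
proof (intro conjI allI impI)
  fix e :: real assume e: "e > 0"
  have "((\<lambda>q. \<Sum>b\<in>Basis. \<bar>D q b\<bar>) \<longlongrightarrow> (\<Sum>b\<in>(Basis::'a set). \<bar>0\<bar>)) (at p within W)"
    by (intro tendsto_sum tendsto_rabs lim)
  then have "\<forall>\<^sub>F q in at p within W. (\<Sum>b\<in>Basis. \<bar>D q b\<bar>) < e"
    using e by (auto dest!: order_tendstoD(2)[where a = e])
  then obtain d where d: "d > 0" "\<And>q. q \<in> W \<Longrightarrow> dist q p < d \<Longrightarrow> (\<Sum>b\<in>Basis. \<bar>D q b\<bar>) < e"
    unfolding eventually_at using p by metis
  have bd: "\<bar>D q a\<bar> \<le> e * norm a" if "q \<in> W" "dist q p < d" for q a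
  proof -
    interpret bounded_linear "D q" using D[OF that(1)] by (rule has_derivative_bounded_linear)
    have "D q a = D q (\<Sum>b\<in>Basis. (a \<bullet> b) *\<^sub>R b)" by (simp add: euclidean_representation)
    also have "\<dots> = (\<Sum>b\<in>Basis. (a \<bullet> b) * D q b)" by (simp add: sum scaleR)
    also have "\<bar>\<dots>\<bar> \<le> (\<Sum>b\<in>Basis. \<bar>(a \<bullet> b) * D q b\<bar>)" by (rule sum_abs)
    also have "\<dots> \<le> (\<Sum>b\<in>Basis. norm a * \<bar>D q b\<bar>)"
      by (intro sum_mono) (auto simp: abs_mult Basis_le_norm intro: mult_right_mono)
    also have "\<dots> = norm a * (\<Sum>b\<in>Basis. \<bar>D q b\<bar>)" by (simp add: sum_distrib_left)
    also have "\<dots> \<le> norm a * e" using d(2)[OF that] by (intro mult_left_mono) auto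
    finally show ?thesis by (simp add: mult.commute)
  qed
  show "\<exists>d>0. \<forall>q. norm (q - p) < d \<longrightarrow> norm (F q - F p - 0) \<le> e * norm (q - p)"
  proof (intro exI[of _ d] conjI allI impI d(1))
    fix q assume q: "norm (q - p) < d"
    show "norm (F q - F p - 0) \<le> e * norm (q - p)"
    proof (cases "q \<in> W")
      case False then show ?thesis using zero p e by auto
    next
      case True
      define c where "c t = p + t *\<^sub>R (q - p)" for t
      have cc: "continuous_on A c" for A unfolding c_def by (intro continuous_intros)
      define Z where "Z = {t \<in> {0..1}. c t \<notin> W}"
      have "Z = {0..1} \<inter> c -` (- W)" by (auto simp: Z_def)
      moreover have "closed ({0..1} \<inter> c -` (- W))"
        by (intro continuous_closed_preimage cc) (use \<open>open W\<close> in auto)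
      ultimately have "closed Z" by simp
      moreover have "0 \<in> Z" using p by (auto simp: Z_def c_def)
      moreover have bb: "bdd_above Z" by (auto simp: Z_def)
      ultimately have sZ: "Sup Z \<in> Z" by (intro closed_contains_Sup) auto
      define t0 where "t0 = Sup Z"
      have t0: "0 \<le> t0" "t0 \<le> 1" "c t0 \<notin> W" using sZ by (auto simp: Z_def t0_def)
      have "c 1 = q" by (simp add: c_def)
      then have "t0 < 1" using True t0 by (metis less_eq_real_def)
      have inW: "c t \<in> W" if "t0 < t" "t \<le> 1" for t
        using cSup_upper[OF _ bb, of t] that t0 by (force simp: Z_def t0_def)
      have near: "dist (c t) p < d" if "t0 < t" "t \<le> 1" for t
      proof -
        have "dist (c t) p = t * norm (q - p)" using that t0 by (simp add: c_def dist_norm)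
        also have "\<dots> \<le> 1 * norm (q - p)" using that by (intro mult_right_mono) auto
        finally show ?thesis using q by simp
      qed
      have cder: "(c has_derivative (\<lambda>s. s *\<^sub>R (q - p))) (at t)" for t
        unfolding c_def by (auto intro!: derivative_eq_intros)
      have der: "((\<lambda>s. F (c s)) has_derivative (\<lambda>s. D (c t) (s *\<^sub>R (q - p)))) (at t)"
        if "t0 < t" "t < 1" for t
        using has_derivative_compose[OF cder D[OF inW]] that by simp
      have "continuous_on {t0..1} (\<lambda>s. F (c s))"
        using continuous_on_compose2[OF cont cc] by auto
      then obtain \<xi> where \<xi>: "t0 < \<xi>" "\<xi> < 1" and
        eq: "F (c 1) - F (c t0) = D (c \<xi>) ((1 - t0) *\<^sub>R (q - p))"
        using mvt[OF \<open>t0 < 1\<close> _ der] by blast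
      have "\<bar>F q\<bar> = \<bar>D (c \<xi>) ((1 - t0) *\<^sub>R (q - p))\<bar>"
        using eq zero[OF t0(3)] \<open>c 1 = q\<close> by simp
      also have "\<dots> \<le> e * norm ((1 - t0) *\<^sub>R (q - p))"
        using \<xi> by (intro bd inW near) auto
      also have "\<dots> = (1 - t0) * (e * norm (q - p))" using t0 by simp
      also have "\<dots> \<le> 1 * (e * norm (q - p))" using t0 e by (intro mult_right_mono) auto
      finally show ?thesis using zero[OF p] by simp
    qed
  qed
qed auto

text \<open>The mean value theorem twice: in direction \<open>a\<close> for the difference of
  \<open>F\<close> across \<open>h *\<^sub>R b\<close>, and in direction \<open>b\<close> for
  \<open>F' q a\<close>.\<close>

lemma second_difference_mvt:
  fixes F :: "'a::real_normed_vector \<Rightarrow> real"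
  assumes F: "\<And>q. q \<in> W \<Longrightarrow> (F has_derivative F' q) (at q)"
    and Fa: "\<And>q. q \<in> W \<Longrightarrow> ((\<lambda>q. F' q a) has_derivative Fa q) (at q)"
    and h: "h > 0" "\<And>s t. 0 \<le> s \<Longrightarrow> s \<le> h \<Longrightarrow> 0 \<le> t \<Longrightarrow> t \<le> h \<Longrightarrow> p + s *\<^sub>R a + t *\<^sub>R b \<in> W"
  obtains \<xi> \<eta> where "0 < \<xi>" "\<xi> < h" "0 < \<eta>" "\<eta> < h"
    "F (p + h *\<^sub>R a + h *\<^sub>R b) - F (p + h *\<^sub>R a) - F (p + h *\<^sub>R b) + F p
       = h * (h * Fa (p + \<xi> *\<^sub>R a + \<eta> *\<^sub>R b) b)"
proof -
  have lin: "linear (F' q)" if "q \<in> W" for q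
    using F[OF that] has_derivative_bounded_linear bounded_linear.linear by blast
  have lina: "linear (Fa q)" if "q \<in> W" for q
    using Fa[OF that] has_derivative_bounded_linear bounded_linear.linear by blast
  define g where "g s = F (p + s *\<^sub>R a + h *\<^sub>R b) - F (p + s *\<^sub>R a + 0 *\<^sub>R b)" for s
  have da: "((\<lambda>s. F (p + s *\<^sub>R a + t *\<^sub>R b)) has_derivative
       (\<lambda>r. F' (p + s *\<^sub>R a + t *\<^sub>R b) (r *\<^sub>R a))) (at s)"
    if "0 \<le> s" "s \<le> h" "0 \<le> t" "t \<le> h" for s t
    by (rule has_derivative_compose[where f = "\<lambda>s. p + s *\<^sub>R a + t *\<^sub>R b" and g = F, OF _ F[OF h(2)[OF that]]])
      (auto intro!: derivative_eq_intros)
  have dg: "(g has_derivative (\<lambda>r. F' (p + s *\<^sub>R a + h *\<^sub>R b) (r *\<^sub>R a)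
       - F' (p + s *\<^sub>R a + 0 *\<^sub>R b) (r *\<^sub>R a))) (at s)" if "0 \<le> s" "s \<le> h" for s
    unfolding g_def by (intro has_derivative_diff da) (use that h in auto)
  have "continuous_on {0..h} g"
    by (intro continuous_at_imp_continuous_on ballI has_derivative_continuous[OF dg]) auto
  then obtain \<xi> where \<xi>: "0 < \<xi>" "\<xi> < h" and
    eq: "g h - g 0 = F' (p + \<xi> *\<^sub>R a + h *\<^sub>R b) ((h - 0) *\<^sub>R a) - F' (p + \<xi> *\<^sub>R a + 0 *\<^sub>R b) ((h - 0) *\<^sub>R a)"
    using mvt[OF h(1) _ dg] by (metis less_imp_le)
  define k where "k t = F' (p + \<xi> *\<^sub>R a + t *\<^sub>R b) a" for t
  have dk: "(k has_derivative (\<lambda>r. Fa (p + \<xi> *\<^sub>R a + t *\<^sub>R b) (r *\<^sub>R b))) (at t)"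
    if "0 \<le> t" "t \<le> h" for t
    unfolding k_def
    by (rule has_derivative_compose[where f = "\<lambda>t. p + \<xi> *\<^sub>R a + t *\<^sub>R b" and g = "\<lambda>q. F' q a", OF _ Fa[OF h(2)]])
      (use that \<xi> in \<open>auto intro!: derivative_eq_intros\<close>)
  have "continuous_on {0..h} k"
    by (intro continuous_at_imp_continuous_on ballI has_derivative_continuous[OF dk]) auto
  then obtain \<eta> where \<eta>: "0 < \<eta>" "\<eta> < h" and
    eq2: "k h - k 0 = Fa (p + \<xi> *\<^sub>R a + \<eta> *\<^sub>R b) ((h - 0) *\<^sub>R b)"
    using mvt[OF h(1) _ dk] by (metis less_imp_le)
  have W: "p + \<xi> *\<^sub>R a + t *\<^sub>R b \<in> W" if "0 \<le> t" "t \<le> h" for t using \<xi> that h(2) by auto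
  have "g h - g 0 = h * (k h - k 0)"
    using eq lin[OF W[of h]] lin[OF W[of 0]] h(1) by (simp add: k_def linear_cmul algebra_simps)
  also have "k h - k 0 = h * Fa (p + \<xi> *\<^sub>R a + \<eta> *\<^sub>R b) b"
    using eq2 lina[OF W[of \<eta>]] \<eta> by (simp add: linear_cmul)
  finally show thesis using that[OF \<xi> \<eta>] by (simp add: g_def algebra_simps)
qed

text \<open>Schwarz's theorem. Exchanging \<open>a\<close> and \<open>b\<close> does not change the
  second difference, so some value of one mixed derivative near \<open>p\<close> equals some value
  of the other; continuity at \<open>p\<close> concludes.\<close>

lemma second_derivative_symmetric:
  fixes F :: "'a::real_normed_vector \<Rightarrow> real"
  assumes "open W" "p \<in> W"
    and F: "\<And>q. q \<in> W \<Longrightarrow> (F has_derivative F' q) (at q)"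
    and Fa: "\<And>q. q \<in> W \<Longrightarrow> ((\<lambda>q. F' q a) has_derivative Fa q) (at q)"
    and Fb: "\<And>q. q \<in> W \<Longrightarrow> ((\<lambda>q. F' q b) has_derivative Fb q) (at q)"
    and ca: "isCont (\<lambda>q. Fa q b) p" and cb: "isCont (\<lambda>q. Fb q a) p"
  shows "Fa p b = Fb p a"
proof (rule ccontr)
  assume "Fa p b \<noteq> Fb p a"
  define e where "e = \<bar>Fa p b - Fb p a\<bar> / 2"
  have e: "e > 0" using \<open>Fa p b \<noteq> Fb p a\<close> by (simp add: e_def)
  obtain d1 where d1: "d1 > 0" "\<And>q. dist q p < d1 \<Longrightarrow> dist (Fa q b) (Fa p b) < e"
    using ca e unfolding continuous_at_eps_delta by blast
  obtain d2 where d2: "d2 > 0" "\<And>q. dist q p < d2 \<Longrightarrow> dist (Fb q a) (Fb p a) < e"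
    using cb e unfolding continuous_at_eps_delta by blast
  obtain d3 where d3: "d3 > 0" "\<And>q. dist q p < d3 \<Longrightarrow> q \<in> W"
    using assms(1,2) open_dist by blast
  define d where "d = min d1 (min d2 d3)"
  have d: "d > 0" using d1 d2 d3 by (simp add: d_def)
  \<comment> \<open>This size keeps the parallelogram spanned by \<open>h *\<^sub>R a\<close> and
    \<open>h *\<^sub>R b\<close> within distance \<open>d\<close> of \<open>p\<close>; the summand 1
    covers \<open>a = b = 0\<close>.\<close>
  define h where "h = d / (norm a + norm b + 1)"
  have h: "h > 0" using d by (simp add: h_def add_nonneg_pos)
  have near: "dist (p + s *\<^sub>R a + t *\<^sub>R b) p < d" if "0 \<le> s" "s \<le> h" "0 \<le> t" "t \<le> h" for s t
  proof -
    have "dist (p + s *\<^sub>R a + t *\<^sub>R b) p \<le> s * norm a + t * norm b"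
      using norm_triangle_ineq[of "s *\<^sub>R a" "t *\<^sub>R b"] that by (simp add: dist_norm)
    also have "\<dots> \<le> h * norm a + h * norm b" using that by (intro add_mono mult_right_mono) auto
    also have "\<dots> < h * (norm a + norm b + 1)" using h by (simp add: algebra_simps)
    also have "\<dots> = d" using add_nonneg_pos[of "norm a + norm b" 1] by (simp add: h_def)
    finally show ?thesis .
  qed
  have W: "p + s *\<^sub>R a + t *\<^sub>R b \<in> W" if "0 \<le> s" "s \<le> h" "0 \<le> t" "t \<le> h" for s t
    using near[OF that] d3(2) by (simp add: d_def)
  have W': "p + s *\<^sub>R b + t *\<^sub>R a \<in> W" if "0 \<le> s" "s \<le> h" "0 \<le> t" "t \<le> h" for s t
    using W[of t s] that by (simp add: algebra_simps)
  obtain \<xi> \<eta> where A: "0 < \<xi>" "\<xi> < h" "0 < \<eta>" "\<eta> < h"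
    "F (p + h *\<^sub>R a + h *\<^sub>R b) - F (p + h *\<^sub>R a) - F (p + h *\<^sub>R b) + F p
       = h * (h * Fa (p + \<xi> *\<^sub>R a + \<eta> *\<^sub>R b) b)"
    using second_difference_mvt[OF F Fa h W] by blast
  obtain \<xi>' \<eta>' where B: "0 < \<xi>'" "\<xi>' < h" "0 < \<eta>'" "\<eta>' < h"
    "F (p + h *\<^sub>R b + h *\<^sub>R a) - F (p + h *\<^sub>R b) - F (p + h *\<^sub>R a) + F p
       = h * (h * Fb (p + \<xi>' *\<^sub>R b + \<eta>' *\<^sub>R a) a)"
    using second_difference_mvt[OF F Fb h W'] by blast
  have "F (p + h *\<^sub>R b + h *\<^sub>R a) = F (p + h *\<^sub>R a + h *\<^sub>R b)" by (simp add: algebra_simps)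
  with A(5) B(5) have "h * (h * Fa (p + \<xi> *\<^sub>R a + \<eta> *\<^sub>R b) b) = h * (h * Fb (p + \<eta>' *\<^sub>R a + \<xi>' *\<^sub>R b) a)"
    by (simp add: algebra_simps)
  then have "Fa (p + \<xi> *\<^sub>R a + \<eta> *\<^sub>R b) b = Fb (p + \<eta>' *\<^sub>R a + \<xi>' *\<^sub>R b) a" using h by simp
  moreover have "dist (Fa (p + \<xi> *\<^sub>R a + \<eta> *\<^sub>R b) b) (Fa p b) < e"
    using near[of \<xi> \<eta>] A by (intro d1) (auto simp: d_def)
  moreover have "dist (Fb (p + \<eta>' *\<^sub>R a + \<xi>' *\<^sub>R b) a) (Fb p a) < e"
    using near[of \<eta>' \<xi>'] B by (intro d2) (auto simp: d_def)
  ultimately show False unfolding e_def dist_real_def by argo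
qed

text \<open>A class of functions closed under directional derivatives consists of smooth functions.
  This replaces formulas for higher derivatives.\<close>

lemma smooth_coinduct:
  assumes "F \<in> K"
    and K: "\<And>F. F \<in> K \<Longrightarrow> \<exists>F'. (\<forall>a. (\<lambda>p. F' p a) \<in> K) \<and> (\<forall>p. (F has_derivative F' p) (at p))"
  shows "smooth F"
proof -
  have "\<forall>F\<in>K. C_k k F" for k
  proof (induction k)
    case 0
    show ?case using K by (fastforce intro: continuous_at_imp_continuous_on has_derivative_continuous)
  next
    case (Suc k)
    show ?case
    proof
      fix F assume "F \<in> K"
      then obtain F' where F': "\<And>a. (\<lambda>p. F' p a) \<in> K" "\<And>p. (F has_derivative F' p) (at p)"
        using K by metis
      moreover have "frechet_derivative F (at p) = F' p" for p
        using frechet_derivative_at[OF F'(2)] by simp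
      ultimately show "C_k (Suc k) F" using Suc by (auto simp: differentiable_def)
    qed
  qed
  then show ?thesis using \<open>F \<in> K\<close> by (simp add: smooth_def)
qed

section \<open>Lengths of curves\<close>

text \<open>A relation and not a function, so that having a length includes integrability of the
  speed.\<close>

definition arclen :: "'a::euclidean_space tensor2 \<Rightarrow> (real \<Rightarrow> 'a) \<Rightarrow> real \<Rightarrow> bool" where
  "arclen g c L \<longleftrightarrow> valid_path c \<and>
     ((\<lambda>t. sqrt (g (c t) (vector_derivative c (at t)) (vector_derivative c (at t)))) has_integral L) {0..1}"

lemma riem_dist_eq: "riem_dist g p q = Inf {L. \<exists>c. arclen g c L \<and> pathstart c = p \<and> pathfinish c = q}"
  unfolding riem_dist_def arclen_def by (rule arg_cong[where f = Inf]) auto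

locale continuous_metric =
  fixes g :: "'a::euclidean_space tensor2"
  assumes sym_g: "symmetric_tensor g" and pos_g: "\<And>p a. a \<noteq> 0 \<Longrightarrow> g p a a > 0"
    and cont_g: "continuous_tensor g"
begin

lemma bilinear_g: "bilinear (g p)" and g_commute: "g p a b = g p b a"
  using sym_g by (auto simp: symmetric_tensor_def)

lemma g_scale: "g p (r *\<^sub>R a) (r *\<^sub>R a) = r\<^sup>2 * g p a a"
  using bilinear_lmul[OF bilinear_g, of p r a] bilinear_rmul[OF bilinear_g, of p _ r a]
  by (simp add: power2_eq_square)

lemma g_minus: "g p (- a) (- a) = g p a a"
  using g_scale[of p "-1" a] by simp

lemma g_nonneg: "g p a a \<ge> 0"
  using pos_g[of a p] bilinear_lzero[OF bilinear_g, of p] by (cases "a = 0") (auto intro: less_imp_le)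

text \<open>Reduces joint continuity in the point and both vectors to continuity of finitely many
  coefficients.\<close>

lemma g_sum: "g p a b = (\<Sum>(i,j)\<in>Basis \<times> Basis. (a \<bullet> i) * (b \<bullet> j) * g p i j)"
proof -
  have "g p a b = g p (\<Sum>i\<in>Basis. (a \<bullet> i) *\<^sub>R i) (\<Sum>j\<in>Basis. (b \<bullet> j) *\<^sub>R j)"
    by (simp add: euclidean_representation)
  also have "\<dots> = (\<Sum>(i,j)\<in>Basis \<times> Basis. g p ((a \<bullet> i) *\<^sub>R i) ((b \<bullet> j) *\<^sub>R j))"
    by (rule bilinear_sum[OF bilinear_g])
  also have "\<dots> = (\<Sum>(i,j)\<in>Basis \<times> Basis. (a \<bullet> i) * (b \<bullet> j) * g p i j)"
    by (rule sum.cong) (auto simp: bilinear_lmul[OF bilinear_g] bilinear_rmul[OF bilinear_g])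
  finally show ?thesis .
qed

lemma continuous_g:
  assumes "continuous_on A c" "continuous_on A a" "continuous_on A b"
  shows "continuous_on A (\<lambda>t. g (c t) (a t) (b t))"
proof -
  have "continuous_on A (\<lambda>t. g (c t) i j)" for i j
    using cont_g assms(1) unfolding continuous_tensor_def
    by (auto intro: continuous_on_compose2[of UNIV "\<lambda>p. g p i j"])
  note c = this
  have eq: "(\<lambda>t. g (c t) (a t) (b t)) =
      (\<lambda>t. \<Sum>(i,j)\<in>Basis \<times> Basis. (a t \<bullet> i) * (b t \<bullet> j) * g (c t) i j)"
    by (rule ext) (rule g_sum)
  show ?thesis unfolding eq case_prod_unfold by (intro continuous_intros assms c)
qed

text \<open>Compactness of the unit sphere bundle over \<open>K\<close>, extended to all vectors by
  homogeneity.\<close>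

lemma bounds_on_compact:
  assumes "compact K"
  obtains m C where "m > 0" "C > 0"
    "\<And>p a. p \<in> K \<Longrightarrow> m * norm a \<le> sqrt (g p a a)" "\<And>p a. p \<in> K \<Longrightarrow> sqrt (g p a a) \<le> C * norm a"
proof (cases "K = {}")
  case False
  define s where "s = (\<lambda>(p, a). sqrt (g p a a))"
  have K: "compact (K \<times> sphere (0::'a) 1)" using assms by (intro compact_Times) auto
  have ne: "K \<times> sphere (0::'a) 1 \<noteq> {}" using False by simp
  have cont: "continuous_on (K \<times> sphere 0 1) s"
    unfolding s_def case_prod_unfold by (intro continuous_intros continuous_g)
  obtain z where z: "z \<in> K \<times> sphere 0 1" "\<And>y. y \<in> K \<times> sphere 0 1 \<Longrightarrow> s z \<le> s y"
    using continuous_attains_inf[OF K ne cont] by blast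
  obtain z' where z': "z' \<in> K \<times> sphere 0 1" "\<And>y. y \<in> K \<times> sphere 0 1 \<Longrightarrow> s y \<le> s z'"
    using continuous_attains_sup[OF K ne cont] by blast
  have pos: "s y > 0" if "y \<in> K \<times> sphere 0 1" for y
    using pos_g[of "snd y" "fst y"] that by (force simp: s_def case_prod_unfold mem_Times_iff)
  have scale: "sqrt (g p a a) = s (p, a /\<^sub>R norm a) * norm a" "(p, a /\<^sub>R norm a) \<in> K \<times> sphere 0 1"
    if "p \<in> K" "a \<noteq> 0" for p a
  proof -
    have "sqrt (g p a a) = sqrt (g p (norm a *\<^sub>R (a /\<^sub>R norm a)) (norm a *\<^sub>R (a /\<^sub>R norm a)))"
      using that by simp
    also have "\<dots> = norm a * sqrt (g p (a /\<^sub>R norm a) (a /\<^sub>R norm a))"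
      by (simp only: g_scale real_sqrt_mult) simp
    finally show "sqrt (g p a a) = s (p, a /\<^sub>R norm a) * norm a" by (simp add: s_def mult.commute)
    show "(p, a /\<^sub>R norm a) \<in> K \<times> sphere 0 1" using that by simp
  qed
  have zero: "sqrt (g p 0 0) = 0" for p by (simp add: bilinear_lzero[OF bilinear_g])
  show ?thesis
  proof (rule that[OF pos[OF z(1)] pos[OF z'(1)]])
    fix p a assume "p \<in> K"
    note scale = scale[OF this]
    show "s z * norm a \<le> sqrt (g p a a)" "sqrt (g p a a) \<le> s z' * norm a"
      by (cases "a = 0"; simp add: zero scale(1) mult_right_mono[OF z(2)[OF scale(2)]] mult_right_mono[OF z'(2)[OF scale(2)]])+
  qed
qed (rule that[of 1 1]; simp)

lemma arclen_nonneg: "arclen g c L \<Longrightarrow> L \<ge> 0"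
  unfolding arclen_def using g_nonneg by (auto intro: has_integral_nonneg)

lemma arclen_reversepath:
  assumes "arclen g c L"
  shows "arclen g (reversepath c) L"
proof -
  define s where "s c t = sqrt (g (c t) (vector_derivative c (at t)) (vector_derivative c (at t)))"
    for c :: "real \<Rightarrow> 'a" and t
  obtain E where E: "finite E" "c C1_differentiable_on {0..1} - E"
    using assms by (auto simp: arclen_def valid_path_def piecewise_C1_differentiable_on_def)
  have "((\<lambda>t. s c (1 - t)) has_integral L) {0..1}"
    using has_integral_affinity01[where m= "-1" and c=1, of "s c" L] assms
    by (simp add: arclen_def s_def[abs_def])
  note I = this
  have eq: "s (reversepath c) t = s c (1 - t)" if "t \<in> {0..1} - (\<lambda>t. 1 - t) ` E" for t
  proof -
    have "1 - t \<notin> E"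
    proof
      assume "1 - t \<in> E"
      then have "t \<in> (\<lambda>t. 1 - t) ` E" by (rule rev_image_eqI) simp
      then show False using that by simp
    qed
    then have "1 - t \<in> {0..1} - E" using that by auto
    then obtain d where d: "(c has_vector_derivative d) (at (1 - t))"
      using E(2) unfolding C1_differentiable_on_def by blast
    have "(c \<circ> (\<lambda>t. 1 - t) has_vector_derivative -1 *\<^sub>R d) (at t)"
      by (rule vector_diff_chain_at[where f = "\<lambda>t. 1 - t" and g = c, OF _ d]) (auto intro!: derivative_eq_intros simp: has_vector_derivative_def)
    then have "vector_derivative (reversepath c) (at t) = - d"
      by (simp add: reversepath_def o_def vector_derivative_at)
    then show ?thesis
      using vector_derivative_at[OF d] by (simp add: s_def g_minus reversepath_def)
  qed
  have "(s (reversepath c) has_integral L) {0..1}"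
    by (rule has_integral_spike_finite[where S = "(\<lambda>t. 1 - t) ` E", OF _ eq I]) (use E(1) in simp_all)
  then show ?thesis using assms by (simp add: arclen_def s_def[abs_def])
qed

lemma arclen_join:
  assumes "arclen g c1 L1" "arclen g c2 L2" "pathfinish c1 = pathstart c2"
  shows "arclen g (c1 +++ c2) (L1 + L2)"
proof -
  define s where "s c t = sqrt (g (c t) (vector_derivative c (at t)) (vector_derivative c (at t)))"
    for c :: "real \<Rightarrow> 'a" and t
  obtain E1 where E1: "finite E1" "c1 C1_differentiable_on {0..1} - E1"
    using assms by (auto simp: arclen_def valid_path_def piecewise_C1_differentiable_on_def)
  obtain E2 where E2: "finite E2" "c2 C1_differentiable_on {0..1} - E2"
    using assms by (auto simp: arclen_def valid_path_def piecewise_C1_differentiable_on_def)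
  have 1: "((\<lambda>t. 2 * s c1 (2 * t)) has_integral L1) {0..1/2}"
    using has_integral_affinity01[of "s c1" L1, where m= 2 and c=0, THEN has_integral_cmul [where c=2]] assms
    by (simp add: image_affinity_atLeastAtMost_div_diff arclen_def s_def[abs_def])
  have 2: "((\<lambda>t. 2 * s c2 (2 * t - 1)) has_integral L2) {1/2..1}"
    using image_affinity_atLeastAtMost_div[of 2 "1/2" 0 "1::real"] has_integral_affinity01[of "s c2" L2, where m= 2 and c="-1", THEN has_integral_cmul [where c=2]] assms
    by (simp add: image_affinity_atLeastAtMost_div_diff arclen_def s_def[abs_def])
  \<comment> \<open>The midpoint joins the exceptional points because the joined path may have a
    corner there.\<close>
  have g1: "s (c1 +++ c2) t = 2 * s c1 (2 * t)"
    if "t \<in> {0..1/2} - insert (1/2) ((\<lambda>t. t / 2) ` E1)" for t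
  proof -
    have "2 * t \<notin> E1"
    proof
      assume "2 * t \<in> E1"
      then have "t \<in> (\<lambda>t. t / 2) ` E1" by (rule rev_image_eqI) simp
      then show False using that by simp
    qed
    then have "2 * t \<in> {0..1} - E1" using that by auto
    then obtain d where d: "(c1 has_vector_derivative d) (at (2 * t))"
      using E1(2) unfolding C1_differentiable_on_def by blast
    have "(c1 \<circ> (\<lambda>t. 2 * t) has_vector_derivative 2 *\<^sub>R d) (at t)"
      by (rule vector_diff_chain_at[where f = "\<lambda>t. 2 * t" and g = c1, OF _ d]) (auto intro!: derivative_eq_intros simp: has_vector_derivative_def)
    then have "((c1 +++ c2) has_vector_derivative 2 *\<^sub>R d) (at t)"
      by (rule has_vector_derivative_transform_within_open[where S = "{..<1/2}"])
        (use that in \<open>auto simp: joinpaths_def\<close>)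
    then have "vector_derivative (c1 +++ c2) (at t) = 2 *\<^sub>R d" by (rule vector_derivative_at)
    then show ?thesis
      using vector_derivative_at[OF d] that by (simp add: s_def g_scale joinpaths_def real_sqrt_mult)
  qed
  have g2: "s (c1 +++ c2) t = 2 * s c2 (2 * t - 1)"
    if "t \<in> {1/2..1} - insert (1/2) ((\<lambda>t. (t + 1) / 2) ` E2)" for t
  proof -
    have "2 * t - 1 \<notin> E2"
    proof
      assume "2 * t - 1 \<in> E2"
      then have "t \<in> (\<lambda>t. (t + 1) / 2) ` E2" by (rule rev_image_eqI) simp
      then show False using that by simp
    qed
    then have "2 * t - 1 \<in> {0..1} - E2" using that by auto
    then obtain d where d: "(c2 has_vector_derivative d) (at (2 * t - 1))"
      using E2(2) unfolding C1_differentiable_on_def by blast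
    have "(c2 \<circ> (\<lambda>t. 2 * t - 1) has_vector_derivative 2 *\<^sub>R d) (at t)"
      by (rule vector_diff_chain_at[where f = "\<lambda>t. 2 * t - 1" and g = c2, OF _ d]) (auto intro!: derivative_eq_intros simp: has_vector_derivative_def)
    then have "((c1 +++ c2) has_vector_derivative 2 *\<^sub>R d) (at t)"
      by (rule has_vector_derivative_transform_within_open[where S = "{1/2<..}"])
        (use that in \<open>auto simp: joinpaths_def\<close>)
    then have "vector_derivative (c1 +++ c2) (at t) = 2 *\<^sub>R d" by (rule vector_derivative_at)
    then show ?thesis
      using vector_derivative_at[OF d] that by (simp add: s_def g_scale joinpaths_def real_sqrt_mult)
  qed
  have "(s (c1 +++ c2) has_integral L1) {0..1/2}"
    by (rule has_integral_spike_finite[where S = "insert (1/2) ((\<lambda>t. t / 2) ` E1)", OF _ g1 1]) (use E1(1) in simp_all)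
  moreover have "(s (c1 +++ c2) has_integral L2) {1/2..1}"
    by (rule has_integral_spike_finite[where S = "insert (1/2) ((\<lambda>t. (t + 1) / 2) ` E2)", OF _ g2 2]) (use E2(1) in simp_all)
  ultimately have "(s (c1 +++ c2) has_integral (L1 + L2)) {0..1}"
    by (rule has_integral_combine[rotated 2]) auto
  moreover have "valid_path (c1 +++ c2)" using assms by (auto simp: arclen_def intro: valid_path_join)
  ultimately show ?thesis by (simp add: arclen_def s_def[abs_def])
qed

lemma arclen_linepath:
  "arclen g (linepath p q) (integral {0..1} (\<lambda>t. sqrt (g (linepath p q t) (q - p) (q - p))))"
proof -
  have "continuous_on {0..1} (\<lambda>t. sqrt (g (linepath p q t) (q - p) (q - p)))"
    by (intro continuous_intros continuous_g)
  from integrable_integral[OF integrable_continuous_real[OF this]]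
  show ?thesis by (simp add: arclen_def)
qed

lemma lengths_nonempty: "{L. \<exists>c. arclen g c L \<and> pathstart c = p \<and> pathfinish c = q} \<noteq> {}"
  using arclen_linepath[of p q] pathstart_linepath pathfinish_linepath by blast

lemma riem_dist_le: "arclen g c L \<Longrightarrow> riem_dist g (pathstart c) (pathfinish c) \<le> L"
  unfolding riem_dist_eq
proof (rule cInf_lower)
  show "bdd_below {L. \<exists>ca. arclen g ca L \<and> pathstart ca = pathstart c \<and> pathfinish ca = pathfinish c}"
    by (rule bdd_belowI[of _ 0]) (auto dest: arclen_nonneg)
qed auto

lemma riem_dist_nonneg: "riem_dist g p q \<ge> 0"
  unfolding riem_dist_eq by (rule cInf_greatest[OF lengths_nonempty]) (auto dest: arclen_nonneg)

lemma riem_dist_less: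
  assumes "riem_dist g p q < r"
  obtains c L where "arclen g c L" "pathstart c = p" "pathfinish c = q" "L < r"
  using cInf_lessD[OF lengths_nonempty assms[unfolded riem_dist_eq]] by auto

lemma riem_dist_commute: "riem_dist g p q = riem_dist g q p"
proof -
  have "riem_dist g p q \<le> riem_dist g q p" for p q
  proof (rule dense_ge)
    fix r assume "riem_dist g q p < r"
    then obtain c L where "arclen g c L" "pathstart c = q" "pathfinish c = p" "L < r"
      by (rule riem_dist_less)
    then show "riem_dist g p q \<le> r" using riem_dist_le[OF arclen_reversepath, of c L] by simp
  qed
  then show ?thesis by (simp add: order_antisym)
qed

lemma riem_dist_triangle: "riem_dist g p r \<le> riem_dist g p q + riem_dist g q r"
proof (rule field_le_epsilon)
  fix e :: real assume e: "e > 0"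
  obtain c1 L1 where 1: "arclen g c1 L1" "pathstart c1 = p" "pathfinish c1 = q" "L1 < riem_dist g p q + e/2"
    using riem_dist_less[of p q "riem_dist g p q + e/2"] e by auto
  obtain c2 L2 where 2: "arclen g c2 L2" "pathstart c2 = q" "pathfinish c2 = r" "L2 < riem_dist g q r + e/2"
    using riem_dist_less[of q r "riem_dist g q r + e/2"] e by auto
  show "riem_dist g p r \<le> riem_dist g p q + riem_dist g q r + e"
    using riem_dist_le[OF arclen_join[OF 1(1) 2(1)]] 1 2 by auto
qed

text \<open>Straight segments compare the two distances; convexity keeps them in
  \<open>K\<close>.\<close>

lemma riem_dist_le_norm:
  assumes "compact K" "convex K"
  obtains C where "C > 0" "\<And>p q. p \<in> K \<Longrightarrow> q \<in> K \<Longrightarrow> riem_dist g p q \<le> C * norm (q - p)"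
proof -
  obtain m C where "m > 0" and C: "C > 0" and "\<And>p a. p \<in> K \<Longrightarrow> m * norm a \<le> sqrt (g p a a)"
    and le: "\<And>p a. p \<in> K \<Longrightarrow> sqrt (g p a a) \<le> C * norm a"
    by (rule bounds_on_compact[OF assms(1)]) (rule that)
  show ?thesis
  proof (rule that[OF C])
    fix p q assume pq: "p \<in> K" "q \<in> K"
    have "riem_dist g p q \<le> integral {0..1} (\<lambda>t. sqrt (g (linepath p q t) (q - p) (q - p)))"
      using riem_dist_le[OF arclen_linepath[of p q]] by simp
    also have "\<dots> \<le> integral {0..1::real} (\<lambda>t. C * norm (q - p))"
    proof (rule integral_le)
      show "(\<lambda>t. sqrt (g (linepath p q t) (q - p) (q - p))) integrable_on {0..1}"
        by (intro integrable_continuous_real continuous_intros continuous_g)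
      show "sqrt (g (linepath p q t) (q - p) (q - p)) \<le> C * norm (q - p)" if "t \<in> {0..1}" for t
        using pq assms(2) that by (intro le) (auto simp: linepath_def intro: convexD_alt)
    qed auto
    finally show "riem_dist g p q \<le> C * norm (q - p)" by simp
  qed
qed


text \<open>The growth condition takes the place of a bound on the gradient, since it is to be
  applied to \<open>foot\<close>, which need not be differentiable. The term
  \<open>e * norm (q - p)\<close> absorbs a first-order remainder.\<close>

lemma arclen_growth:
  fixes F :: "'a \<Rightarrow> real"
  assumes c: "arclen g c L" and \<Omega>: "\<And>t. t \<in> {0..1} \<Longrightarrow> c t \<in> \<Omega>" and "K \<ge> 0"
    and cont: "\<And>p. p \<in> \<Omega> \<Longrightarrow> isCont F p"
    and F: "\<And>p e. p \<in> \<Omega> \<Longrightarrow> e > 0 \<Longrightarrow>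
      \<forall>\<^sub>F q in nhds p. \<bar>F q - F p\<bar> \<le> K * sqrt (g p (q - p) (q - p)) + e * norm (q - p)"
    and t: "t \<in> {0..1}"
  shows "F (c t) - F (c 0) \<le> K * L"
proof -
  define s where "s t = sqrt (g (c t) (vector_derivative c (at t)) (vector_derivative c (at t)))" for t
  have s0: "s t \<ge> 0" for t by (simp add: s_def g_nonneg)
  have int: "s integrable_on {0..1}" and L: "integral {0..1} s = L"
    using c by (auto simp: arclen_def s_def[abs_def])
  have "valid_path c" using c by (simp add: arclen_def)
  then obtain E where cc: "continuous_on {0..1} c" and E: "finite E" "c C1_differentiable_on {0..1} - E"
    by (auto simp: valid_path_def piecewise_C1_differentiable_on_def)
  have cder: "(c has_vector_derivative vector_derivative c (at x)) (at x)" if "x \<in> {0..1} - E" for x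
    using E(2) that by (auto simp: C1_differentiable_on_eq vector_derivative_works)
  have vdc: "continuous_on ({0..1} - E) (\<lambda>x. vector_derivative c (at x))"
    using E(2) by (simp add: C1_differentiable_on_eq)
  have sc: "continuous_on ({0..1} - E) s"
    unfolding s_def
    by (intro continuous_intros continuous_g continuous_on_subset[OF cc] vdc) auto
  define I where "I x = integral {0..x} s" for x
  \<comment> \<open>Subtracting \<open>e * x\<close> gives strict decrease to the right of every
    regular point; \<open>e\<close> tends to zero afterwards.\<close>
  have "F (c t) - K * I t - e * t \<le> F (c 0) - K * I 0 - e * 0" if e: "e > 0" for e
  proof (rule right_decreasing_imp_le[where E = E and a = 0 and b = t
        and \<xi> = "\<lambda>x. F (c x) - K * I x - e * x"])
    have sub: "{0..t} \<subseteq> {0..1}" using t by auto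
    have "continuous_on {0..1} (\<lambda>x. F (c x))"
    proof -
      have "continuous_on (c ` {0..1}) F"
        using cont \<Omega> by (intro continuous_at_imp_continuous_on) auto
      then show ?thesis by (rule continuous_on_compose2[OF _ cc]) auto
    qed
    moreover have "continuous_on {0..1} I"
      unfolding I_def by (rule indefinite_integral_continuous_1[OF int])
    ultimately show "continuous_on {0..t} (\<lambda>x. F (c x) - K * I x - e * x)"
      using sub by (auto intro!: continuous_intros intro: continuous_on_subset)
    fix x assume x: "0 < x" "x < t" "x \<notin> E"
    \<comment> \<open>The exceptional points are isolated, so the derivative of the integral,
      obtained within the set where the speed is continuous, is a derivative on a full
      neighbourhood.\<close>
    then have xE: "x \<in> {0..1} - E" "x \<in> {0<..<1}" using t by auto
    have "open ({0<..<1} - E)" using E(1) by (simp add: finite_imp_closed open_Diff)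
    then have atE: "at x within ({0..1} - E) = at x"
      using xE by (intro at_within_interior interiorI[of "{0<..<1} - E"]) auto
    have "((\<lambda>u. integral {0..u} s) has_vector_derivative s x) (at x within ({0..1} - E))"
      using sc xE E(1) by (intro integral_has_vector_derivative_continuous_at[OF int])
        (auto simp: continuous_on_eq_continuous_within)
    then have "(I has_real_derivative s x) (at x)"
      unfolding atE I_def by (simp add: has_real_derivative_iff_has_vector_derivative)
    then have Ilim: "((\<lambda>y. (I y - I x) / (y - x)) \<longlongrightarrow> s x) (at_right x)"
      unfolding has_field_derivative_iff by (rule tendsto_within_subset) auto
    define d where "d = vector_derivative c (at x)"
    define \<Delta> where "\<Delta> y = (c y - c x) /\<^sub>R (y - x)" for y
    have cd: "(c has_vector_derivative d) (at x)" unfolding d_def by (rule cder[OF xE(1)])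
    have "((\<lambda>y. (1 / norm (y - x)) *\<^sub>R (c y - (c x + (y - x) *\<^sub>R d))) \<longlongrightarrow> 0) (at_right x)"
      using has_derivative_at_withinI[OF cd[unfolded has_vector_derivative_def]]
      unfolding has_derivative_within by blast
    moreover have "\<forall>\<^sub>F y in at_right x. (1 / norm (y - x)) *\<^sub>R (c y - (c x + (y - x) *\<^sub>R d)) = \<Delta> y - d"
      using eventually_at_right_less[of x]
      by eventually_elim (simp add: \<Delta>_def scaleR_diff_right diff_diff_eq[symmetric] divide_inverse)
    ultimately have "((\<lambda>y. \<Delta> y - d) \<longlongrightarrow> 0) (at_right x)"
      using tendsto_cong by fast
    then have \<Delta>: "(\<Delta> \<longlongrightarrow> d) (at_right x)" by (rule LIM_zero_cancel)
    \<comment> \<open>Chosen so that \<open>e' * norm d\<close> is at most \<open>e / 2\<close>,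
      while the terms \<open>K * s x\<close> cancel in the limit.\<close>
    define e' where "e' = e / (2 * (norm d + 1))"
    have e': "e' > 0" using e by (simp add: e'_def add_nonneg_pos)
    have "continuous_on UNIV (\<lambda>v. sqrt (g (c x) v v))"
      by (intro continuous_intros continuous_g)
    then have "isCont (\<lambda>v. sqrt (g (c x) v v)) d" by (simp add: continuous_on_eq_continuous_at)
    then have "((\<lambda>y. sqrt (g (c x) (\<Delta> y) (\<Delta> y))) \<longlongrightarrow> s x) (at_right x)"
      using isCont_tendsto_compose[OF _ \<Delta>] by (simp add: s_def d_def)
    then have "((\<lambda>y. K * sqrt (g (c x) (\<Delta> y) (\<Delta> y)) + e' * norm (\<Delta> y) - K * ((I y - I x) / (y - x)) - e)
        \<longlongrightarrow> K * s x + e' * norm d - K * s x - e) (at_right x)"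
      by (intro tendsto_intros \<Delta> Ilim)
    moreover have "K * s x + e' * norm d - K * s x - e < 0"
    proof -
      have "e' * norm d \<le> e' * (norm d + 1)" using e' by simp
      also have "\<dots> = e / 2" using add_nonneg_pos[of "norm d" 1] by (simp add: e'_def field_simps)
      finally show ?thesis using e by linarith
    qed
    ultimately have 1: "\<forall>\<^sub>F y in at_right x. K * sqrt (g (c x) (\<Delta> y) (\<Delta> y)) + e' * norm (\<Delta> y)
        - K * ((I y - I x) / (y - x)) - e < 0"
      by (rule order_tendstoD(2))
    have "(c \<longlongrightarrow> c x) (at_right x)"
      using has_vector_derivative_continuous[OF cd] unfolding isCont_def by (rule tendsto_within_subset) auto
    then have 2: "\<forall>\<^sub>F y in at_right x. \<bar>F (c y) - F (c x)\<bar>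
        \<le> K * sqrt (g (c x) (c y - c x) (c y - c x)) + e' * norm (c y - c x)"
      using F[OF \<Omega> e', of x] xE unfolding filterlim_def le_filter_def eventually_filtermap by auto
    have 3: "\<forall>\<^sub>F y in at_right x. x < y" by (rule eventually_at_right_less)
    from 1 2 3 show "\<forall>\<^sub>F y in at_right x. F (c y) - K * I y - e * y < F (c x) - K * I x - e * x"
    proof eventually_elim
      case (elim y)
      define r where "r = y - x"
      have r: "r > 0" using elim by (simp add: r_def)
      have cr: "c y - c x = r *\<^sub>R \<Delta> y" using r by (simp add: \<Delta>_def r_def)
      have "F (c y) - F (c x) \<le> r * (K * sqrt (g (c x) (\<Delta> y) (\<Delta> y)) + e' * norm (\<Delta> y))"
        using elim(2) r unfolding cr g_scale by (simp add: real_sqrt_mult algebra_simps)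
      also have "\<dots> < r * (K * ((I y - I x) / r) + e)"
        using elim(1) r by (intro mult_strict_left_mono) (auto simp: r_def)
      also have "\<dots> = K * (I y - I x) + e * r" using r by (simp add: field_simps)
      finally show ?case by (simp add: r_def algebra_simps)
    qed
  qed (use E t in auto)
  then have "F (c t) - K * I t - e * t \<le> F (c 0)" if "e > 0" for e
    using that by (simp add: I_def)
  then have "F (c t) \<le> F (c 0) + K * I t + e" if "e > 0" for e
  proof -
    have "e * t \<le> e" using that t by (intro mult_left_le) auto
    with \<open>\<And>e. e > 0 \<Longrightarrow> F (c t) - K * I t - e * t \<le> F (c 0)\<close>[OF that] show ?thesis by linarith
  qed
  then have "F (c t) \<le> F (c 0) + K * I t" by (rule field_le_epsilon)
  also have "I t \<le> L"
    unfolding I_def L[symmetric] using t s0 int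
    by (intro integral_subset_le) (auto intro: integrable_on_subinterval)
  then have "K * I t \<le> K * L" using \<open>K \<ge> 0\<close> by (rule mult_left_mono)
  then have "F (c 0) + K * I t \<le> F (c 0) + K * L" by simp
  finally show ?thesis by simp
qed

lemma arclen_lipschitz:
  fixes F :: "'a \<Rightarrow> real"
  assumes c: "arclen g c L" and \<Omega>: "\<And>t. t \<in> {0..1} \<Longrightarrow> c t \<in> \<Omega>" and "K \<ge> 0"
    and cont: "\<And>p. p \<in> \<Omega> \<Longrightarrow> isCont F p"
    and F: "\<And>p e. p \<in> \<Omega> \<Longrightarrow> e > 0 \<Longrightarrow>
      \<forall>\<^sub>F q in nhds p. \<bar>F q - F p\<bar> \<le> K * sqrt (g p (q - p) (q - p)) + e * norm (q - p)"
    and t: "t \<in> {0..1}"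
  shows "\<bar>F (c t) - F (c 0)\<bar> \<le> K * L"
proof -
  have "F (c t) - F (c 0) \<le> K * L" by (rule arclen_growth[OF assms])
  moreover have "(- F (c t)) - (- F (c 0)) \<le> K * L"
    using F cont by (intro arclen_growth[OF c \<Omega> \<open>K \<ge> 0\<close> _ _ t, where F = "\<lambda>p. - F p"])
      (auto simp: abs_minus_commute intro!: continuous_intros)
  ultimately show ?thesis by simp
qed

text \<open>The Heine-Borel direction of Hopf-Rinow. On the compact set that confines short curves
  the metric is comparable with the Euclidean one: this separates points, and a Cauchy sequence,
  whose tail is confined, has a convergent subsequence.\<close>

theorem riem_complete_criterion:
  assumes bounded: "\<And>p r. \<exists>K. compact K \<and>
    (\<forall>c L. arclen g c L \<and> c 0 = p \<and> L \<le> r \<longrightarrow> (\<forall>t\<in>{0..1}. c t \<in> K))"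
  shows "riem_complete g"
proof -
  have pos: "p = q" if "riem_dist g p q = 0" for p q
  proof (rule ccontr)
    assume "p \<noteq> q"
    obtain K where K: "compact K" "\<And>c L t. arclen g c L \<Longrightarrow> c 0 = p \<Longrightarrow> L \<le> 1 \<Longrightarrow> t \<in> {0..1} \<Longrightarrow> c t \<in> K"
      using bounded[of p 1] by blast
    obtain m C where m: "m > 0" and "C > 0" and ge: "\<And>p a. p \<in> K \<Longrightarrow> m * norm a \<le> sqrt (g p a a)"
      and "\<And>p a. p \<in> K \<Longrightarrow> sqrt (g p a a) \<le> C * norm a"
      by (rule bounds_on_compact[OF K(1)]) (rule that)
    \<comment> \<open>The bound 1 keeps a short curve in \<open>K\<close>, where its length is at
      least \<open>m\<close> times the Euclidean distance of its ends; the other bound contradicts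
      this.\<close>
    define e where "e = min 1 (m * norm (q - p))"
    have "e > 0" using m \<open>p \<noteq> q\<close> by (simp add: e_def)
    then obtain c L where c: "arclen g c L" "pathstart c = p" "pathfinish c = q" "L < e"
      using riem_dist_less[of p q e] \<open>riem_dist g p q = 0\<close> by metis
    have "\<bar>norm (c 1 - p) - norm (c 0 - p)\<bar> \<le> (1 / m) * L"
    proof (rule arclen_lipschitz[OF c(1), where \<Omega> = K and F = "\<lambda>q. norm (q - p)"])
      show "c t \<in> K" if "t \<in> {0..1}" for t
        using K(2)[OF c(1) _ _ that] c by (simp add: pathstart_def e_def)
      show "\<forall>\<^sub>F q in nhds p'. \<bar>norm (q - p) - norm (p' - p)\<bar>
          \<le> 1 / m * sqrt (g p' (q - p') (q - p')) + e * norm (q - p')"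
        if "p' \<in> K" "e > 0" for p' e
      proof (rule always_eventually, rule allI)
        fix q
        have "\<bar>norm (q - p) - norm (p' - p)\<bar> \<le> norm (q - p')"
          using norm_triangle_ineq3[of "q - p" "p' - p"] by simp
        also have "\<dots> \<le> 1 / m * sqrt (g p' (q - p') (q - p'))"
          using ge[OF that(1), of "q - p'"] m by (simp add: field_simps)
        finally show "\<bar>norm (q - p) - norm (p' - p)\<bar>
          \<le> 1 / m * sqrt (g p' (q - p') (q - p')) + e * norm (q - p')"
          using that(2) by (simp add: add_increasing2)
      qed
    qed (use m in \<open>auto intro!: continuous_intros\<close>)
    then have "m * norm (q - p) \<le> L"
      using c m by (simp add: pathstart_def pathfinish_def field_simps)
    then show False using c(4) by (simp add: e_def)
  qed
  interpret M: Metric_space UNIV "riem_dist g"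
  proof
    show "riem_dist g p q = 0 \<longleftrightarrow> p = q" for p q
      using pos[of p q] riem_dist_le_norm[of "{p}"] riem_dist_nonneg[of p p] by force
  qed (rule riem_dist_nonneg riem_dist_commute riem_dist_triangle)+
  have "M.mcomplete"
    unfolding M.mcomplete_def
  proof (intro allI impI)
    fix \<sigma> assume \<sigma>: "M.MCauchy \<sigma>"
    obtain N where N: "\<And>n n'. N \<le> n \<Longrightarrow> N \<le> n' \<Longrightarrow> riem_dist g (\<sigma> n) (\<sigma> n') < 1"
      using \<sigma> unfolding M.MCauchy_def by (meson zero_less_one)
    obtain K where K: "compact K" "\<And>c L t. arclen g c L \<Longrightarrow> c 0 = \<sigma> N \<Longrightarrow> L \<le> 1 \<Longrightarrow> t \<in> {0..1} \<Longrightarrow> c t \<in> K"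
      using bounded[of "\<sigma> N" 1] by blast
    have inK: "\<sigma> (n + N) \<in> K" for n
    proof -
      obtain c L where "arclen g c L" "pathstart c = \<sigma> N" "pathfinish c = \<sigma> (n + N)" "L < 1"
        using riem_dist_less[OF N[of N "n + N"]] by auto
      then show ?thesis using K(2)[of c L 1] by (simp add: pathstart_def pathfinish_def)
    qed
    then obtain p r where r: "strict_mono r" "p \<in> K" "((\<lambda>n. \<sigma> (n + N)) \<circ> r) \<longlonglongrightarrow> p"
      using K(1)[unfolded compact_def, rule_format, of "\<lambda>n. \<sigma> (n + N)"] by blast
    have sub: "strict_mono (\<lambda>n. r n + N)" using r(1) by (simp add: strict_mono_def)
    obtain C where C: "C > 0" "\<And>x y. x \<in> cball p 1 \<Longrightarrow> y \<in> cball p 1 \<Longrightarrow> riem_dist g x y \<le> C * norm (y - x)"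
      using riem_dist_le_norm[of "cball p 1"] by auto
    have lim: "(\<lambda>n. \<sigma> (r n + N)) \<longlonglongrightarrow> p" using r(3) by (simp add: o_def)
    have "limitin M.mtopology (\<sigma> \<circ> (\<lambda>n. r n + N)) p sequentially"
      unfolding M.limitin_metric
    proof (intro conjI allI impI)
      fix e :: real assume "e > 0"
      have "\<forall>\<^sub>F n in sequentially. dist (\<sigma> (r n + N)) p < min 1 (e / C)"
        using \<open>e > 0\<close> C(1) by (intro tendstoD[OF lim]) simp
      then show "\<forall>\<^sub>F n in sequentially. (\<sigma> \<circ> (\<lambda>n. r n + N)) n \<in> UNIV \<and>
          riem_dist g ((\<sigma> \<circ> (\<lambda>n. r n + N)) n) p < e"
      proof eventually_elim
        case (elim n)
        have "riem_dist g (\<sigma> (r n + N)) p \<le> C * norm (p - \<sigma> (r n + N))"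
          using elim by (intro C) (auto simp: dist_commute)
        also have "\<dots> < e" using elim C(1) by (simp add: field_simps dist_norm norm_minus_commute)
        finally show ?case by simp
      qed
    qed simp
    then show "\<exists>x. limitin M.mtopology \<sigma> x sequentially"
      using M.MCauchy_convergent_subsequence[OF \<sigma> sub] by blast
  qed
  then show ?thesis unfolding riem_complete_def using M.Metric_space_axioms by simp
qed

end

section \<open>The hyperboloid model\<close>

lemma christoffel_eqI:
  assumes bil: "bilinear (g p)" and pos: "\<And>a. a \<noteq> 0 \<Longrightarrow> g p a a > 0"
    and c: "\<And>d. 2 * g p c d =
     frechet_derivative (\<lambda>q. g q b d) (at p) a
     + frechet_derivative (\<lambda>q. g q a d) (at p) b
     - frechet_derivative (\<lambda>q. g q a b) (at p) d"
  shows "christoffel g p a b = c"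
  unfolding christoffel_def
proof (rule the_equality)
  fix c' assume c': "\<forall>d. 2 * g p c' d =
     frechet_derivative (\<lambda>q. g q b d) (at p) a
     + frechet_derivative (\<lambda>q. g q a d) (at p) b
     - frechet_derivative (\<lambda>q. g q a b) (at p) d"
  have "2 * g p c' (c' - c) = 2 * g p c (c' - c)" using c c' by simp
  then have "g p (c' - c) (c' - c) = 0" by (simp add: bilinear_lsub[OF bil])
  then show "c' = c" using pos[of "c' - c"] by fastforce
qed (use c in blast)

text \<open>Uniqueness of the Levi-Civita connection: for a symmetric and metric-compatible
  candidate the Koszul terms cancel in pairs. Christoffel symbols can thus be guessed instead of
  computed by inverting the metric.\<close>

lemma christoffel_koszul:
  assumes bil: "bilinear (g p)" and pos: "\<And>a. a \<noteq> 0 \<Longrightarrow> g p a a > 0"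
    and sym: "\<And>a b. g p a b = g p b a" and \<Gamma>: "\<And>a b. \<Gamma> a b = \<Gamma> b a"
    and compat: "\<And>b c. ((\<lambda>q. g q b c) has_derivative (\<lambda>a. g p (\<Gamma> a b) c + g p b (\<Gamma> a c))) (at p)"
  shows "christoffel g p a b = \<Gamma> a b"
proof (rule christoffel_eqI[where g = g, OF bil pos])
  have D: "frechet_derivative (\<lambda>q. g q b c) (at p) a = g p (\<Gamma> a b) c + g p b (\<Gamma> a c)" for a b c
    using frechet_derivative_at[OF compat[of b c]] by metis
  show "2 * g p (\<Gamma> a b) d = frechet_derivative (\<lambda>q. g q b d) (at p) a
     + frechet_derivative (\<lambda>q. g q a d) (at p) b - frechet_derivative (\<lambda>q. g q a b) (at p) d" for d
    unfolding D using \<Gamma>[of d a] \<Gamma>[of d b] \<Gamma>[of b a] sym[of b "\<Gamma> a d"] sym[of a "\<Gamma> b d"] by simp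
qed

section \<open>Minkowski space and the lift of the hyperbolic plane\<close>

definition mink :: "real \<times> complex \<Rightarrow> real \<times> complex \<Rightarrow> real" where
  "mink v w = snd v \<bullet> snd w - fst v * fst w"

definition lift :: "complex \<Rightarrow> real \<times> complex" where
  "lift y = (sqrt (1 + y \<bullet> y), y)"

definition dlift :: "complex \<Rightarrow> complex \<Rightarrow> real \<times> complex" where
  "dlift y a = (y \<bullet> a / sqrt (1 + y \<bullet> y), a)"

lemma bounded_bilinear_mink: "bounded_bilinear mink"
proof
  show "\<exists>K. \<forall>a b. norm (mink a b) \<le> norm a * norm b * K"
  proof (intro exI allI)
    fix a b :: "real \<times> complex"
    have "\<bar>snd a \<bullet> snd b\<bar> \<le> norm (snd a) * norm (snd b)" by (rule Cauchy_Schwarz_ineq2)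
    also have "\<dots> \<le> norm a * norm b"
      using norm_snd_le[of "snd a" "fst a"] norm_snd_le[of "snd b" "fst b"] by (intro mult_mono) auto
    finally have 1: "\<bar>snd a \<bullet> snd b\<bar> \<le> norm a * norm b" .
    have "\<bar>fst a * fst b\<bar> \<le> norm a * norm b"
      using norm_fst_le[of "fst a" "snd a"] norm_fst_le[of "fst b" "snd b"] by (auto simp: abs_mult intro: mult_mono)
    then show "norm (mink a b) \<le> norm a * norm b * 2" using 1 by (simp add: mink_def)
  qed
qed (auto simp: mink_def algebra_simps inner_simps)

interpretation mink: bounded_bilinear mink by (rule bounded_bilinear_mink)

lemma mink_commute: "mink v w = mink w v"
  by (simp add: mink_def inner_commute)

lemma one_plus_inner_pos [simp]: "0 < 1 + y \<bullet> y" "1 + y \<bullet> y \<noteq> 0" "0 \<le> 1 + y \<bullet> y"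
  for y :: complex
  using inner_ge_zero[of y] by linarith+

lemma mink_lift_lift [simp]: "mink (lift y) (lift y) = -1"
  by (simp add: mink_def lift_def)

lemma mink_lift_dlift [simp]: "mink (lift y) (dlift y a) = 0"
  by (simp add: mink_def lift_def dlift_def)

lemma mink_dlift: "mink (dlift y a) (dlift y b) = hyp_metric y a b"
  by (simp add: mink_def dlift_def hyp_metric_def)

lemma linear_dlift: "linear (dlift y)"
  by (auto intro!: linearI simp: dlift_def inner_simps add_divide_distrib)

lemma fst_lift_pos: "0 < fst (lift y)" and snd_lift [simp]: "snd (lift y) = y"
  and snd_dlift [simp]: "snd (dlift y a) = a"
  by (simp_all add: lift_def dlift_def)

lemma has_derivative_lift: "(lift has_derivative dlift y) (at y)"
  unfolding lift_def dlift_def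
  by (auto intro!: derivative_eq_intros ext simp: inner_commute divide_simps)

lemma bilinear_hyp_metric: "bilinear (hyp_metric y)"
  by (auto simp: bilinear_def hyp_metric_def inner_simps algebra_simps add_divide_distrib
      intro!: linearI)

lemma hyp_metric_commute: "hyp_metric y a b = hyp_metric y b a"
  by (simp add: hyp_metric_def inner_commute mult.commute)

lemma hyp_metric_pos: "a \<noteq> 0 \<Longrightarrow> hyp_metric y a a > 0"
proof -
  assume "a \<noteq> 0"
  then have a: "a \<bullet> a > 0" by simp
  have "(y \<bullet> a) * (y \<bullet> a) \<le> (y \<bullet> y) * (a \<bullet> a)"
    using Cauchy_Schwarz_ineq[of y a] by (simp add: power2_eq_square)
  also have "\<dots> < (1 + y \<bullet> y) * (a \<bullet> a)" using a by (simp add: algebra_simps)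
  finally show ?thesis by (simp add: hyp_metric_def field_simps)
qed

text \<open>The summands have the shape that \<open>christoffel_koszul\<close> asks for, with
  candidate \<open>- hyp_metric y a b *\<^sub>R y\<close>.\<close>

lemma has_derivative_hyp_metric:
  "((\<lambda>y. hyp_metric y b c) has_derivative
     (\<lambda>a. hyp_metric y (- hyp_metric y a b *\<^sub>R y) c + hyp_metric y b (- hyp_metric y a c *\<^sub>R y))) (at y)"
proof -
  have n: "1 + y \<bullet> y \<noteq> 0" by simp
  define n where "n = 1 + y \<bullet> y"
  have yy: "y \<bullet> y = n - 1" and n0: "n \<noteq> 0" using n by (simp_all add: n_def)
  show ?thesis
    unfolding hyp_metric_def
    apply (rule derivative_eq_intros n refl | simp)+
    apply (rule ext)
    subgoal for a
      unfolding inner_scaleR_left inner_scaleR_right inner_minus_left inner_minus_right n_def[symmetric] yy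
        inner_commute[of a y] inner_commute[of b y]
      using n0 by (simp add: field_simps inner_commute)
    done
qed

text \<open>On the hyperboloid the flat derivative of a tangent field has normal part
  \<open>hyp_metric y a b\<close> times \<open>lift y\<close>. A constant field of the chart has
  constant spatial part, so its tangential derivative must cancel the spatial part \<open>y\<close>
  of that normal term.\<close>

lemma christoffel_hyp_metric: "christoffel hyp_metric y a b = - hyp_metric y a b *\<^sub>R y"
  by (rule christoffel_koszul[where g = hyp_metric, OF bilinear_hyp_metric hyp_metric_pos
      hyp_metric_commute _ has_derivative_hyp_metric]) (auto simp: hyp_metric_commute)

lemma inner_imult:
  fixes a b :: complex
  shows "a \<bullet> (\<i> * a) = 0" "(\<i> * a) \<bullet> (\<i> * b) = a \<bullet> b" "\<i> * (\<i> * a) = - a"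
  by (simp_all add: inner_complex_def complex_eq_iff)

lemma inner_imult_swap: "a \<bullet> (\<i> * b) = - (b \<bullet> (\<i> * a))"
  for a b :: complex
  by (simp add: inner_complex_def)

lemma hyp_rot_eq: "hyp_rot y w = sqrt (1 + y \<bullet> y) *\<^sub>R (\<i> * (w - (y \<bullet> w / (1 + y \<bullet> y)) *\<^sub>R y))"
proof -
  define n where "n = 1 + y \<bullet> y"
  have n0: "n > 0" by (simp add: n_def)
  \<comment> \<open>\<open>m\<close> represents the functional \<open>hyp_metric y w\<close> for the
    Euclidean product, so \<open>\<i> * m\<close> is hyperbolically orthogonal to \<open>w\<close>.
    The factor \<open>sqrt n\<close> corrects the length, since the determinant of the metric is
    \<open>1 / n\<close>.\<close>
  define m where "m = w - (y \<bullet> w / n) *\<^sub>R y"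
  have hm: "hyp_metric y w z = m \<bullet> z" for z
    by (simp add: hyp_metric_def m_def n_def inner_simps)
  have norm: "n * hyp_metric y (\<i> * m) (\<i> * m) = hyp_metric y w w"
  proof -
    define \<alpha> \<delta> where "\<alpha> = y \<bullet> w" and "\<delta> = y \<bullet> (\<i> * w)"
    have yy: "y \<bullet> y = n - 1" by (simp add: n_def)
    have 1: "y \<bullet> (\<i> * m) = \<delta>" by (simp add: \<delta>_def m_def right_diff_distrib inner_diff_right inner_imult)
    have "(\<i> * m) \<bullet> (\<i> * m) = m \<bullet> m" by (simp add: inner_complex_def)
    also have "\<dots> = w \<bullet> w - 2 * (\<alpha> / n) * \<alpha> + (\<alpha> / n) * (\<alpha> / n) * (n - 1)"
      unfolding m_def yy[symmetric] \<alpha>_def[symmetric]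
      by (simp add: inner_simps \<alpha>_def inner_commute[of w y] algebra_simps)
    finally have 2: "(\<i> * m) \<bullet> (\<i> * m) = w \<bullet> w - 2 * (\<alpha> / n) * \<alpha> + (\<alpha> / n) * (\<alpha> / n) * (n - 1)" .
    have "\<delta> * \<delta> + \<alpha> * \<alpha> = (y \<bullet> y) * (w \<bullet> w)"
      by (simp add: \<delta>_def \<alpha>_def inner_complex_def algebra_simps)
    then have 3: "\<delta> * \<delta> = (n - 1) * (w \<bullet> w) - \<alpha> * \<alpha>" by (simp add: yy)
    show ?thesis
      unfolding hyp_metric_def n_def[symmetric] 1 2 3 \<alpha>_def[symmetric] using n0
      by (simp add: field_simps)
  qed
  have im: "Im (cnj w * (\<i> * m)) = hyp_metric y w w"
    unfolding hm by (simp add: inner_complex_def algebra_simps)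
  show ?thesis
    unfolding hyp_rot_def n_def[symmetric] m_def[symmetric]
  proof (rule the_equality)
    show "hyp_metric y (sqrt n *\<^sub>R (\<i> * m)) (sqrt n *\<^sub>R (\<i> * m)) = hyp_metric y w w \<and>
      hyp_metric y w (sqrt n *\<^sub>R (\<i> * m)) = 0 \<and> 0 \<le> Im (cnj w * sqrt n *\<^sub>R (\<i> * m))"
    proof (intro conjI)
      show "hyp_metric y (sqrt n *\<^sub>R (\<i> * m)) (sqrt n *\<^sub>R (\<i> * m)) = hyp_metric y w w"
        using norm n0 by (simp add: bilinear_lmul[OF bilinear_hyp_metric] bilinear_rmul[OF bilinear_hyp_metric]
            mult.assoc[symmetric])
      show "hyp_metric y w (sqrt n *\<^sub>R (\<i> * m)) = 0"
        unfolding hm by (simp add: inner_complex_def)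
      have "Im (cnj w * sqrt n *\<^sub>R (\<i> * m)) = sqrt n * Im (cnj w * (\<i> * m))" by (simp add: algebra_simps)
      also have "\<dots> \<ge> 0" unfolding im using hyp_metric_pos[of w y] n0
        by (cases "w = 0") (auto simp: hyp_metric_def)
      finally show "0 \<le> Im (cnj w * sqrt n *\<^sub>R (\<i> * m))" .
    qed
  next
    fix z assume z: "hyp_metric y z z = hyp_metric y w w \<and> hyp_metric y w z = 0 \<and> 0 \<le> Im (cnj w * z)"
    show "z = sqrt n *\<^sub>R (\<i> * m)"
    proof (cases "w = 0")
      case True
      then show ?thesis using z hyp_metric_pos[of z y] by (force simp: hyp_metric_def m_def)
    next
      case False
      then have w: "hyp_metric y w w > 0" by (rule hyp_metric_pos)
      then have "m \<noteq> 0" unfolding hm by auto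
      then have mm: "m \<bullet> m > 0" by simp
      \<comment> \<open>Orthogonality forces \<open>z\<close> to be a multiple of
        \<open>\<i> * m\<close>; the length gives \<open>t\<^sup>2 = n\<close>, and the orientation
        selects the positive root.\<close>
      define t where "t = ((\<i> * m) \<bullet> z) / (m \<bullet> m)"
      have mz: "Re m * Re z + Im m * Im z = 0" using z unfolding hm inner_complex_def by simp
      have zt: "z = t *\<^sub>R (\<i> * m)"
      proof (rule complex_eqI)
        have tm: "t * (m \<bullet> m) = Re m * Im z - Im m * Re z"
          using mm by (simp add: t_def) (simp add: inner_complex_def)
        have "(m \<bullet> m) * Re z = - (Re m * Im z - Im m * Re z) * Im m + Re m * (Re m * Re z + Im m * Im z)"
          by (simp add: inner_complex_def algebra_simps)
        also have "\<dots> = (m \<bullet> m) * (- t * Im m)" unfolding mz tm[symmetric] by (simp add: algebra_simps)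
        finally have "Re z = - t * Im m" using mm by (metis mult_left_cancel order_less_irrefl)
        then show "Re z = Re (t *\<^sub>R (\<i> * m))" by simp
        have "(m \<bullet> m) * Im z = (Re m * Im z - Im m * Re z) * Re m + Im m * (Re m * Re z + Im m * Im z)"
          by (simp add: inner_complex_def algebra_simps)
        also have "\<dots> = (m \<bullet> m) * (t * Re m)" unfolding mz tm[symmetric] by (simp add: algebra_simps)
        finally have "Im z = t * Re m" using mm by (metis mult_left_cancel order_less_irrefl)
        then show "Im z = Im (t *\<^sub>R (\<i> * m))" by simp
      qed
      have "Im (cnj w * z) = t * Im (cnj w * (\<i> * m))" unfolding zt by (simp add: algebra_simps)
      then have "t \<ge> 0" using z w unfolding im by (metis zero_le_mult_iff not_le)
      have "t\<^sup>2 * hyp_metric y (\<i> * m) (\<i> * m) = n * hyp_metric y (\<i> * m) (\<i> * m)"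
        using z unfolding norm zt
        by (simp add: bilinear_lmul[OF bilinear_hyp_metric] bilinear_rmul[OF bilinear_hyp_metric] power2_eq_square)
      moreover have "hyp_metric y (\<i> * m) (\<i> * m) > 0" using \<open>m \<noteq> 0\<close> by (intro hyp_metric_pos) auto
      ultimately have "t\<^sup>2 = n" by simp
      then have "t = sqrt n" using \<open>t \<ge> 0\<close> by (metis real_sqrt_unique)
      then show ?thesis using zt by simp
    qed
  qed
qed


lemma hyp_rot_linear_comb:
  "hyp_rot y (r *\<^sub>R a + s *\<^sub>R b) = r *\<^sub>R hyp_rot y a + s *\<^sub>R hyp_rot y b"
  unfolding hyp_rot_eq by (simp add: inner_simps distrib_left right_diff_distrib scaleR_add_right scaleR_diff_right
    scaleR_add_left add_divide_distrib distrib_left algebra_simps)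

lemma hyp_rot_hyp_rot: "hyp_rot y (hyp_rot y w) = - w"
proof -
  define n where "n = 1 + y \<bullet> y"
  have n0: "n > 0" by (simp add: n_def)
  have rot: "hyp_rot y w = sqrt n *\<^sub>R (\<i> * w) - (sqrt n * (y \<bullet> w / n)) *\<^sub>R (\<i> * y)" for w
    unfolding hyp_rot_eq n_def by (simp add: right_diff_distrib scaleR_diff_right)
  have 1: "y \<bullet> hyp_rot y w = sqrt n * (y \<bullet> (\<i> * w))"
    unfolding rot by (simp add: inner_simps inner_imult)
  have 2: "\<i> * hyp_rot y w = - (sqrt n *\<^sub>R w) + (sqrt n * (y \<bullet> w / n)) *\<^sub>R y"
    unfolding rot by (simp add: right_diff_distrib inner_imult)
  have "hyp_rot y (hyp_rot y w) = - (n *\<^sub>R w) + ((y \<bullet> w) *\<^sub>R y - (y \<bullet> (\<i> * w)) *\<^sub>R (\<i> * y))"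
    unfolding rot[of "hyp_rot y w"] 1 2 using n0
    by (simp add: scaleR_add_right scaleR_diff_right mult.assoc[symmetric])
  \<comment> \<open>The expansion of \<open>w\<close> in the orthogonal pair \<open>y\<close>,
    \<open>\<i> * y\<close>, multiplied by \<open>y \<bullet> y\<close>.\<close>
  also have "(y \<bullet> w) *\<^sub>R y - (y \<bullet> (\<i> * w)) *\<^sub>R (\<i> * y) = (y \<bullet> y) *\<^sub>R w"
    by (rule complex_eqI) (simp_all add: inner_complex_def algebra_simps)
  also have "y \<bullet> y = n - 1" by (simp add: n_def)
  finally show ?thesis by (simp add: algebra_simps)
qed

lemma hyp_metric_hyp_rot:
  "hyp_metric y w (hyp_rot y w) = 0" "hyp_metric y (hyp_rot y w) (hyp_rot y w) = hyp_metric y w w"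
proof -
  show 1: "hyp_metric y w (hyp_rot y w) = 0" for w
    unfolding hyp_metric_def hyp_rot_eq
    by (simp add: right_diff_distrib inner_simps inner_imult inner_imult_swap[of w y])
  \<comment> \<open>Orthogonality for \<open>w + hyp_rot y w\<close>, whose rotation is
    \<open>hyp_rot y w - w\<close>, compares the two lengths.\<close>
  have "hyp_metric y (w + hyp_rot y w) (hyp_rot y (w + hyp_rot y w)) = 0" by (rule 1)
  moreover have "hyp_rot y (w + hyp_rot y w) = hyp_rot y w - w"
    using hyp_rot_linear_comb[of y 1 w 1 "hyp_rot y w"] by (simp add: hyp_rot_hyp_rot)
  ultimately show "hyp_metric y (hyp_rot y w) (hyp_rot y w) = hyp_metric y w w"
    using 1[of w] by (simp add: bilinear_radd[OF bilinear_hyp_metric] bilinear_ladd[OF bilinear_hyp_metric]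
      bilinear_rsub[OF bilinear_hyp_metric] hyp_metric_commute[of y "hyp_rot y w" w])
qed

subsection \<open>Geodesics\<close>

lemma has_real_derivative_inner:
  assumes "(f has_vector_derivative f') (at t)" "(g has_vector_derivative g') (at t)"
  shows "((\<lambda>t. f t \<bullet> g t) has_real_derivative f' \<bullet> g t + f t \<bullet> g') (at t)"
  unfolding has_field_derivative_def
  by (rule has_derivative_eq_rhs[OF has_derivative_inner[OF assms[unfolded has_vector_derivative_def]]])
    (auto simp: algebra_simps)

lemma zero_derivative_const:
  fixes f :: "real \<Rightarrow> 'b::real_normed_vector"
  assumes "\<And>t. (f has_derivative (\<lambda>s. 0)) (at t)"
  shows "f a = f b"
proof -
  have "\<exists>c. \<forall>x\<in>UNIV. f x = c" by (rule has_derivative_zero_constant) (auto simp: assms)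
  then show ?thesis by auto
qed

text \<open>The uniqueness half of \<open>riem_exp_hyp_metric\<close>. The squared speed is
  constant, so the geodesic equation becomes linear, c'' = u^2 c, and two first integrals solve
  it.\<close>

lemma geodesic_hyp_eq:
  assumes c: "geodesic hyp_metric c" and c0: "c 0 = p" "vector_derivative c (at 0) = u *\<^sub>R w"
    and w: "hyp_metric p w w = 1"
  shows "c 1 = cosh u *\<^sub>R p + sinh u *\<^sub>R w"
proof -
  define b where "b t = vector_derivative c (at t)" for t
  have dc: "(c has_vector_derivative b t) (at t)" for t
    using c by (simp add: geodesic_def b_def vector_derivative_works)
  have db: "(b has_vector_derivative hyp_metric (c t) (b t) (b t) *\<^sub>R c t) (at t)" for t
    using c unfolding geodesic_def parallel_along_def christoffel_hyp_metric b_def[symmetric, abs_def]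
    by (simp add: b_def[abs_def])
  have "((\<lambda>t. hyp_metric (c t) (b t) (b t)) has_derivative (\<lambda>s. 0)) (at t)" for t
  proof -
    define n \<alpha> \<beta> \<kappa> where "n = 1 + c t \<bullet> c t" and "\<alpha> = c t \<bullet> b t" and "\<beta> = b t \<bullet> b t"
      and "\<kappa> = hyp_metric (c t) (b t) (b t)"
    have n0: "n \<noteq> 0" "1 + c t \<bullet> c t \<noteq> 0" by (simp_all add: n_def)
    have cc: "c t \<bullet> c t = n - 1" by (simp add: n_def)
    have \<kappa>: "\<kappa> = \<beta> - \<alpha> * \<alpha> / n" by (simp add: \<kappa>_def hyp_metric_def n_def \<alpha>_def \<beta>_def)
    have 1: "((\<lambda>t. c t \<bullet> c t) has_real_derivative 2 * \<alpha>) (at t)"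
      using has_real_derivative_inner[OF dc[of t] dc[of t]] by (simp add: \<alpha>_def inner_commute)
    have 2: "((\<lambda>t. c t \<bullet> b t) has_real_derivative \<beta> + \<kappa> * (n - 1)) (at t)"
      using has_real_derivative_inner[OF dc[of t] db[of t]] by (simp add: \<beta>_def \<kappa>_def cc)
    have 3: "((\<lambda>t. b t \<bullet> b t) has_real_derivative 2 * \<kappa> * \<alpha>) (at t)"
      using has_real_derivative_inner[OF db[of t] db[of t]] by (simp add: \<alpha>_def \<kappa>_def inner_commute mult.commute mult.left_commute)
    have "((\<lambda>t. hyp_metric (c t) (b t) (b t)) has_real_derivative
       2 * \<kappa> * \<alpha> - (((\<beta> + \<kappa> * (n - 1)) * \<alpha> + \<alpha> * (\<beta> + \<kappa> * (n - 1))) * n - (\<alpha> * \<alpha>) * (2 * \<alpha>)) / (n * n)) (at t)"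
      unfolding hyp_metric_def
      by (rule derivative_eq_intros 1 2 3 n0 refl)+ (simp add: n_def \<alpha>_def)
    moreover have "2 * \<kappa> * \<alpha> - (((\<beta> + \<kappa> * (n - 1)) * \<alpha> + \<alpha> * (\<beta> + \<kappa> * (n - 1))) * n - (\<alpha> * \<alpha>) * (2 * \<alpha>)) / (n * n) = 0"
      using n0 by (simp add: \<kappa> field_simps)
    ultimately show ?thesis by (simp only: has_field_derivative_def lambda_zero)
  qed
  then have k: "hyp_metric (c t) (b t) (b t) = hyp_metric (c 0) (b 0) (b 0)" for t
    by (rule zero_derivative_const)
  define k where "k = hyp_metric (c 0) (b 0) (b 0)"
  note k = k[folded k_def]
  have "k = u\<^sup>2" using k[of 0] w c0
    by (simp add: b_def bilinear_lmul[OF bilinear_hyp_metric] bilinear_rmul[OF bilinear_hyp_metric] power2_eq_square)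
  show ?thesis
  proof (cases "u = 0")
    case True
    then have "b t = 0" for t using k[of t] \<open>k = u\<^sup>2\<close> hyp_metric_pos[of "b t" "c t"] by force
    then have "\<And>t. (c has_derivative (\<lambda>s. 0)) (at t)" using dc by (simp add: has_vector_derivative_def)
    then have "c 1 = c 0" by (rule zero_derivative_const)
    then show ?thesis using c0 True by simp
  next
    case False
    have db': "(b has_vector_derivative u\<^sup>2 *\<^sub>R c t) (at t)" for t using db[of t] k \<open>k = u\<^sup>2\<close> by simp
    \<comment> \<open>The first integrals, used for \<open>s = u\<close> and \<open>s = - u\<close>;
      together they determine \<open>b 1\<close> and \<open>c 1\<close>.\<close>
    have const: "exp (- (s * 1)) *\<^sub>R (b 1 + s *\<^sub>R c 1) = exp (- (s * 0)) *\<^sub>R (b 0 + s *\<^sub>R c 0)"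
      if s: "s * s = u\<^sup>2" for s
    proof -
      have "((\<lambda>t. exp (- (s * t)) *\<^sub>R (b t + s *\<^sub>R c t)) has_derivative (\<lambda>r. 0)) (at t)" for t
      proof -
        have "((\<lambda>t. exp (- (s * t))) has_real_derivative - s * exp (- (s * t))) (at t)"
          by (auto intro!: derivative_eq_intros)
        from has_vector_derivative_scaleR[OF this has_vector_derivative_add[OF db'
              bounded_linear.has_vector_derivative[OF bounded_linear_scaleR_right dc]]]
        show ?thesis unfolding has_vector_derivative_def
          by (rule has_derivative_eq_rhs) (auto simp: s[symmetric] algebra_simps)
      qed
      then show ?thesis by (rule zero_derivative_const)
    qed
    have b0: "b 0 = u *\<^sub>R w" using c0 by (simp add: b_def)
    have 1: "b 1 + u *\<^sub>R c 1 = exp u *\<^sub>R (u *\<^sub>R w + u *\<^sub>R p)"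
    proof -
      have "exp u *\<^sub>R (exp (- u) *\<^sub>R (b 1 + u *\<^sub>R c 1)) = exp u *\<^sub>R (u *\<^sub>R w + u *\<^sub>R p)"
        using const[of u] b0 c0 by (simp add: power2_eq_square)
      then show ?thesis by (simp add: mult_exp_exp)
    qed
    have 2: "b 1 - u *\<^sub>R c 1 = exp (- u) *\<^sub>R (u *\<^sub>R w - u *\<^sub>R p)"
    proof -
      have "exp (- u) *\<^sub>R (exp u *\<^sub>R (b 1 - u *\<^sub>R c 1)) = exp (- u) *\<^sub>R (u *\<^sub>R w - u *\<^sub>R p)"
        using const[of "- u"] b0 c0 by (simp add: power2_eq_square)
      then show ?thesis by (simp add: mult_exp_exp)
    qed
    have "(2 * u) *\<^sub>R c 1 = (b 1 + u *\<^sub>R c 1) - (b 1 - u *\<^sub>R c 1)" by (simp add: scaleR_2[symmetric] algebra_simps)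
    also have "\<dots> = (2 * u) *\<^sub>R (cosh u *\<^sub>R p + sinh u *\<^sub>R w)"
      unfolding 1 2 cosh_field_def sinh_field_def by (simp add: algebra_simps diff_divide_distrib add_divide_distrib)
    finally show ?thesis using False by simp
  qed
qed

lemma riem_exp_hyp_metric:
  assumes w: "hyp_metric p w w = 1"
  shows "riem_exp hyp_metric p (u *\<^sub>R w) = cosh u *\<^sub>R p + sinh u *\<^sub>R w"
  unfolding riem_exp_def
proof (rule the_equality)
  define c where "c t = cosh (u * t) *\<^sub>R p + sinh (u * t) *\<^sub>R w" for t
  define b where "b t = u *\<^sub>R (sinh (u * t) *\<^sub>R p + cosh (u * t) *\<^sub>R w)" for t
  have cs: "((\<lambda>t. cosh (u * t)) has_real_derivative u * sinh (u * t)) (at t)"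
    "((\<lambda>t. sinh (u * t)) has_real_derivative u * cosh (u * t)) (at t)" for t
    by (auto intro!: derivative_eq_intros)
  note sc = has_vector_derivative_scaleR[OF _ has_vector_derivative_const]
  have dc: "(c has_vector_derivative b t) (at t)" for t
    using has_vector_derivative_add[OF sc[OF cs(1)[of t], of p] sc[OF cs(2)[of t], of w]]
    unfolding c_def[abs_def] b_def by (simp add: scaleR_add_right)
  have db: "(b has_vector_derivative u\<^sup>2 *\<^sub>R c t) (at t)" for t
    using bounded_linear.has_vector_derivative[OF bounded_linear_scaleR_right
        has_vector_derivative_add[OF sc[OF cs(2)[of t], of p] sc[OF cs(1)[of t], of w]], of u]
    unfolding c_def b_def[abs_def] by (simp add: scaleR_add_right power2_eq_square mult.assoc)
  have bc: "vector_derivative c (at t) = b t" for t using dc by (rule vector_derivative_at)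
  have hyp: "hyp_metric (c t) (b t) (b t) = u\<^sup>2" for t
  proof -
    define z w0 where "z = sqrt (1 + p \<bullet> p)" and "w0 = p \<bullet> w / z"
    have z: "z > 0" "z * z = 1 + p \<bullet> p" by (simp_all add: z_def)
    have pp: "p \<bullet> p = z * z - 1" and pw: "p \<bullet> w = z * w0" using z by (simp_all add: w0_def)
    have "w \<bullet> w = 1 + w0 * w0"
    proof -
      have "w \<bullet> w - (z * w0) * (z * w0) / (z * z) = 1"
        using w unfolding hyp_metric_def pw z(2)[symmetric] .
      moreover have "(z * w0) * (z * w0) / (z * z) = w0 * w0" using z(1) by simp
      ultimately show ?thesis by linarith
    qed
    note ip = pp pw inner_commute[of w p] this
    define C S where "C = cosh (u * t)" and "S = sinh (u * t)"
    have CS: "C * C = 1 + S * S" using cosh_square_eq[of "u * t"] by (simp add: C_def S_def power2_eq_square)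
    \<comment> \<open>The time component of \<open>cosh (u * t) *\<^sub>R lift p + sinh (u * t)
      *\<^sub>R dlift p w\<close>: \<open>z\<close> and \<open>w0\<close> are those of
      \<open>lift p\<close> and \<open>dlift p w\<close>.\<close>
    define Z where "Z = C * z + S * w0"
    have cc: "1 + c t \<bullet> c t = Z * Z"
      unfolding c_def C_def[symmetric] S_def[symmetric] Z_def using CS
      by (simp add: inner_simps ip algebra_simps)
    have cb: "c t \<bullet> b t = u * (Z * (S * z + C * w0))"
      unfolding c_def b_def C_def[symmetric] S_def[symmetric] Z_def using CS
      by (simp add: inner_simps ip algebra_simps)
    have "(S *\<^sub>R p + C *\<^sub>R w) \<bullet> (S *\<^sub>R p + C *\<^sub>R w) = 1 + (S * z + C * w0) * (S * z + C * w0)"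
      using CS by (simp add: inner_simps ip algebra_simps)
    then have bb: "b t \<bullet> b t = u * u * (1 + (S * z + C * w0) * (S * z + C * w0))"
      unfolding b_def C_def[symmetric] S_def[symmetric] by (simp add: mult.assoc)
    have "Z * Z > 0" unfolding cc[symmetric] by simp
    then have "Z \<noteq> 0" by auto
    then show ?thesis unfolding hyp_metric_def cc cb bb by (simp add: field_simps power2_eq_square)
  qed
  have "geodesic hyp_metric c"
    unfolding geodesic_def parallel_along_def bc christoffel_hyp_metric hyp
    using dc db by (auto simp: differentiable_def has_vector_derivative_def)
  then show "\<exists>c. geodesic hyp_metric c \<and> c 0 = p \<and> vector_derivative c (at 0) = u *\<^sub>R w \<and>
      cosh u *\<^sub>R p + sinh u *\<^sub>R w = c 1"
    by (intro exI[of _ c]) (auto simp: bc b_def c_def)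
qed (use geodesic_hyp_eq w in blast)

subsection \<open>The moving frame\<close>

text \<open>Lifted to the hyperboloid, the parallel frame along the curve solves a linear ODE.\<close>

lemma has_vector_derivative_dlift_parallel:
  assumes \<gamma>: "(\<gamma> has_vector_derivative T) (at x)"
    and V: "(V has_vector_derivative hyp_metric (\<gamma> x) T (V x) *\<^sub>R \<gamma> x) (at x)"
  shows "((\<lambda>x. dlift (\<gamma> x) (V x)) has_vector_derivative hyp_metric (\<gamma> x) T (V x) *\<^sub>R lift (\<gamma> x)) (at x)"
proof -
  define z a b where "z = sqrt (1 + \<gamma> x \<bullet> \<gamma> x)" and "a = \<gamma> x \<bullet> T" and "b = \<gamma> x \<bullet> V x"
  define \<kappa> where "\<kappa> = hyp_metric (\<gamma> x) T (V x)"
  have z: "z > 0" "z * z = 1 + \<gamma> x \<bullet> \<gamma> x" by (simp_all add: z_def)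
  then have gg: "\<gamma> x \<bullet> \<gamma> x = z * z - 1" by simp
  have TV: "T \<bullet> V x = \<kappa> + a * b / (z * z)"
    by (simp add: \<kappa>_def hyp_metric_def z a_def b_def)
  have "((\<lambda>x. \<gamma> x \<bullet> V x / sqrt (1 + \<gamma> x \<bullet> \<gamma> x)) has_derivative (\<lambda>s. s * (\<kappa> * z))) (at x)"
    apply (rule derivative_eq_intros \<gamma>[unfolded has_vector_derivative_def]
          V[unfolded has_vector_derivative_def] refl | simp)+
    apply (rule ext)
    unfolding z_def[symmetric] \<kappa>_def[symmetric] inner_commute[of T "\<gamma> x"] gg a_def[symmetric] b_def[symmetric] TV
    using z(1) by (simp add: divide_simps TV) (simp add: algebra_simps)
  from has_derivative_Pair[OF this V[unfolded has_vector_derivative_def]] show ?thesis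
    unfolding has_vector_derivative_def dlift_def lift_def z_def[symmetric] \<kappa>_def[symmetric]
    by (simp add: algebra_simps)
qed

text \<open>The complex structure of a surface is parallel; hence one parallel field yields a
  parallel frame.\<close>

lemma parallel_hyp_rot:
  assumes \<gamma>: "(\<gamma> has_vector_derivative T) (at x)"
    and V: "(V has_vector_derivative hyp_metric (\<gamma> x) T (V x) *\<^sub>R \<gamma> x) (at x)"
  shows "((\<lambda>x. hyp_rot (\<gamma> x) (V x)) has_vector_derivative
    hyp_metric (\<gamma> x) T (hyp_rot (\<gamma> x) (V x)) *\<^sub>R \<gamma> x) (at x)"
proof -
  \<comment> \<open>In this form \<open>hyp_rot\<close> involves only the time components of
    \<open>lift\<close> and \<open>dlift\<close>, whose derivatives along the curve are
    known.\<close>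
  have rot: "hyp_rot y w = fst (lift y) *\<^sub>R (\<i> * w) - fst (dlift y w) *\<^sub>R (\<i> * y)" for y w
  proof -
    define z where "z = sqrt (1 + y \<bullet> y)"
    have "z > 0" "1 + y \<bullet> y = z * z" by (simp_all add: z_def)
    then show ?thesis
      unfolding hyp_rot_eq dlift_def lift_def z_def[symmetric] by (simp add: right_diff_distrib scaleR_diff_right)
  qed
  define z where "z = sqrt (1 + \<gamma> x \<bullet> \<gamma> x)"
  have z: "z > 0" "z * z = 1 + \<gamma> x \<bullet> \<gamma> x" by (simp_all add: z_def)
  define \<kappa> where "\<kappa> = hyp_metric (\<gamma> x) T (V x)"
  have dl: "((\<lambda>x. lift (\<gamma> x)) has_derivative (\<lambda>s. s *\<^sub>R dlift (\<gamma> x) T)) (at x)"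
    using has_derivative_compose[OF \<gamma>[unfolded has_vector_derivative_def] has_derivative_lift]
    by (simp add: linear_cmul[OF linear_dlift])
  have dd: "((\<lambda>x. dlift (\<gamma> x) (V x)) has_derivative (\<lambda>s. s *\<^sub>R (\<kappa> *\<^sub>R lift (\<gamma> x)))) (at x)"
    using has_vector_derivative_dlift_parallel[OF assms] by (simp add: has_vector_derivative_def \<kappa>_def)
  have "((\<lambda>x. hyp_rot (\<gamma> x) (V x)) has_derivative (\<lambda>s. s *\<^sub>R
      ((fst (dlift (\<gamma> x) T) *\<^sub>R (\<i> * V x) + fst (lift (\<gamma> x)) *\<^sub>R (\<i> * (\<kappa> *\<^sub>R \<gamma> x)))
       - (\<kappa> * fst (lift (\<gamma> x))) *\<^sub>R (\<i> * \<gamma> x) - fst (dlift (\<gamma> x) (V x)) *\<^sub>R (\<i> * T)))) (at x)"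
    unfolding rot
    apply (rule derivative_eq_intros \<gamma>[unfolded has_vector_derivative_def]
          V[unfolded has_vector_derivative_def] dl dd refl | simp)+
    apply (rule ext)
    by (simp add: \<kappa>_def algebra_simps)
  moreover have "(fst (dlift (\<gamma> x) T) *\<^sub>R (\<i> * V x) + fst (lift (\<gamma> x)) *\<^sub>R (\<i> * (\<kappa> *\<^sub>R \<gamma> x)))
       - (\<kappa> * fst (lift (\<gamma> x))) *\<^sub>R (\<i> * \<gamma> x) - fst (dlift (\<gamma> x) (V x)) *\<^sub>R (\<i> * T)
      = hyp_metric (\<gamma> x) T (hyp_rot (\<gamma> x) (V x)) *\<^sub>R \<gamma> x"
  proof -
    \<comment> \<open>Up to sign this is the hyperbolic area form, the determinant divided by
      \<open>z\<close>.\<close>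
    have "hyp_metric (\<gamma> x) T (hyp_rot (\<gamma> x) (V x)) = - (Re T * Im (V x) - Im T * Re (V x)) / z"
    proof -
      define y where "y = \<gamma> x"
      have "hyp_metric y T (hyp_rot y (V x)) = z * (T \<bullet> (\<i> * V x)) - (y \<bullet> V x / z) * (T \<bullet> (\<i> * y))
         - (y \<bullet> T) * (z * (y \<bullet> (\<i> * V x))) / (z * z)"
        unfolding hyp_metric_def rot dlift_def lift_def using z
        by (simp add: z_def[folded y_def, symmetric] y_def[symmetric] inner_simps)
          (simp add: inner_complex_def algebra_simps)
      also have "\<dots> = - (z * z - (y \<bullet> y)) * (Re T * Im (V x) - Im T * Re (V x)) / z"
        using z(1) by (simp add: field_simps inner_complex_def)
      finally show ?thesis using z by (simp add: y_def)
    qed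
    note eq = this
    show ?thesis
      unfolding eq dlift_def lift_def z_def[symmetric] using z(1)
      by (simp add: complex_eq_iff inner_complex_def field_simps)
  qed
  ultimately show ?thesis by (simp add: has_vector_derivative_def)
qed

text \<open>Reduces the curve to Minkowski data. The rotation by the turning angle is kept explicit,
  so that \<open>P\<close> and \<open>Q\<close> satisfy differential equations at every point
  although the tangent need not be differentiable.\<close>

lemma frame_along_curve:
  assumes "curve_with_turning_angle H \<gamma>"
  obtains G P Q :: "real \<Rightarrow> real \<times> complex" where
    "\<And>x. (G has_vector_derivative cos (H x - H 0) *\<^sub>R P x + sin (H x - H 0) *\<^sub>R Q x) (at x)"
    "\<And>x. (P has_vector_derivative cos (H x - H 0) *\<^sub>R G x) (at x)"
    "\<And>x. (Q has_vector_derivative sin (H x - H 0) *\<^sub>R G x) (at x)"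
    "\<And>x. mink (G x) (G x) = -1" "\<And>x. mink (P x) (P x) = 1" "\<And>x. mink (Q x) (Q x) = 1"
    "\<And>x. mink (G x) (P x) = 0" "\<And>x. mink (G x) (Q x) = 0" "\<And>x. mink (P x) (Q x) = 0"
    "\<And>x. fst (G x) > 0"
    "\<And>x u v. coords \<gamma> (x, u, v) = (snd (cosh u *\<^sub>R G x +
       sinh u *\<^sub>R (cos (H x - H 0) *\<^sub>R Q x - sin (H x - H 0) *\<^sub>R P x)), v)"
proof -
  define T where "T x = vector_derivative \<gamma> (at x)" for x
  define \<theta> where "\<theta> x = H x - H 0" for x
  obtain p where par: "parallel_along hyp_metric \<gamma> p"
    and T: "\<And>x. T x = cos (\<theta> x) *\<^sub>R p x + sin (\<theta> x) *\<^sub>R hyp_rot (\<gamma> x) (p x)"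
    using assms unfolding curve_with_turning_angle_def T_def \<theta>_def by blast
  define q where "q x = hyp_rot (\<gamma> x) (p x)" for x
  have \<gamma>: "(\<gamma> has_vector_derivative T x) (at x)" for x
    using assms by (simp add: curve_with_turning_angle_def T_def vector_derivative_works)
  have TT: "hyp_metric (\<gamma> x) (T x) (T x) = 1" for x
    using assms by (simp add: curve_with_turning_angle_def T_def)
  have dp: "(p has_vector_derivative hyp_metric (\<gamma> x) (T x) (p x) *\<^sub>R \<gamma> x) (at x)" for x
    using par by (simp add: parallel_along_def christoffel_hyp_metric T_def)
  have dq: "(q has_vector_derivative hyp_metric (\<gamma> x) (T x) (q x) *\<^sub>R \<gamma> x) (at x)" for x
    using parallel_hyp_rot[OF \<gamma> dp] by (simp add: q_def[abs_def])
  note lin = bilinear_ladd[OF bilinear_hyp_metric] bilinear_radd[OF bilinear_hyp_metric]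
    bilinear_lmul[OF bilinear_hyp_metric] bilinear_rmul[OF bilinear_hyp_metric]
  have pq: "hyp_metric (\<gamma> x) (p x) (q x) = 0" "hyp_metric (\<gamma> x) (q x) (p x) = 0"
    "hyp_metric (\<gamma> x) (q x) (q x) = hyp_metric (\<gamma> x) (p x) (p x)" for x
    unfolding q_def using hyp_metric_hyp_rot hyp_metric_commute by metis+
  \<comment> \<open>The tangent is a rotation of \<open>p\<close>, so its unit length passes to
    \<open>p\<close>.\<close>
  have pp: "hyp_metric (\<gamma> x) (p x) (p x) = 1" for x
  proof -
    define k where "k = hyp_metric (\<gamma> x) (p x) (p x)"
    have "hyp_metric (\<gamma> x) (T x) (T x) = cos (\<theta> x) * cos (\<theta> x) * k + sin (\<theta> x) * sin (\<theta> x) * k"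
      unfolding T q_def[symmetric] k_def by (simp only: lin pq) simp
    also have "\<dots> = ((cos (\<theta> x))\<^sup>2 + (sin (\<theta> x))\<^sup>2) * k" by (simp only: power2_eq_square distrib_right)
    finally have "hyp_metric (\<gamma> x) (T x) (T x) = hyp_metric (\<gamma> x) (p x) (p x)" by (simp add: k_def)
    then show ?thesis using TT[of x] by simp
  qed
  note pq = pq[unfolded pp] pp
  have Tp: "hyp_metric (\<gamma> x) (T x) (p x) = cos (\<theta> x)" and Tq: "hyp_metric (\<gamma> x) (T x) (q x) = sin (\<theta> x)" for x
    unfolding T q_def[symmetric] by (simp_all add: lin pq)
  define U where "U x = cos (\<theta> x) *\<^sub>R q x - sin (\<theta> x) *\<^sub>R p x" for x
  have rotT: "hyp_rot (\<gamma> x) (T x) = U x" for x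
    unfolding T hyp_rot_linear_comb hyp_rot_hyp_rot U_def q_def by simp
  have UU: "hyp_metric (\<gamma> x) (U x) (U x) = 1" for x
    unfolding rotT[symmetric] hyp_metric_hyp_rot TT ..
  show thesis
  proof (rule that[of "\<lambda>x. lift (\<gamma> x)" "\<lambda>x. dlift (\<gamma> x) (p x)" "\<lambda>x. dlift (\<gamma> x) (q x)"], unfold \<theta>_def[symmetric])
    fix x
    have "((\<lambda>x. lift (\<gamma> x)) has_derivative (\<lambda>s. s *\<^sub>R dlift (\<gamma> x) (T x))) (at x)"
      using has_derivative_compose[OF \<gamma>[unfolded has_vector_derivative_def] has_derivative_lift]
      by (simp add: linear_cmul[OF linear_dlift])
    then show "((\<lambda>x. lift (\<gamma> x)) has_vector_derivative
        cos (\<theta> x) *\<^sub>R dlift (\<gamma> x) (p x) + sin (\<theta> x) *\<^sub>R dlift (\<gamma> x) (q x)) (at x)"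
      by (simp add: has_vector_derivative_def T q_def linear_add[OF linear_dlift] linear_cmul[OF linear_dlift])
    show "((\<lambda>x. dlift (\<gamma> x) (p x)) has_vector_derivative cos (\<theta> x) *\<^sub>R lift (\<gamma> x)) (at x)"
      using has_vector_derivative_dlift_parallel[OF \<gamma> dp] by (simp add: Tp)
    show "((\<lambda>x. dlift (\<gamma> x) (q x)) has_vector_derivative sin (\<theta> x) *\<^sub>R lift (\<gamma> x)) (at x)"
      using has_vector_derivative_dlift_parallel[OF \<gamma> dq] by (simp add: Tq)
    show "coords \<gamma> (x, u, v) = (snd (cosh u *\<^sub>R lift (\<gamma> x) +
       sinh u *\<^sub>R (cos (\<theta> x) *\<^sub>R dlift (\<gamma> x) (q x) - sin (\<theta> x) *\<^sub>R dlift (\<gamma> x) (p x))), v)" for u v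
      unfolding coords_def by (simp add: T_def[symmetric] rotT riem_exp_hyp_metric[OF UU]) (simp add: U_def)
  qed (simp_all add: mink_dlift pq fst_lift_pos)
qed

section \<open>Fermi coordinates along the curve\<close>

lemma has_derivative_imp_lipschitz_at:
  fixes f :: "'a::real_normed_vector \<Rightarrow> 'b::real_normed_vector"
  assumes "(f has_derivative f') (at y)"
  obtains C where "C > 0" "\<forall>\<^sub>F z in nhds y. norm (f z - f y) \<le> C * norm (z - y)"
proof -
  obtain K where K: "K > 0" "\<And>v. norm (f' v) \<le> norm v * K"
    using bounded_linear.pos_bounded[OF has_derivative_bounded_linear[OF assms]] by blast
  have "\<exists>d>0. \<forall>z. norm (z - y) < d \<longrightarrow> norm (f z - f y - f' (z - y)) \<le> 1 * norm (z - y)"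
    using assms unfolding has_derivative_at_alt by (meson zero_less_one)
  then have "\<forall>\<^sub>F z in nhds y. norm (f z - f y - f' (z - y)) \<le> norm (z - y)"
    unfolding eventually_nhds_metric dist_norm by simp
  then have "\<forall>\<^sub>F z in nhds y. norm (f z - f y) \<le> (K + 1) * norm (z - y)"
  proof eventually_elim
    case (elim z)
    have "norm (f z - f y) \<le> norm (f' (z - y)) + norm (f z - f y - f' (z - y))"
      using norm_triangle_ineq[of "f' (z - y)" "f z - f y - f' (z - y)"] by simp
    then show ?case using elim K(2)[of "z - y"] by (simp add: algebra_simps)
  qed
  then show ?thesis using that[of "K + 1"] K by simp
qed

text \<open>\<open>P\<close> and \<open>Q\<close> stand for a lifted parallel frame, so their
  equations hold at every point; all irregularity sits in the angle \<open>H\<close>.\<close>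

locale fermi =
  fixes H :: "real \<Rightarrow> real" and G P Q :: "real \<Rightarrow> real \<times> complex"
  assumes lipschitz_H: "1-lipschitz_on UNIV H"
    and dG: "\<And>x. (G has_vector_derivative cos (H x - H 0) *\<^sub>R P x + sin (H x - H 0) *\<^sub>R Q x) (at x)"
    and dP: "\<And>x. (P has_vector_derivative cos (H x - H 0) *\<^sub>R G x) (at x)"
    and dQ: "\<And>x. (Q has_vector_derivative sin (H x - H 0) *\<^sub>R G x) (at x)"
    and mink_frame: "\<And>x. mink (G x) (G x) = -1" "\<And>x. mink (P x) (P x) = 1" "\<And>x. mink (Q x) (Q x) = 1"
      "\<And>x. mink (G x) (P x) = 0" "\<And>x. mink (G x) (Q x) = 0" "\<And>x. mink (P x) (Q x) = 0"
    and G_pos: "\<And>x. fst (G x) > 0"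
begin

definition \<theta> where "\<theta> x = H x - H 0"
definition T where "T x = cos (\<theta> x) *\<^sub>R P x + sin (\<theta> x) *\<^sub>R Q x"
definition U where "U x = cos (\<theta> x) *\<^sub>R Q x - sin (\<theta> x) *\<^sub>R P x"

lemmas mink_simps = mink.add_left mink.add_right mink.diff_left mink.diff_right
  mink.scaleR_left mink.scaleR_right real_scaleR_def mink.minus_left mink.minus_right

lemma abs_H_diff: "\<bar>H x - H y\<bar> \<le> \<bar>x - y\<bar>"
  using lipschitz_onD[OF lipschitz_H, of x y] by (simp add: dist_real_def)

lemma continuous_H: "continuous_on A H"
  using lipschitz_on_continuous_on[OF lipschitz_H] continuous_on_subset by blast

lemma orth [simp]:
  "mink (G x) (G x) = -1" "mink (T x) (T x) = 1" "mink (U x) (U x) = 1"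
  "mink (G x) (T x) = 0" "mink (G x) (U x) = 0" "mink (T x) (U x) = 0"
  "mink (T x) (G x) = 0" "mink (U x) (G x) = 0" "mink (U x) (T x) = 0"
proof -
  have cs: "cos (\<theta> x) * cos (\<theta> x) + sin (\<theta> x) * sin (\<theta> x) = 1"
    using sin_cos_squared_add3[of "\<theta> x"] by simp
  show "mink (G x) (G x) = -1" "mink (T x) (T x) = 1" "mink (U x) (U x) = 1"
    "mink (G x) (T x) = 0" "mink (G x) (U x) = 0" "mink (T x) (U x) = 0"
    "mink (T x) (G x) = 0" "mink (U x) (G x) = 0" "mink (U x) (T x) = 0"
    using cs unfolding T_def U_def
    by (simp_all add: mink_simps mink_frame mink_commute[of "Q x" "P x"] mink_commute[of "P x" "G x"]
        mink_commute[of "Q x" "G x"])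
qed

text \<open>\<open>L\<close> is injective because pairing with the frame recovers its argument;
  equality of dimensions makes it onto.\<close>

lemma frame_expansion: "v = - mink v (G x) *\<^sub>R G x + mink v (T x) *\<^sub>R T x + mink v (U x) *\<^sub>R U x"
proof -
  define L where "L w = fst w *\<^sub>R G x + Re (snd w) *\<^sub>R T x + Im (snd w) *\<^sub>R U x" for w :: "real \<times> complex"
  have lin: "linear L" by (auto intro!: linearI simp: L_def algebra_simps)
  have L: "mink (L w) (G x) = - fst w" "mink (L w) (T x) = Re (snd w)" "mink (L w) (U x) = Im (snd w)" for w
    by (simp_all add: L_def mink_simps)
  have "inj L"
    by (rule injI) (metis L complex_eqI prod_eqI neg_equal_iff_equal)
  then have "surj L" using lin linear_inj_imp_surj by blast
  then obtain w where w: "v = L w" by (rule surjE)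
  show ?thesis unfolding w L by (simp add: L_def)
qed

lemma mink_expansion: "mink v w = - mink v (G x) * mink w (G x) + mink v (T x) * mink w (T x) + mink v (U x) * mink w (U x)"
proof -
  have "mink v w = mink (- mink v (G x) *\<^sub>R G x + mink v (T x) *\<^sub>R T x + mink v (U x) *\<^sub>R U x) w"
    using frame_expansion[of v x] by simp
  then show ?thesis by (simp add: mink_simps mink_commute[of _ w])
qed

text \<open>Expanding the time vector \<open>(1, 0)\<close> in the frame gives \<open>(fst (G
  x))\<^sup>2 = 1 + (fst (T x))\<^sup>2 + (fst (U x))\<^sup>2\<close>. The bound places the normal
  geodesics on the upper sheet.\<close>

lemma abs_fst_U: "\<bar>fst (U x)\<bar> < fst (G x)"
proof -
  have "mink (1, 0) (1, 0) = -1" and m: "\<And>v. mink (1, 0) v = - fst v" by (simp_all add: mink_def)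
  then have "(fst (U x))\<^sup>2 < (fst (G x))\<^sup>2"
    using mink_expansion[of "(1, 0)" "(1, 0)" x] unfolding m by (simp add: power2_eq_square)
      (smt (verit) zero_le_square)
  then show ?thesis using G_pos[of x] by (metis abs_of_pos power2_less_imp_less abs_ge_zero power2_abs)
qed

text \<open>The frame as a function of two independent variables, the parameter and the increment of
  \<open>H\<close>. It is differentiable at \<open>(x0, 0)\<close>, so the irregularity of
  \<open>H\<close> is confined to the argument substituted in \<open>KT_eq\<close> and
  \<open>KU_eq\<close>.\<close>

definition KT where "KT x0 z = cos (snd z + \<theta> x0) *\<^sub>R P (fst z) + sin (snd z + \<theta> x0) *\<^sub>R Q (fst z)"
  for x0 :: real and z :: "real \<times> real"
definition KU where "KU x0 z = cos (snd z + \<theta> x0) *\<^sub>R Q (fst z) - sin (snd z + \<theta> x0) *\<^sub>R P (fst z)"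
  for x0 :: real and z :: "real \<times> real"

lemma KT_eq: "T x = KT x0 (x, H x - H x0)" and KU_eq: "U x = KU x0 (x, H x - H x0)"
  by (simp_all add: T_def KT_def U_def KU_def \<theta>_def)

lemma dPQ_fst:
  "((\<lambda>z::real \<times> real. P (fst z)) has_derivative (\<lambda>v. fst v *\<^sub>R (cos (\<theta> x0) *\<^sub>R G x0))) (at (x0, 0))"
  "((\<lambda>z::real \<times> real. Q (fst z)) has_derivative (\<lambda>v. fst v *\<^sub>R (sin (\<theta> x0) *\<^sub>R G x0))) (at (x0, 0))"
  "((\<lambda>z::real \<times> real. cos (snd z + \<theta> x0)) has_derivative (\<lambda>v. - sin (\<theta> x0) * snd v)) (at (x0, 0))"
  "((\<lambda>z::real \<times> real. sin (snd z + \<theta> x0)) has_derivative (\<lambda>v. cos (\<theta> x0) * snd v)) (at (x0, 0))"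
proof -
  have f: "(fst has_derivative fst) (at (x0, 0 :: real))"
    by (intro bounded_linear.has_derivative[OF bounded_linear_fst, of "\<lambda>z. z", simplified] has_derivative_ident)
  show "((\<lambda>z::real \<times> real. P (fst z)) has_derivative (\<lambda>v. fst v *\<^sub>R (cos (\<theta> x0) *\<^sub>R G x0))) (at (x0, 0))"
    "((\<lambda>z::real \<times> real. Q (fst z)) has_derivative (\<lambda>v. fst v *\<^sub>R (sin (\<theta> x0) *\<^sub>R G x0))) (at (x0, 0))"
    using has_derivative_compose[OF f, of P "\<lambda>r. r *\<^sub>R (cos (\<theta> x0) *\<^sub>R G x0)"]
      has_derivative_compose[OF f, of Q "\<lambda>r. r *\<^sub>R (sin (\<theta> x0) *\<^sub>R G x0)"] dP[of x0] dQ[of x0]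
    by (simp_all add: has_vector_derivative_def \<theta>_def)
  show "((\<lambda>z::real \<times> real. cos (snd z + \<theta> x0)) has_derivative (\<lambda>v. - sin (\<theta> x0) * snd v)) (at (x0, 0))"
    "((\<lambda>z::real \<times> real. sin (snd z + \<theta> x0)) has_derivative (\<lambda>v. cos (\<theta> x0) * snd v)) (at (x0, 0))"
    by (auto intro!: derivative_eq_intros)
qed

lemma dKT: "(KT x0 has_derivative (\<lambda>v. fst v *\<^sub>R G x0 + snd v *\<^sub>R U x0)) (at (x0, 0))"
proof -
  have cs: "cos (\<theta> x0) * cos (\<theta> x0) + sin (\<theta> x0) * sin (\<theta> x0) = 1"
    using sin_cos_squared_add3[of "\<theta> x0"] by simp
  have "(KT x0 has_derivative (\<lambda>v. (cos (\<theta> x0) *\<^sub>R (fst v *\<^sub>R (cos (\<theta> x0) *\<^sub>R G x0)) + (- sin (\<theta> x0) * snd v) *\<^sub>R P x0)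
     + (sin (\<theta> x0) *\<^sub>R (fst v *\<^sub>R (sin (\<theta> x0) *\<^sub>R G x0)) + (cos (\<theta> x0) * snd v) *\<^sub>R Q x0))) (at (x0, 0))"
    using has_derivative_add[OF has_derivative_scaleR[OF dPQ_fst(3,1)] has_derivative_scaleR[OF dPQ_fst(4,2)], of x0]
    unfolding KT_def[abs_def] by simp
  then show ?thesis
  proof (rule has_derivative_eq_rhs, intro ext)
    fix v :: "real \<times> real"
    have "(fst v * (cos (\<theta> x0) * cos (\<theta> x0))) *\<^sub>R G x0 + (fst v * (sin (\<theta> x0) * sin (\<theta> x0))) *\<^sub>R G x0
        = fst v *\<^sub>R G x0"
      unfolding scaleR_add_left[symmetric] distrib_left[symmetric] cs by simp
    then show "cos (\<theta> x0) *\<^sub>R fst v *\<^sub>R cos (\<theta> x0) *\<^sub>R G x0 + (- sin (\<theta> x0) * snd v) *\<^sub>R P x0 +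
         (sin (\<theta> x0) *\<^sub>R fst v *\<^sub>R sin (\<theta> x0) *\<^sub>R G x0 + (cos (\<theta> x0) * snd v) *\<^sub>R Q x0) =
         fst v *\<^sub>R G x0 + snd v *\<^sub>R U x0"
      by (simp add: U_def algebra_simps)
  qed
qed

lemma dKU: "(KU x0 has_derivative (\<lambda>v. - snd v *\<^sub>R T x0)) (at (x0, 0))"
proof -
  have "(KU x0 has_derivative (\<lambda>v. (cos (\<theta> x0) *\<^sub>R (fst v *\<^sub>R (sin (\<theta> x0) *\<^sub>R G x0)) + (- sin (\<theta> x0) * snd v) *\<^sub>R Q x0)
     - (sin (\<theta> x0) *\<^sub>R (fst v *\<^sub>R (cos (\<theta> x0) *\<^sub>R G x0)) + (cos (\<theta> x0) * snd v) *\<^sub>R P x0))) (at (x0, 0))"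
    using has_derivative_diff[OF has_derivative_scaleR[OF dPQ_fst(3,2)] has_derivative_scaleR[OF dPQ_fst(4,1)], of x0]
    unfolding KU_def[abs_def] by simp
  then show ?thesis by (rule has_derivative_eq_rhs) (auto simp: T_def algebra_simps)
qed

lemma continuous_T: "isCont T x" and continuous_U: "isCont U x"
proof -
  have "isCont P x" "isCont Q x" "isCont H x"
    using has_vector_derivative_continuous[OF dP] has_vector_derivative_continuous[OF dQ] continuous_H[of UNIV]
    by (auto simp: continuous_on_eq_continuous_at)
  then show "isCont T x" "isCont U x"
    unfolding T_def[abs_def] U_def[abs_def] \<theta>_def by (intro continuous_intros; simp)+
qed

lemma continuous_G: "isCont G x"
  using has_vector_derivative_continuous[OF dG] by simp

text \<open>No derivative of the merely Lipschitz function \<open>H\<close> is used here.\<close>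

lemma mink_T_expansion:
  assumes "e > 0"
  shows "\<forall>\<^sub>F x in nhds x0. \<bar>mink Y (T x) - mink Y (T x0)
     - ((x - x0) * mink Y (G x0) + (H x - H x0) * mink Y (U x0))\<bar> \<le> e * \<bar>x - x0\<bar>"
proof -
  have "((\<lambda>z. mink Y (KT x0 z)) has_derivative (\<lambda>v. mink Y (fst v *\<^sub>R G x0 + snd v *\<^sub>R U x0))) (at (x0, 0))"
    by (rule bounded_linear.has_derivative[OF mink.bounded_linear_right dKT])
  then have "\<exists>d>0. \<forall>z. norm (z - (x0, 0)) < d \<longrightarrow> norm (mink Y (KT x0 z) - mink Y (KT x0 (x0, 0))
      - mink Y (fst (z - (x0, 0)) *\<^sub>R G x0 + snd (z - (x0, 0)) *\<^sub>R U x0)) \<le> (e / 2) * norm (z - (x0, 0))"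
    using assms unfolding has_derivative_at_alt by (meson half_gt_zero)
  then obtain d where d: "d > 0" "\<And>z. norm (z - (x0, 0)) < d \<Longrightarrow> norm (mink Y (KT x0 z) - mink Y (KT x0 (x0, 0))
      - mink Y (fst (z - (x0, 0)) *\<^sub>R G x0 + snd (z - (x0, 0)) *\<^sub>R U x0)) \<le> (e / 2) * norm (z - (x0, 0))"
    by blast
  show ?thesis unfolding eventually_nhds_metric
  proof (intro exI[of _ "d / 2"] conjI allI impI)
    fix x assume x: "dist x x0 < d / 2"
    \<comment> \<open>The Lipschitz constant 1 compares the increment of \<open>H\<close> with that
      of \<open>x\<close>.\<close>
    have n: "norm ((x, H x - H x0) - (x0, 0)) \<le> 2 * \<bar>x - x0\<bar>"
      using norm_Pair_le[of "x - x0" "H x - H x0"] abs_H_diff[of x x0] by simp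
    then have "norm ((x, H x - H x0) - (x0, 0)) < d" using x by (simp add: dist_real_def)
    from d(2)[OF this] have "\<bar>mink Y (T x) - mink Y (T x0)
     - ((x - x0) * mink Y (G x0) + (H x - H x0) * mink Y (U x0))\<bar> \<le> (e / 2) * norm ((x, H x - H x0) - (x0, 0))"
      unfolding KT_eq[of x x0] KT_eq[of x0 x0] by (simp add: mink_simps)
    also have "\<dots> \<le> (e / 2) * (2 * \<bar>x - x0\<bar>)" using n assms by (intro mult_left_mono) auto
    finally show "\<bar>mink Y (T x) - mink Y (T x0)
     - ((x - x0) * mink Y (G x0) + (H x - H x0) * mink Y (U x0))\<bar> \<le> e * \<bar>x - x0\<bar>" by simp
  qed (use d in auto)
qed

section \<open>Existence and uniqueness of the foot point\<close>

text \<open>\<open>- mink (lift y) (G x)\<close> is the hyperbolic cosine of a distance. The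
  identity expands \<open>mink (lift y) (lift y) = -1\<close> in the frame; the strict bound on the
  \<open>U\<close> component is what the Lipschitz constant 1 is weighed against.\<close>

lemma mink_lift_G:
  "mink (lift y) (G x) < 0"
  "(mink (lift y) (G x))\<^sup>2 = 1 + (mink (lift y) (T x))\<^sup>2 + (mink (lift y) (U x))\<^sup>2"
  "\<bar>mink (lift y) (U x)\<bar> < - mink (lift y) (G x)"
proof -
  have gg: "fst (G x) = sqrt (1 + snd (G x) \<bullet> snd (G x))"
    using orth(1)[of x] G_pos[of x] by (simp add: mink_def) (smt (verit) real_sqrt_abs2 zero_less_mult_iff)
  have "y \<bullet> snd (G x) \<le> norm y * norm (snd (G x))" by (rule norm_cauchy_schwarz)
  also have "\<dots> < fst (lift y) * fst (G x)"
    unfolding gg lift_def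
    by (intro mult_strict_mono') (auto simp: norm_eq_sqrt_inner)
  finally show neg: "mink (lift y) (G x) < 0" by (simp add: mink_def)
  show sq: "(mink (lift y) (G x))\<^sup>2 = 1 + (mink (lift y) (T x))\<^sup>2 + (mink (lift y) (U x))\<^sup>2"
    using mink_expansion[of "lift y" "lift y" x] by (simp add: power2_eq_square)
  have "\<bar>mink (lift y) (U x)\<bar>\<^sup>2 < (- mink (lift y) (G x))\<^sup>2"
    unfolding power2_minus sq by (simp add: add_pos_nonneg)
  then show "\<bar>mink (lift y) (U x)\<bar> < - mink (lift y) (G x)"
    using neg by (metis power2_less_imp_less less_imp_le neg_0_less_iff_less)
qed

text \<open>To first order the change is \<open>s - x\<close> times the \<open>G\<close> component
  plus the increment of \<open>H\<close> times the \<open>U\<close> component. That increment is at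
  most \<open>s - x\<close>, so the \<open>U\<close> component can weaken the decrease by no more
  than its absolute value. The slope \<open>m\<close> records the remaining rate.\<close>

lemma mink_T_right_decreasing:
  assumes m: "m < - mink (lift y) (G x) - \<bar>mink (lift y) (U x)\<bar>"
  shows "\<forall>\<^sub>F s in at_right x. mink (lift y) (T s) + m * s < mink (lift y) (T x) + m * x"
proof -
  define e where "e = (- mink (lift y) (G x) - \<bar>mink (lift y) (U x)\<bar> - m) / 2"
  have e: "e > 0" using m by (simp add: e_def)
  have "\<forall>\<^sub>F s in at_right x. \<bar>mink (lift y) (T s) - mink (lift y) (T x)
     - ((s - x) * mink (lift y) (G x) + (H s - H x) * mink (lift y) (U x))\<bar> \<le> e * \<bar>s - x\<bar>"
    using mink_T_expansion[OF e, where ?x0.0 = x and Y = "lift y"] by (auto simp: eventually_at_filter elim: eventually_mono)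
  moreover have "\<forall>\<^sub>F s in at_right x. x < s" by (rule eventually_at_right_less)
  ultimately show ?thesis
  proof eventually_elim
    case (elim s)
    have "(H s - H x) * mink (lift y) (U x) \<le> \<bar>H s - H x\<bar> * \<bar>mink (lift y) (U x)\<bar>"
      by (metis abs_ge_self abs_mult)
    also have "\<dots> \<le> (s - x) * \<bar>mink (lift y) (U x)\<bar>"
      using abs_H_diff[of s x] elim by (intro mult_right_mono) auto
    finally have "mink (lift y) (T s) - mink (lift y) (T x) \<le>
        (s - x) * mink (lift y) (G x) + (s - x) * \<bar>mink (lift y) (U x)\<bar> + e * (s - x)"
      using elim by simp
    also have "\<dots> = - (m + e) * (s - x)" by (simp add: e_def field_simps)
    also have "\<dots> < - m * (s - x)"
    proof -
      have "0 < e * (s - x)" using elim e by simp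
      then show ?thesis by (simp add: algebra_simps)
    qed
    finally show ?case by (simp add: algebra_simps)
  qed
qed

lemma continuous_mink_T: "continuous_on A (\<lambda>x. mink Y (T x))"
  using continuous_T by (intro continuous_at_imp_continuous_on ballI mink.continuous) auto

text \<open>Local decrease gives a weak inequality on intervals; a point \<open>s\<close> just to
  the right of \<open>x1\<close> makes it strict.\<close>

lemma mink_T_strict_antimono: "x1 < x2 \<Longrightarrow> mink (lift y) (T x2) < mink (lift y) (T x1)"
proof -
  assume "x1 < x2"
  have "\<forall>\<^sub>F s in at_right x. mink (lift y) (T s) < mink (lift y) (T x)" for x
    using mink_T_right_decreasing[of 0 y x] mink_lift_G[of y x] by simp
  note dec = this
  have "\<forall>\<^sub>F s in at_right x1. x1 < s \<and> s < x2" using \<open>x1 < x2\<close> by (rule eventually_at_right_real[THEN eventually_mono]) auto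
  then obtain s where s: "x1 < s" "s < x2" "mink (lift y) (T s) < mink (lift y) (T x1)"
    using eventually_happens[OF eventually_conj[OF _ dec[of x1]]] by force
  have "mink (lift y) (T x2) \<le> mink (lift y) (T s)"
    by (rule right_decreasing_imp_le[where E = "{}" and \<xi> = "\<lambda>x. mink (lift y) (T x)"])
      (use s dec continuous_mink_T in auto)
  then show ?thesis using s by simp
qed

text \<open>From \<open>\<psi>\<^sup>2 - \<sigma>\<^sup>2 \<ge> 1\<close> and
  \<open>\<psi> + \<sigma> \<le> 2 * C\<close> the rate \<open>\<psi> - \<sigma>\<close> is at least
  \<open>1 / (2 * C)\<close>; the smaller constant \<open>1 / (4 * C)\<close> provides the strict
  inequality.\<close>

lemma mink_T_decay:
  assumes "a \<le> b" and C: "\<And>x. a \<le> x \<Longrightarrow> x \<le> b \<Longrightarrow> - mink (lift y) (G x) \<le> C" and "C > 0"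
  shows "mink (lift y) (T b) + (1 / (4 * C)) * b \<le> mink (lift y) (T a) + (1 / (4 * C)) * a"
proof (rule right_decreasing_imp_le[where E = "{}" and \<xi> = "\<lambda>x. mink (lift y) (T x) + (1 / (4 * C)) * x"])
  show "continuous_on {a..b} (\<lambda>x. mink (lift y) (T x) + (1 / (4 * C)) * x)"
    by (intro continuous_intros continuous_mink_T)
  fix x assume x: "a < x" "x < b"
  define \<psi> \<sigma> where "\<psi> = - mink (lift y) (G x)" and "\<sigma> = \<bar>mink (lift y) (U x)\<bar>"
  have \<psi>: "\<psi> \<le> C" "0 < \<psi>" "\<sigma> < \<psi>" "0 \<le> \<sigma>"
    using C[of x] x mink_lift_G[of y x] by (auto simp: \<psi>_def \<sigma>_def)
  have "\<psi>\<^sup>2 - \<sigma>\<^sup>2 \<ge> 1" using mink_lift_G(2)[of y x] by (simp add: \<psi>_def \<sigma>_def)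
  then have "1 \<le> (\<psi> - \<sigma>) * (\<psi> + \<sigma>)" by (simp add: power2_eq_square algebra_simps)
  also have "\<dots> \<le> (\<psi> - \<sigma>) * (2 * C)" using \<psi> by (intro mult_left_mono) auto
  finally have "1 / (2 * C) \<le> \<psi> - \<sigma>" using \<open>C > 0\<close> by (simp add: field_simps)
  moreover have "1 / (4 * C) < 1 / (2 * C)" using \<open>C > 0\<close> by (simp add: field_simps)
  ultimately have "1 / (4 * C) < \<psi> - \<sigma>" by linarith
  then show "\<forall>\<^sub>F s in at_right x. mink (lift y) (T s) + (1 / (4 * C)) * s < mink (lift y) (T x) + (1 / (4 * C)) * x"
    unfolding \<psi>_def \<sigma>_def by (rule mink_T_right_decreasing)
qed (use assms in auto)

lemma dmink_G: "((\<lambda>x. mink Y (G x)) has_real_derivative mink Y (T x)) (at x)"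
  using bounded_linear.has_vector_derivative[OF mink.bounded_linear_right[of Y] dG[of x]]
  by (simp add: has_real_derivative_iff_has_vector_derivative T_def \<theta>_def)

text \<open>The distance to the point \<open>y\<close> along the curve, \<open>arcosh (- mink (lift y) (G x))\<close>, has a
  critical point: otherwise it would decrease forever, at a rate bounded away from zero.\<close>

lemma ex1_foot: "\<exists>!x. mink (lift y) (T x) = 0"
proof (rule ex_ex1I)
  define C where "C = - mink (lift y) (G 0)"
  have C: "C > 0" using mink_lift_G(1) by (simp add: C_def)
  define \<phi> where "\<phi> x = mink (lift y) (T x)" for x
  have cont: "continuous_on A \<phi>" for A unfolding \<phi>_def by (rule continuous_mink_T)
  \<comment> \<open>Over this distance a decrease at rate \<open>1 / (4 * C)\<close> uses up
    \<open>\<phi> 0\<close>.\<close>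
  define X where "X = 4 * C * \<bar>\<phi> 0\<bar>"
  have X: "X \<ge> 0" using C by (simp add: X_def)
  consider "\<phi> 0 \<ge> 0" | "\<phi> 0 < 0" by linarith
  then show "\<exists>x. mink (lift y) (T x) = 0"
  proof cases
    case 1
    show ?thesis
    proof (rule ccontr)
      assume no: "\<nexists>x. mink (lift y) (T x) = 0"
      have pos: "\<phi> x \<ge> 0" if "x \<ge> 0" for x
        using IVT2'[of \<phi> x 0 0] that 1 cont no by (force simp: \<phi>_def)
      \<comment> \<open>While \<open>\<phi>\<close> is nonnegative the distance to \<open>y\<close>
        does not grow, so \<open>C\<close> remains a bound and \<open>mink_T_decay\<close>
        applies.\<close>
      have "- mink (lift y) (G x) \<le> C" if "0 \<le> x" for x
      proof -
        have "mink (lift y) (G 0) \<le> mink (lift y) (G x)"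
          by (rule DERIV_nonneg_imp_nondecreasing[OF that]) (metis dmink_G pos \<phi>_def)
        then show ?thesis by (simp add: C_def)
      qed
      then have "\<phi> X + (1 / (4 * C)) * X \<le> \<phi> 0 + (1 / (4 * C)) * 0"
        unfolding \<phi>_def using X C by (intro mink_T_decay) auto
      then have "\<phi> X \<le> 0" using C 1 by (simp add: X_def)
      then show False using pos[OF X] no by (force simp: \<phi>_def)
    qed
  next
    case 2
    show ?thesis
    proof (rule ccontr)
      assume no: "\<nexists>x. mink (lift y) (T x) = 0"
      have neg: "\<phi> x \<le> 0" if "x \<le> 0" for x
        using IVT2'[of \<phi> 0 0 x] that 2 cont no by (force simp: \<phi>_def)
      have "- mink (lift y) (G x) \<le> C" if "x \<le> 0" for x
      proof -
        have "mink (lift y) (G 0) \<le> mink (lift y) (G x)"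
          by (rule DERIV_nonpos_imp_nonincreasing[OF that]) (metis dmink_G neg \<phi>_def)
        then show ?thesis by (simp add: C_def)
      qed
      then have "\<phi> 0 + (1 / (4 * C)) * 0 \<le> \<phi> (- X) + (1 / (4 * C)) * (- X)"
        unfolding \<phi>_def using X C by (intro mink_T_decay) auto
      then have "\<phi> (- X) \<ge> 0" using C 2 by (simp add: X_def)
      then show False using neg[of "- X"] X no by (force simp: \<phi>_def)
    qed
  qed
qed (metis linorder_cases mink_T_strict_antimono order_less_irrefl)

section \<open>The coordinates \<open>foot\<close> and \<open>height\<close> and their
  inverse\<close>

definition foot where "foot y = (THE x. mink (lift y) (T x) = 0)"
definition height where "height y = arsinh (mink (lift y) (U (foot y)))"
definition \<Phi> where "\<Phi> x u = snd (cosh u *\<^sub>R G x + sinh u *\<^sub>R U x)"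

lemma foot_zero: "mink (lift y) (T (foot y)) = 0"
  unfolding foot_def by (rule theI'[OF ex1_foot])

lemma foot_unique: "mink (lift y) (T x) = 0 \<Longrightarrow> foot y = x"
  using ex1_foot[of y] foot_zero[of y] by blast

lemma sinh_height: "sinh (height y) = mink (lift y) (U (foot y))"
  by (simp add: height_def)

lemma cosh_height: "cosh (height y) = - mink (lift y) (G (foot y))"
proof -
  have "(cosh (height y))\<^sup>2 = (- mink (lift y) (G (foot y)))\<^sup>2"
    using mink_lift_G(2)[of y "foot y"] by (simp add: cosh_square_eq sinh_height foot_zero)
  then show ?thesis
    using mink_lift_G(1)[of y "foot y"] by (intro power2_eq_imp_eq[of "cosh (height y)"]) auto
qed

lemma lift_eq: "lift y = cosh (height y) *\<^sub>R G (foot y) + sinh (height y) *\<^sub>R U (foot y)"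
  using frame_expansion[of "lift y" "foot y"] by (simp add: sinh_height cosh_height foot_zero)

text \<open>A unit timelike vector with positive time component is the lift of its spatial part.
  Positivity combines \<open>\<bar>sinh u\<bar> \<le> cosh u\<close> with
  \<open>abs_fst_U\<close>.\<close>

lemma lift_\<Phi>: "lift (\<Phi> x u) = cosh u *\<^sub>R G x + sinh u *\<^sub>R U x"
proof -
  define v where "v = cosh u *\<^sub>R G x + sinh u *\<^sub>R U x"
  have mv: "mink v v = -1"
    using cosh_square_eq[of u] by (simp add: v_def mink_simps power2_eq_square)
  have "\<bar>sinh u * fst (U x)\<bar> \<le> cosh u * \<bar>fst (U x)\<bar>"
    using sinh_le_cosh_real[of "\<bar>u\<bar>"] by (simp add: abs_mult mult_right_mono flip: sinh_real_abs)
  also have "\<dots> < cosh u * fst (G x)" using abs_fst_U[of x] by simp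
  finally have "fst v > 0" by (simp add: v_def)
  moreover have "(fst v)\<^sup>2 = 1 + snd v \<bullet> snd v" using mv by (simp add: mink_def power2_eq_square)
  ultimately have "fst v = sqrt (1 + snd v \<bullet> snd v)" by (metis real_sqrt_unique less_imp_le)
  then show ?thesis unfolding \<Phi>_def v_def[symmetric] by (simp add: lift_def prod_eq_iff)
qed

lemma foot_\<Phi> [simp]: "foot (\<Phi> x u) = x"
  by (rule foot_unique) (simp add: lift_\<Phi> mink_simps)

lemma height_\<Phi> [simp]: "height (\<Phi> x u) = u"
  by (simp add: height_def lift_\<Phi> mink_simps arsinh_sinh_real)

lemma \<Phi>_foot_height [simp]: "\<Phi> (foot y) (height y) = y"
  unfolding \<Phi>_def lift_eq[symmetric] by simp

text \<open>\<open>mink (lift y) (T x)\<close> is decreasing in \<open>x\<close> and continuous in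
  \<open>y\<close>: its signs at \<open>x0 + e\<close> and \<open>x0 - e\<close> persist for nearby
  \<open>y\<close> and trap the foot point between.\<close>

lemma continuous_foot: "isCont foot y0"
proof -
  have "\<forall>\<^sub>F y in nhds y0. dist (foot y) (foot y0) < e" if e: "e > 0" for e
  proof -
    define x0 where "x0 = foot y0"
    have c: "((\<lambda>y. mink (lift y) v) \<longlongrightarrow> mink (lift y0) v) (nhds y0)" for v
      using has_derivative_continuous[OF has_derivative_lift, of y0]
      by (intro mink.tendsto tendsto_const) (simp add: isCont_def tendsto_at_iff_tendsto_nhds)
    have "mink (lift y0) (T (x0 + e)) < 0" "0 < mink (lift y0) (T (x0 - e))"
      using mink_T_strict_antimono[of x0 "x0 + e" y0] mink_T_strict_antimono[of "x0 - e" x0 y0] e foot_zero[of y0]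
      by (auto simp: x0_def)
    then have "\<forall>\<^sub>F y in nhds y0. mink (lift y) (T (x0 + e)) < 0" "\<forall>\<^sub>F y in nhds y0. 0 < mink (lift y) (T (x0 - e))"
      using c order_tendstoD by blast+
    then show ?thesis
    proof eventually_elim
      case (elim y)
      have "foot y < x0 + e"
        using mink_T_strict_antimono[of "x0 + e" "foot y" y] elim foot_zero[of y]
        by (metis linorder_cases order_less_asym order_less_irrefl)
      moreover have "x0 - e < foot y"
        using mink_T_strict_antimono[of "foot y" "x0 - e" y] elim foot_zero[of y]
        by (metis linorder_cases order_less_asym order_less_irrefl)
      ultimately show ?case by (simp add: x0_def dist_real_def abs_less_iff)
    qed
  qed
  then show ?thesis unfolding isCont_def tendsto_at_iff_tendsto_nhds by (simp add: tendsto_iff)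
qed

lemma continuous_height: "isCont height y"
  unfolding height_def[abs_def]
  using has_derivative_continuous[OF has_derivative_lift, of y] isCont_o2[OF continuous_foot continuous_U]
  by (intro continuous_intros mink.continuous) auto

lemma continuous_\<Phi>: "continuous_on A (\<lambda>z. \<Phi> (fst z) (snd z))"
proof -
  have "continuous_on UNIV G" "continuous_on UNIV U"
    using continuous_G continuous_U by (auto simp: continuous_on_eq_continuous_at)
  then have "continuous_on A (\<lambda>z. G (fst z))" "continuous_on A (\<lambda>z. U (fst z))" for A :: "(real \<times> real) set"
    by (auto intro: continuous_on_compose2[OF _ continuous_on_fst[OF continuous_on_id]])
  then show ?thesis unfolding \<Phi>_def by (auto intro!: continuous_intros)
qed

lemma exp_height_le: "exp (- \<bar>height y\<bar>) \<le> cosh (height y) - \<bar>sinh (height y)\<bar>"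
  by (metis cosh_minus_sinh cosh_real_abs sinh_real_abs order_refl)

text \<open>Near \<open>x0\<close> the function \<open>mink (lift y0) (T x)\<close> moves away from
  zero at rate at least \<open>\<kappa> / 2\<close>. At \<open>foot y\<close> it equals
  \<open>mink (lift y0 - lift y) (T (foot y))\<close>, which is of order
  \<open>y - y0\<close>.\<close>

lemma foot_lipschitz_at:
  obtains C where "C > 0" "\<forall>\<^sub>F y in nhds y0. \<bar>foot y - foot y0\<bar> \<le> C * norm (y - y0)"
proof -
  define x0 \<kappa> where "x0 = foot y0" and "\<kappa> = - mink (lift y0) (G x0) - \<bar>mink (lift y0) (U x0)\<bar>"
  have \<kappa>: "\<kappa> > 0" using mink_lift_G(3)[of y0 x0] by (simp add: \<kappa>_def)
  obtain K where K: "K > 0" "\<And>a b. norm (mink a b) \<le> norm a * norm b * K"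
    using mink.pos_bounded by blast
  obtain L where L: "L > 0" "\<forall>\<^sub>F y in nhds y0. norm (lift y - lift y0) \<le> L * norm (y - y0)"
    using has_derivative_imp_lipschitz_at[OF has_derivative_lift] .
  have foot: "filterlim foot (nhds x0) (nhds y0)"
    using continuous_foot[of y0] by (simp add: isCont_def tendsto_at_iff_tendsto_nhds x0_def)
  have "isCont (\<lambda>y. norm (T (foot y))) y0"
    using isCont_o2[OF continuous_foot continuous_T] by (intro continuous_intros)
  then have "((\<lambda>y. norm (T (foot y))) \<longlongrightarrow> norm (T x0)) (nhds y0)"
    unfolding isCont_def x0_def by (subst (asm) tendsto_at_iff_tendsto_nhds)
  then have T1: "\<forall>\<^sub>F y in nhds y0. norm (T (foot y)) < norm (T x0) + 1"
    by (rule order_tendstoD(2)) simp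
  define M where "M = L * (norm (T x0) + 1) * K * 2 / \<kappa>"
  have "M > 0" unfolding M_def using L K \<kappa> by (intro divide_pos_pos mult_pos_pos add_nonneg_pos) auto
  have "\<forall>\<^sub>F y in nhds y0. \<bar>mink (lift y0) (T (foot y)) - mink (lift y0) (T x0)
     - ((foot y - x0) * mink (lift y0) (G x0) + (H (foot y) - H x0) * mink (lift y0) (U x0))\<bar>
     \<le> \<kappa> / 2 * \<bar>foot y - x0\<bar>"
    using mink_T_expansion[of "\<kappa> / 2", where ?x0.0 = x0 and Y = "lift y0"] \<kappa> foot by (auto simp: filterlim_iff)
  with L(2) T1 have "\<forall>\<^sub>F y in nhds y0. \<bar>foot y - foot y0\<bar> \<le> M * norm (y - y0)"
  proof eventually_elim
    case (elim y)
    define s \<eta> where "s = foot y - x0" and "\<eta> = H (foot y) - H x0"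
    have "\<bar>\<eta>\<bar> \<le> \<bar>s\<bar>" using abs_H_diff by (simp add: s_def \<eta>_def)
    then have "\<bar>\<eta> * mink (lift y0) (U x0)\<bar> \<le> \<bar>s\<bar> * \<bar>mink (lift y0) (U x0)\<bar>"
      by (simp add: abs_mult mult_right_mono)
    moreover have "\<bar>s * mink (lift y0) (G x0)\<bar> = \<bar>s\<bar> * - mink (lift y0) (G x0)"
      using mink_lift_G(1)[of y0 x0] by (simp add: abs_mult)
    ultimately have "\<kappa> * \<bar>s\<bar> \<le> \<bar>s * mink (lift y0) (G x0) + \<eta> * mink (lift y0) (U x0)\<bar>"
      unfolding \<kappa>_def by (simp add: algebra_simps)
    then have "\<kappa> / 2 * \<bar>s\<bar> \<le> \<bar>mink (lift y0) (T (foot y))\<bar>"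
    proof -
      define A B where "A = mink (lift y0) (T (foot y))" and "B = s * mink (lift y0) (G x0) + \<eta> * mink (lift y0) (U x0)"
      have "\<bar>A - B\<bar> \<le> \<kappa> / 2 * \<bar>s\<bar>"
        using elim(3) foot_zero[of y0] by (simp add: A_def B_def s_def[symmetric] \<eta>_def[symmetric] x0_def[symmetric])
      moreover have "\<bar>B\<bar> \<le> \<bar>A\<bar> + \<bar>A - B\<bar>" by linarith
      moreover have "\<kappa> * \<bar>s\<bar> \<le> \<bar>B\<bar>" unfolding B_def by fact
      ultimately show ?thesis unfolding A_def[symmetric] by linarith
    qed
    also have "mink (lift y0) (T (foot y)) = - mink (lift y - lift y0) (T (foot y))"
      by (simp add: mink_simps foot_zero)
    also have "\<bar>\<dots>\<bar> \<le> norm (lift y - lift y0) * norm (T (foot y)) * K"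
      using K(2)[of "lift y - lift y0" "T (foot y)"] by simp
    also have "\<dots> \<le> (L * norm (y - y0)) * (norm (T x0) + 1) * K"
      using elim K L by (intro mult_right_mono mult_mono) auto
    finally show ?case using \<kappa> by (simp add: M_def s_def x0_def field_simps)
  qed
  then show thesis using that[OF \<open>M > 0\<close>] by blast
qed

section \<open>Derivatives of the coordinates\<close>

text \<open>Where \<open>H\<close> is differentiable at the foot point, \<open>\<tau>\<close> and
  \<open>\<nu>\<close> are (cosh u - h sinh u) dx and du. Defined through the frame, they make sense
  everywhere.\<close>

definition \<tau> where "\<tau> y a = mink (T (foot y)) (dlift y a)"
definition \<nu> where "\<nu> y a = mink (sinh (height y) *\<^sub>R G (foot y) + cosh (height y) *\<^sub>R U (foot y)) (dlift y a)"

lemma foot_H_lipschitz_at: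
  obtains C where "\<forall>\<^sub>F y in nhds y0. norm ((foot y, H (foot y) - H (foot y0)) - (foot y0, H (foot y0) - H (foot y0)))
     \<le> C * norm (y - y0)"
proof -
  obtain C where "C > 0" and C: "\<forall>\<^sub>F y in nhds y0. \<bar>foot y - foot y0\<bar> \<le> C * norm (y - y0)"
    by (rule foot_lipschitz_at)
  from C have "\<forall>\<^sub>F y in nhds y0. norm ((foot y, H (foot y) - H (foot y0)) - (foot y0, H (foot y0) - H (foot y0)))
     \<le> (2 * C) * norm (y - y0)"
  proof eventually_elim
    case (elim y)
    have "norm ((foot y, H (foot y) - H (foot y0)) - (foot y0, H (foot y0) - H (foot y0))) \<le> 2 * \<bar>foot y - foot y0\<bar>"
      using norm_Pair_le[of "foot y - foot y0" "H (foot y) - H (foot y0)"] abs_H_diff[of "foot y" "foot y0"] by simp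
    then show ?case using elim by simp
  qed
  then show ?thesis by (rule that)
qed

text \<open>Although \<open>foot\<close> and \<open>H \<circ> foot\<close> are merely Lipschitz, this combination of them is differentiable.\<close>

lemma dfoot_combination:
  "((\<lambda>y. cosh (height y0) * foot y - sinh (height y0) * H (foot y)) has_derivative \<tau> y0) (at y0)"
proof -
  define x0 Y0 where "x0 = foot y0" and "Y0 = lift y0"
  define k where "k y = (foot y, H (foot y) - H x0)" for y
  obtain C where "\<forall>\<^sub>F y in nhds y0. norm (k y - k y0) \<le> C * norm (y - y0)"
    using foot_H_lipschitz_at[of y0] unfolding k_def x0_def by blast
  then have "((\<lambda>y. KT x0 (k y) - (fst (k y) *\<^sub>R G x0 + snd (k y) *\<^sub>R U x0)) has_derivative (\<lambda>_. 0)) (at y0)"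
    by (rule has_derivative_zero_comp[rotated]) (use dKT in \<open>simp add: k_def x0_def\<close>)
  from bounded_linear.has_derivative[OF mink.bounded_linear_right this]
  have E: "((\<lambda>y. mink Y0 (KT x0 (k y) - (fst (k y) *\<^sub>R G x0 + snd (k y) *\<^sub>R U x0))) has_derivative (\<lambda>_. 0)) (at y0)"
    by (simp add: mink.zero_right)
  have "((\<lambda>y. mink (lift y - Y0) (T (foot y))) has_derivative (\<lambda>a. mink (dlift y0 a) (T (foot y0)))) (at y0)"
    by (rule has_derivative_mult_vanishing[OF bounded_bilinear_mink _ _ isCont_o2[OF continuous_foot continuous_T]])
      (auto simp: Y0_def intro!: derivative_eq_intros has_derivative_lift)
  from has_derivative_add[OF this E]
  have "((\<lambda>y. mink (lift y - Y0) (T (foot y)) + mink Y0 (KT x0 (k y) - (fst (k y) *\<^sub>R G x0 + snd (k y) *\<^sub>R U x0)))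
     has_derivative \<tau> y0) (at y0)"
    by (simp add: \<tau>_def[abs_def] mink_commute[of _ "T (foot y0)"])
  \<comment> \<open>The terms \<open>mink (lift y) (T (foot y))\<close> vanish; what remains is
    minus the linear part of \<open>KT x0\<close>, paired with \<open>lift y0\<close>.\<close>
  moreover have "mink (lift y - Y0) (T (foot y)) + mink Y0 (KT x0 (k y) - (fst (k y) *\<^sub>R G x0 + snd (k y) *\<^sub>R U x0))
    = cosh (height y0) * foot y - sinh (height y0) * H (foot y) + sinh (height y0) * H x0" for y
    unfolding k_def KT_eq[symmetric]
    by (simp add: mink_simps foot_zero Y0_def x0_def cosh_height sinh_height algebra_simps)
  ultimately have "((\<lambda>y. cosh (height y0) * foot y - sinh (height y0) * H (foot y) + sinh (height y0) * H x0)
    has_derivative \<tau> y0) (at y0)" by simp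
  from has_derivative_diff[OF this has_derivative_const[of "sinh (height y0) * H x0"]] show ?thesis by simp
qed

text \<open>\<open>dlift y a\<close> is orthogonal to \<open>lift y\<close>, so its product with
  \<open>G\<close> at the foot point is determined by that with \<open>U\<close>.\<close>

lemma \<nu>_eq: "\<nu> y a = mink (U (foot y)) (dlift y a) / cosh (height y)"
proof -
  define c s where "c = cosh (height y)" and "s = sinh (height y)"
  have cs: "c * c = 1 + s * s" using cosh_square_eq[of "height y"] by (simp add: c_def s_def power2_eq_square)
  have "c > 0" by (simp add: c_def)
  have "c * mink (G (foot y)) (dlift y a) + s * mink (U (foot y)) (dlift y a) = 0"
    using mink_lift_dlift[of y a] by (subst (asm) lift_eq) (simp add: mink_simps c_def s_def)
  then have cG: "c * mink (G (foot y)) (dlift y a) = - s * mink (U (foot y)) (dlift y a)" by simp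
  have "c * \<nu> y a = s * (c * mink (G (foot y)) (dlift y a)) + c * c * mink (U (foot y)) (dlift y a)"
    by (simp add: \<nu>_def c_def[symmetric] s_def[symmetric] mink_simps algebra_simps)
  then have "c * \<nu> y a = (c * c - s * s) * mink (U (foot y)) (dlift y a)"
    unfolding cG by (simp add: algebra_simps)
  then show ?thesis using \<open>c > 0\<close> cs by (simp add: c_def[symmetric] field_simps)
qed

text \<open>To first order \<open>KU\<close> moves along \<open>T x0\<close> only, and
  \<open>T x0\<close> is orthogonal to \<open>lift y0\<close>. The increment of \<open>H\<close>
  therefore drops out, whether or not \<open>H\<close> is differentiable.\<close>

lemma dheight: "(height has_derivative \<nu> y0) (at y0)"
proof -
  define x0 Y0 where "x0 = foot y0" and "Y0 = lift y0"
  define k where "k y = (foot y, H (foot y) - H x0)" for y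
  obtain C where "\<forall>\<^sub>F y in nhds y0. norm (k y - k y0) \<le> C * norm (y - y0)"
    using foot_H_lipschitz_at[of y0] unfolding k_def x0_def by blast
  then have "((\<lambda>y. KU x0 (k y) - (- snd (k y) *\<^sub>R T x0)) has_derivative (\<lambda>_. 0)) (at y0)"
    by (rule has_derivative_zero_comp[rotated]) (use dKU in \<open>simp add: k_def x0_def\<close>)
  from bounded_linear.has_derivative[OF mink.bounded_linear_right this]
  have E: "((\<lambda>y. mink Y0 (KU x0 (k y) - (- snd (k y) *\<^sub>R T x0))) has_derivative (\<lambda>_. 0)) (at y0)"
    by (simp add: mink.zero_right)
  have "((\<lambda>y. mink (lift y - Y0) (U (foot y))) has_derivative (\<lambda>a. mink (dlift y0 a) (U (foot y0)))) (at y0)"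
    by (rule has_derivative_mult_vanishing[OF bounded_bilinear_mink _ _ isCont_o2[OF continuous_foot continuous_U]])
      (auto simp: Y0_def intro!: derivative_eq_intros has_derivative_lift)
  from has_derivative_add[OF this E]
  have "((\<lambda>y. mink (lift y - Y0) (U (foot y)) + mink Y0 (KU x0 (k y) - (- snd (k y) *\<^sub>R T x0)))
     has_derivative (\<lambda>a. mink (U x0) (dlift y0 a))) (at y0)"
    by (simp add: x0_def mink_commute[of _ "U (foot y0)"])
  moreover have "mink (lift y - Y0) (U (foot y)) + mink Y0 (KU x0 (k y) - (- snd (k y) *\<^sub>R T x0))
    = mink (lift y) (U (foot y))" for y
    unfolding k_def KU_eq[symmetric] by (simp add: mink_simps foot_zero Y0_def x0_def)
  ultimately have "((\<lambda>y. mink (lift y) (U (foot y))) has_derivative (\<lambda>a. mink (U x0) (dlift y0 a))) (at y0)"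
    by simp
  moreover have "(arsinh has_derivative (*) (1 / cosh (height y0))) (at (mink (lift y0) (U (foot y0))))"
  proof -
    have "sqrt ((sinh (height y0))\<^sup>2 + 1) = cosh (height y0)"
      by (simp add: sinh_square_eq)
    then show ?thesis
      using arsinh_real_has_field_derivative[of "sinh (height y0)" UNIV]
      by (simp add: has_field_derivative_def sinh_height[symmetric] inverse_eq_divide)
  qed
  ultimately have "(height has_derivative (\<lambda>a. 1 / cosh (height y0) * mink (U x0) (dlift y0 a))) (at y0)"
    unfolding height_def[abs_def] by (rule has_derivative_compose)
  then show ?thesis by (rule has_derivative_eq_rhs) (simp add: \<nu>_eq x0_def ext)
qed

text \<open>With a derivative of \<open>H\<close> at hand, \<open>H (foot y) - h * foot y\<close>
  has derivative zero. Adding a multiple of it to \<open>dfoot_combination\<close> leaves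
  \<open>w\<close> times \<open>foot\<close>, and \<open>w\<close> is positive because
  \<open>\<bar>h\<bar> \<le> 1\<close>.\<close>

lemma dfoot:
  assumes h: "(H has_real_derivative h) (at (foot y0))" and "\<bar>h\<bar> \<le> 1"
  shows "(foot has_derivative (\<lambda>a. \<tau> y0 a / (cosh (height y0) - h * sinh (height y0)))) (at y0)"
proof -
  define c s where "c = cosh (height y0)" and "s = sinh (height y0)"
  define w where "w = c - h * s"
  have "\<bar>h * s\<bar> \<le> 1 * \<bar>s\<bar>" unfolding abs_mult using assms(2) by (intro mult_right_mono) auto
  moreover have "0 < c - \<bar>s\<bar>"
    using exp_height_le[of y0] exp_gt_zero[of "- \<bar>height y0\<bar>"] unfolding c_def s_def by linarith
  ultimately have w: "w > 0" unfolding w_def by linarith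
  obtain C where "C > 0" and "\<forall>\<^sub>F y in nhds y0. \<bar>foot y - foot y0\<bar> \<le> C * norm (y - y0)"
    by (rule foot_lipschitz_at)
  then have "\<forall>\<^sub>F y in nhds y0. norm (foot y - foot y0) \<le> C * norm (y - y0)" by simp
  then have "((\<lambda>y. H (foot y) - h * foot y) has_derivative (\<lambda>_. 0)) (at y0)"
    using has_derivative_zero_comp[of H "(*) h" foot y0] h by (simp add: has_field_derivative_def)
  from has_derivative_add[OF dfoot_combination[of y0] has_derivative_mult_right[OF this, of s]]
  have "((\<lambda>y. w * foot y) has_derivative \<tau> y0) (at y0)"
    by (simp add: c_def[symmetric] s_def[symmetric] w_def algebra_simps)
  from has_derivative_mult_right[OF this, of "1 / w"] show ?thesis
    using w by (simp add: w_def c_def s_def)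
qed

end

section \<open>Functions of Fermi coordinates\<close>

lemma abs_derivative_le_lipschitz:
  assumes L: "L-lipschitz_on UNIV F" and d: "(F has_real_derivative d) (at x)"
  shows "\<bar>d\<bar> \<le> L"
proof (rule tendsto_upperbound[OF tendsto_rabs])
  show "((\<lambda>y. (F y - F x) / (y - x)) \<longlongrightarrow> d) (at x)"
    using d by (simp add: has_field_derivative_iff)
  have "\<bar>(F y - F x) / (y - x)\<bar> \<le> L" if "y \<noteq> x" for y
    using lipschitz_onD[OF L, of y x] that by (simp add: dist_real_def field_simps)
  then show "\<forall>\<^sub>F y in at x. \<bar>(F y - F x) / (y - x)\<bar> \<le> L"
    by (simp add: eventually_at_filter)
qed simp

lemma smooth_real_on_deriv:
  assumes "smooth_real_on S F" "x \<in> S"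
  shows "((deriv ^^ k) F has_real_derivative (deriv ^^ Suc k) F x) (at x)"
  using assms by (auto simp: smooth_real_on_def DERIV_deriv_iff_real_differentiable)

locale fermi_smooth = fermi H G P Q for H :: "real \<Rightarrow> real" and G P Q :: "real \<Rightarrow> real \<times> complex" +
  fixes f :: "real \<Rightarrow> real" and S :: "real set"
  assumes smooth_f: "smooth_real_on UNIV f" and open_S: "open S" and dense_S: "closure S = UNIV"
    and smooth_H: "smooth_real_on S H"
    and decay: "\<And>(k::nat) (ls::nat list) x\<^sub>0. x\<^sub>0 \<notin> S \<Longrightarrow>
      ((\<lambda>x. (deriv ^^ k) f x * (\<Prod>l\<leftarrow>ls. (deriv ^^ l) (deriv H) x)) \<longlongrightarrow> 0) (at x\<^sub>0 within S)"
begin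

definition W :: "(complex \<times> real) set" where "W = {p. foot (fst p) \<in> S}"

abbreviation (input) "hder l \<equiv> (deriv ^^ l) (deriv H)"
abbreviation (input) "fder k \<equiv> (deriv ^^ k) f"

lemma dhder: "x \<in> S \<Longrightarrow> (hder l has_real_derivative hder (Suc l) x) (at x)"
  using smooth_real_on_deriv[OF smooth_H, of x "Suc l"] by (simp add: funpow_swap1)

lemma dH: "x \<in> S \<Longrightarrow> (H has_real_derivative deriv H x) (at x)"
  using smooth_real_on_deriv[OF smooth_H, of x 0] by simp

lemma dfder: "(fder k has_real_derivative fder (Suc k) x) (at x)"
  using smooth_real_on_deriv[OF smooth_f, of x k] by simp

lemma abs_deriv_H: "x \<in> S \<Longrightarrow> \<bar>deriv H x\<bar> \<le> 1"
  using abs_derivative_le_lipschitz[OF lipschitz_H dH] .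

lemma at_within_S_nontrivial: "x \<notin> S \<Longrightarrow> at x within S \<noteq> bot"
  using dense_S by (simp add: trivial_limit_within islimpt_in_closure)

text \<open>By continuity and density of \<open>S\<close>; the empty list of factors gives the decay
  of the derivative of \<open>f\<close> itself.\<close>

lemma fder_zero: "x \<notin> S \<Longrightarrow> fder k x = 0"
proof (rule tendsto_unique[OF at_within_S_nontrivial])
  show "(fder k \<longlongrightarrow> fder k x) (at x within S)"
    using DERIV_isCont[OF dfder[of k x]] by (auto simp: isCont_def intro: tendsto_within_subset)
  show "(fder k \<longlongrightarrow> 0) (at x within S)" if "x \<notin> S" using decay[OF that, of k "[]"] by simp
qed

lemma isCont_foot_fst: "isCont (\<lambda>p. foot (fst p)) p" and isCont_height_fst: "isCont (\<lambda>p. height (fst p)) p"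
  for p :: "complex \<times> real"
  by (rule isCont_o2[OF _ continuous_foot] isCont_o2[OF _ continuous_height]; simp)+

lemma open_W: "open W"
proof -
  have "W = (\<lambda>p. foot (fst p)) -` S" by (auto simp: W_def)
  moreover have "open ((\<lambda>p::complex \<times> real. foot (fst p)) -` S)"
    by (rule continuous_open_vimage[OF open_S]) (use isCont_foot_fst in blast)
  ultimately show ?thesis by simp
qed

definition warp :: "complex \<times> real \<Rightarrow> real" where
  "warp p = cosh (height (fst p)) - deriv H (foot (fst p)) * sinh (height (fst p))"

text \<open>A bound independent of the curvature: near the complement of \<open>W\<close>, where
  \<open>deriv H\<close> may oscillate, \<open>1 / warp\<close> stays below a continuous
  function.\<close>

lemma warp_ge: "p \<in> W \<Longrightarrow> warp p \<ge> exp (- \<bar>height (fst p)\<bar>)"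
proof -
  assume "p \<in> W"
  then have "\<bar>deriv H (foot (fst p)) * sinh (height (fst p))\<bar> \<le> 1 * \<bar>sinh (height (fst p))\<bar>"
    unfolding abs_mult by (intro mult_right_mono abs_deriv_H) (auto simp: W_def)
  then show ?thesis using exp_height_le[of "fst p"] unfolding warp_def by linarith
qed

lemma warp_pos: "p \<in> W \<Longrightarrow> warp p > 0"
  using warp_ge[of p] exp_gt_zero[of "- \<bar>height (fst p)\<bar>"] by linarith

section \<open>The algebra of coordinate functions\<close>

text \<open>The generators are chosen so that derivatives on \<open>W\<close> stay inside;
  \<open>alg_inverse_warp\<close> comes from the derivative of \<open>foot\<close>. Off
  \<open>W\<close> the curvature terms may have arbitrary values, which the ideal below multiplies
  by zero.\<close>

inductive alg :: "(complex \<times> real \<Rightarrow> real) \<Rightarrow> bool" where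
  alg_const: "alg (\<lambda>p. r)"
| alg_snd: "alg snd"
| alg_inverse_fst_lift: "alg (\<lambda>p. 1 / sqrt (1 + fst p \<bullet> fst p))"
| alg_G: "alg (\<lambda>p. mink M (G (foot (fst p))))"
| alg_T: "alg (\<lambda>p. mink M (T (foot (fst p))))"
| alg_U: "alg (\<lambda>p. mink M (U (foot (fst p))))"
| alg_height: "alg (\<lambda>p. height (fst p))"
| alg_cosh: "alg (\<lambda>p. cosh (height (fst p)))"
| alg_sinh: "alg (\<lambda>p. sinh (height (fst p)))"
| alg_hder: "alg (\<lambda>p. hder l (foot (fst p)))"
| alg_fder: "alg (\<lambda>p. fder k (foot (fst p)))"
| alg_inverse_warp: "alg (\<lambda>p. 1 / warp p)"
| alg_add: "alg c \<Longrightarrow> alg d \<Longrightarrow> alg (\<lambda>p. c p + d p)"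
| alg_mult: "alg c \<Longrightarrow> alg d \<Longrightarrow> alg (\<lambda>p. c p * d p)"

lemma alg_minus: "alg c \<Longrightarrow> alg (\<lambda>p. - c p)"
  using alg_mult[OF alg_const[of "-1"]] by simp

lemma alg_diff: "alg c \<Longrightarrow> alg d \<Longrightarrow> alg (\<lambda>p. c p - d p)"
  using alg_add[OF _ alg_minus, of c d] by simp

lemma alg_over_warp: "alg c \<Longrightarrow> alg (\<lambda>p. c p / warp p)"
  using alg_mult[OF _ alg_inverse_warp, of c] by simp

lemma alg_deriv_H: "alg (\<lambda>p. deriv H (foot (fst p)))"
  using alg_hder[of 0] by simp

lemma alg_power: "alg c \<Longrightarrow> alg (\<lambda>p. c p ^ k)"
  by (induction k) (auto intro: alg_const alg_mult)

text \<open>The spatial part of \<open>lift_eq\<close> expresses the chart coordinates through the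
  frame.\<close>

lemma alg_inner: "alg (\<lambda>p. fst p \<bullet> a)"
proof -
  have "fst p \<bullet> a = cosh (height (fst p)) * mink (0, a) (G (foot (fst p))) + sinh (height (fst p)) * mink (0, a) (U (foot (fst p)))"
    for p :: "complex \<times> real"
  proof -
    have "fst p \<bullet> a = mink (0, a) (lift (fst p))" by (simp add: mink_def inner_commute)
    then show ?thesis by (subst (asm) lift_eq) (simp add: mink_simps)
  qed
  then show ?thesis by (auto intro!: alg_add alg_mult alg_cosh alg_sinh alg_G alg_U)
qed

lemma mink_dlift_eq: "mink M (dlift y a) = mink (0, a) M + (y \<bullet> a) * (1 / sqrt (1 + y \<bullet> y)) * mink (1, 0) M"
  by (simp add: mink_def dlift_def inner_commute)

lemma alg_\<tau>: "alg (\<lambda>p. \<tau> (fst p) a)"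
  unfolding \<tau>_def mink_dlift_eq by (intro alg_add alg_mult alg_T alg_inner alg_inverse_fst_lift)

lemma alg_\<nu>: "alg (\<lambda>p. \<nu> (fst p) a)"
  unfolding \<nu>_def mink_dlift_eq mink_simps
  by (intro alg_add alg_mult alg_G alg_U alg_cosh alg_sinh alg_inner alg_inverse_fst_lift)

lemma alg_warp: "alg warp"
  unfolding warp_def[abs_def] by (intro alg_diff alg_mult alg_cosh alg_sinh alg_deriv_H)

lemmas alg_intros = alg_const alg_snd alg_height alg_cosh alg_sinh alg_hder alg_fder alg_deriv_H alg_G alg_T alg_U
  alg_inverse_warp alg_over_warp alg_add alg_diff alg_minus alg_mult alg_power alg_inner alg_\<tau> alg_\<nu>
  alg_inverse_fst_lift alg_warp

lemma dfoot_W: "p \<in> W \<Longrightarrow> ((\<lambda>p. foot (fst p)) has_derivative (\<lambda>a. \<tau> (fst p) (fst a) / warp p)) (at p)"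
proof -
  assume p: "p \<in> W"
  have "(fst has_derivative fst) (at p)"
    by (rule bounded_linear_imp_has_derivative[OF bounded_linear_fst])
  moreover have "(foot has_derivative (\<lambda>a. \<tau> (fst p) a / warp p)) (at (fst p))"
    using dfoot[OF dH abs_deriv_H, of "fst p"] p by (simp add: W_def warp_def)
  ultimately show ?thesis by (rule has_derivative_compose)
qed

lemma dheight_fst: "((\<lambda>p. height (fst p)) has_derivative (\<lambda>a. \<nu> (fst p) (fst a))) (at p)"
  for p :: "complex \<times> real"
proof -
  have "(fst has_derivative fst) (at p)"
    by (rule bounded_linear_imp_has_derivative[OF bounded_linear_fst])
  then show ?thesis using dheight by (rule has_derivative_compose)
qed

lemma dfoot_comp:
  assumes "p \<in> W" "(k has_real_derivative k') (at (foot (fst p)))"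
  shows "((\<lambda>p. k (foot (fst p))) has_derivative (\<lambda>a. k' * (\<tau> (fst p) (fst a) / warp p))) (at p)"
  using has_derivative_compose[OF dfoot_W[OF assms(1)] assms(2)[unfolded has_field_derivative_def]] by simp

lemma dheight_comp:
  assumes "(k has_real_derivative k') (at (height (fst p)))"
  shows "((\<lambda>p. k (height (fst p))) has_derivative (\<lambda>a. k' * \<nu> (fst p) (fst a))) (at (p :: complex \<times> real))"
  using has_derivative_compose[OF dheight_fst assms(1)[unfolded has_field_derivative_def]] by simp

lemma d\<theta>: "x \<in> S \<Longrightarrow> (\<theta> has_real_derivative deriv H x) (at x)"
  unfolding \<theta>_def[abs_def] by (auto intro!: derivative_eq_intros dH)

lemma dmink_PQ:
  "((\<lambda>x. mink M (P x)) has_real_derivative cos (\<theta> x) * mink M (G x)) (at x)"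
  "((\<lambda>x. mink M (Q x)) has_real_derivative sin (\<theta> x) * mink M (G x)) (at x)"
  using bounded_linear.has_vector_derivative[OF mink.bounded_linear_right[of M] dP[of x]]
    bounded_linear.has_vector_derivative[OF mink.bounded_linear_right[of M] dQ[of x]]
  by (simp_all add: has_real_derivative_iff_has_vector_derivative \<theta>_def mink_simps)

text \<open>One of the Frenet equations T' = G + h U, U' = - h T, G' = T of the lifted
  frame.\<close>

lemma dmink_T: "x \<in> S \<Longrightarrow> ((\<lambda>x. mink M (T x)) has_real_derivative mink M (G x) + deriv H x * mink M (U x)) (at x)"
proof -
  assume x: "x \<in> S"
  have cs: "cos (\<theta> x) * cos (\<theta> x) = 1 - sin (\<theta> x) * sin (\<theta> x)"
    using sin_cos_squared_add3[of "\<theta> x"] by linarith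
  show ?thesis
    unfolding T_def mink_simps U_def
    by (rule derivative_eq_intros dmink_PQ d\<theta>[OF x] refl)+ (use cs in algebra)
qed

lemma dmink_U: "x \<in> S \<Longrightarrow> ((\<lambda>x. mink M (U x)) has_real_derivative - deriv H x * mink M (T x)) (at x)"
proof -
  assume x: "x \<in> S"
  show ?thesis
    unfolding T_def mink_simps U_def
    by (rule derivative_eq_intros dmink_PQ d\<theta>[OF x] refl)+ (simp add: algebra_simps)
qed

lemma dwarp: "p \<in> W \<Longrightarrow> (warp has_derivative (\<lambda>a. (sinh (height (fst p)) - deriv H (foot (fst p)) * cosh (height (fst p))) * \<nu> (fst p) (fst a)
     - hder 1 (foot (fst p)) * sinh (height (fst p)) / warp p * \<tau> (fst p) (fst a))) (at p)"
proof -
  assume p: "p \<in> W"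
  have "foot (fst p) \<in> S" using p by (simp add: W_def)
  from dfoot_comp[OF p dhder[OF this, of 0]]
  have 1: "((\<lambda>p. deriv H (foot (fst p))) has_derivative (\<lambda>a. hder 1 (foot (fst p)) * (\<tau> (fst p) (fst a) / warp p))) (at p)"
    by simp
  have 2: "((\<lambda>p. cosh (height (fst p))) has_derivative (\<lambda>a. sinh (height (fst p)) * \<nu> (fst p) (fst a))) (at p)"
    "((\<lambda>p. sinh (height (fst p))) has_derivative (\<lambda>a. cosh (height (fst p)) * \<nu> (fst p) (fst a))) (at p)"
    by (rule dheight_comp; auto intro!: derivative_eq_intros)+
  show ?thesis unfolding warp_def[abs_def]
    by (rule has_derivative_eq_rhs[OF has_derivative_diff[OF 2(1) has_derivative_mult[OF 1 2(2)]]])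
      (auto simp: algebra_simps warp_def)
qed

text \<open>Closure rests on \<open>dfoot_W\<close> and \<open>dheight_fst\<close>: the derivatives
  of the coordinates are \<open>\<tau> / warp\<close> and \<open>\<nu>\<close>, which belong to the
  algebra, and the Frenet equations keep the frame inside.\<close>

lemma alg_derivative:
  assumes "alg c"
  shows "\<exists>c'. (\<forall>a. alg (c' a)) \<and> (\<forall>p\<in>W. (c has_derivative (\<lambda>a. c' a p)) (at p))"
  using assms
proof induction
  case (alg_const r)
  show ?case by (rule exI[of _ "\<lambda>a p. 0"]) (auto intro: alg.alg_const)
next
  case alg_snd
  have "(snd has_derivative snd) (at p)" for p :: "complex \<times> real"
    by (rule bounded_linear_imp_has_derivative[OF bounded_linear_snd])
  then show ?case by (intro exI[of _ "\<lambda>a p. snd a"]) (auto intro: alg.alg_const)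
next
  case alg_inverse_fst_lift
  have "((\<lambda>p. 1 / sqrt (1 + fst p \<bullet> fst p)) has_derivative
      (\<lambda>a. - (fst p \<bullet> fst a) * (1 / sqrt (1 + fst p \<bullet> fst p)) ^ 3)) (at p)" for p :: "complex \<times> real"
  proof -
    define z where "z = sqrt (1 + fst p \<bullet> fst p)"
    have z: "z > 0" by (simp add: z_def)
    have f: "(fst has_derivative fst) (at p)"
      by (rule bounded_linear_imp_has_derivative[OF bounded_linear_fst])
    have "((\<lambda>p. fst (lift (fst p))) has_derivative (\<lambda>a. fst (dlift (fst p) (fst a)))) (at p)"
      by (rule bounded_linear.has_derivative[OF bounded_linear_fst has_derivative_compose[OF f has_derivative_lift]])
    then have d: "((\<lambda>p. sqrt (1 + fst p \<bullet> fst p)) has_derivative (\<lambda>a. (fst p \<bullet> fst a) / z)) (at p)"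
      by (simp add: lift_def dlift_def z_def)
    have "((\<lambda>t. 1 / t) has_real_derivative - (1 / z\<^sup>2)) (at z)"
      using z by (auto intro!: derivative_eq_intros simp: power2_eq_square)
    from has_derivative_compose[OF d this[unfolded has_field_derivative_def z_def]]
    show ?thesis unfolding z_def
      by (rule has_derivative_eq_rhs) (auto simp: power2_eq_square power3_eq_cube)
  qed
  then show ?case
    by (intro exI[of _ "\<lambda>a p. - (fst p \<bullet> fst a) * (1 / sqrt (1 + fst p \<bullet> fst p)) ^ 3"] conjI allI ballI)
      (intro alg_intros, blast)
next
  case (alg_G M)
  show ?case
    by (rule exI[of _ "\<lambda>a p. mink M (T (foot (fst p))) * (\<tau> (fst p) (fst a) / warp p)"], intro conjI allI ballI)
      (intro alg_intros, intro dfoot_comp dmink_G)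
next
  case (alg_T M)
  show ?case
    by (rule exI[of _ "\<lambda>a p. (mink M (G (foot (fst p))) + deriv H (foot (fst p)) * mink M (U (foot (fst p)))) * (\<tau> (fst p) (fst a) / warp p)"],
       intro conjI allI ballI) (intro alg_intros, intro dfoot_comp dmink_T, auto simp: W_def)
next
  case (alg_U M)
  show ?case
    by (rule exI[of _ "\<lambda>a p. (- deriv H (foot (fst p)) * mink M (T (foot (fst p)))) * (\<tau> (fst p) (fst a) / warp p)"],
       intro conjI allI ballI) (intro alg_intros, intro dfoot_comp dmink_U, auto simp: W_def)
next
  case alg_height
  show ?case
    by (rule exI[of _ "\<lambda>a p. \<nu> (fst p) (fst a)"], intro conjI allI ballI) (intro alg_intros, rule dheight_fst)
next
  case alg_cosh
  show ?case
    by (rule exI[of _ "\<lambda>a p. sinh (height (fst p)) * \<nu> (fst p) (fst a)"], intro conjI allI ballI)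
      (intro alg_intros, rule dheight_comp, auto intro!: derivative_eq_intros)
next
  case alg_sinh
  show ?case
    by (rule exI[of _ "\<lambda>a p. cosh (height (fst p)) * \<nu> (fst p) (fst a)"], intro conjI allI ballI)
      (intro alg_intros, rule dheight_comp, auto intro!: derivative_eq_intros)
next
  case (alg_hder l)
  show ?case
    by (rule exI[of _ "\<lambda>a p. hder (Suc l) (foot (fst p)) * (\<tau> (fst p) (fst a) / warp p)"], intro conjI allI ballI)
      (intro alg_intros, intro dfoot_comp dhder, auto simp: W_def)
next
  case (alg_fder k)
  show ?case
    by (rule exI[of _ "\<lambda>a p. fder (Suc k) (foot (fst p)) * (\<tau> (fst p) (fst a) / warp p)"], intro conjI allI ballI)
      (intro alg_intros, intro dfoot_comp dfder)
next
  case alg_inverse_warp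
  show ?case
  proof (intro exI conjI allI ballI)
    fix p assume p: "p \<in> W"
    have "((\<lambda>t. 1 / t) has_real_derivative - ((1 / warp p) ^ 2)) (at (warp p))"
      using warp_pos[OF p] by (auto intro!: derivative_eq_intros simp: power2_eq_square)
    from has_derivative_compose[OF dwarp[OF p] this[unfolded has_field_derivative_def]]
    show "((\<lambda>p. 1 / warp p) has_derivative (\<lambda>a. - ((1 / warp p) ^ 2) * ((sinh (height (fst p)) - deriv H (foot (fst p)) * cosh (height (fst p))) * \<nu> (fst p) (fst a)
     - hder 1 (foot (fst p)) * sinh (height (fst p)) / warp p * \<tau> (fst p) (fst a)))) (at p)" .
  next
    show "alg (\<lambda>p. - ((1 / warp p) ^ 2) * ((sinh (height (fst p)) - deriv H (foot (fst p)) * cosh (height (fst p))) * \<nu> (fst p) (fst a)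
     - hder 1 (foot (fst p)) * sinh (height (fst p)) / warp p * \<tau> (fst p) (fst a)))" for a :: "complex \<times> real"
      by (intro alg_intros)
  qed
next
  case (alg_add c d)
  then obtain c' d' where "\<And>a. alg (c' a)" "\<And>p. p \<in> W \<Longrightarrow> (c has_derivative (\<lambda>a. c' a p)) (at p)"
    "\<And>a. alg (d' a)" "\<And>p. p \<in> W \<Longrightarrow> (d has_derivative (\<lambda>a. d' a p)) (at p)" by metis
  then show ?case
    by (intro exI[of _ "\<lambda>a p. c' a p + d' a p"] conjI allI ballI) (auto intro: alg.alg_add has_derivative_add)
next
  case (alg_mult c d)
  then obtain c' d' where cd: "\<And>a. alg (c' a)" "\<And>p. p \<in> W \<Longrightarrow> (c has_derivative (\<lambda>a. c' a p)) (at p)"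
    "\<And>a. alg (d' a)" "\<And>p. p \<in> W \<Longrightarrow> (d has_derivative (\<lambda>a. d' a p)) (at p)" by metis
  show ?case
  proof (intro exI[of _ "\<lambda>a p. c p * d' a p + c' a p * d p"] conjI allI ballI)
    show "alg (\<lambda>p. c p * d' a p + c' a p * d p)" for a
      by (intro alg.alg_add alg.alg_mult cd alg_mult.hyps)
    show "((\<lambda>p. c p * d p) has_derivative (\<lambda>a. c p * d' a p + c' a p * d p)) (at p)" if "p \<in> W" for p
      by (rule has_derivative_mult[OF cd(2,4)[OF that]])
  qed
qed

text \<open>The functions that decay, even after multiplication by derivatives of the curvature, form a
  module over the algebra.\<close>

definition decaying :: "(complex \<times> real \<Rightarrow> real) \<Rightarrow> bool" where
  "decaying m \<longleftrightarrow> (\<forall>p ls. p \<notin> W \<longrightarrow> ((\<lambda>q. m q * (\<Prod>l\<leftarrow>ls. hder l (foot (fst q)))) \<longlongrightarrow> 0) (at p within W))"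

lemma decaying_mult_continuous:
  assumes "decaying m" "\<And>p. isCont c p"
  shows "decaying (\<lambda>p. c p * m p)"
  unfolding decaying_def
proof (intro allI impI)
  fix p ls assume "p \<notin> W"
  then have "((\<lambda>q. m q * (\<Prod>l\<leftarrow>ls. hder l (foot (fst q)))) \<longlongrightarrow> 0) (at p within W)"
    using assms(1) unfolding decaying_def by blast
  moreover have "(c \<longlongrightarrow> c p) (at p within W)"
    using assms(2)[of p] by (auto simp: isCont_def intro: tendsto_within_subset)
  ultimately have "((\<lambda>q. c q * (m q * (\<Prod>l\<leftarrow>ls. hder l (foot (fst q))))) \<longlongrightarrow> c p * 0) (at p within W)"
    by (intro tendsto_mult)
  then show "((\<lambda>q. c q * m q * (\<Prod>l\<leftarrow>ls. hder l (foot (fst q)))) \<longlongrightarrow> 0) (at p within W)"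
    by (simp add: mult.assoc)
qed

lemma isCont_mink_frame:
  "isCont (\<lambda>p. mink M (G (foot (fst p)))) p" "isCont (\<lambda>p. mink M (T (foot (fst p)))) p"
  "isCont (\<lambda>p. mink M (U (foot (fst p)))) p" for p :: "complex \<times> real"
  by (intro mink.continuous continuous_const isCont_o2[OF isCont_foot_fst] continuous_G continuous_T continuous_U)+

text \<open>Multiplication by a continuous generator preserves decay. The two other kinds need care:
  \<open>hder l\<close> is absorbed into the list of curvature factors, and \<open>1 / warp\<close>
  is dominated on \<open>W\<close> by the exponential of the absolute height.\<close>

lemma decaying_mult_alg: "alg c \<Longrightarrow> decaying m \<Longrightarrow> decaying (\<lambda>p. c p * m p)"
proof (induction arbitrary: m rule: alg.induct)
  case (alg_hder l)
  show ?case unfolding decaying_def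
  proof (intro allI impI)
    fix p ls assume "p \<notin> W"
    then have "((\<lambda>q. m q * (\<Prod>l\<leftarrow>l # ls. hder l (foot (fst q)))) \<longlongrightarrow> 0) (at p within W)"
      using alg_hder unfolding decaying_def by blast
    then show "((\<lambda>q. hder l (foot (fst q)) * m q * (\<Prod>l\<leftarrow>ls. hder l (foot (fst q)))) \<longlongrightarrow> 0) (at p within W)"
      by (simp add: mult_ac)
  qed
next
  case alg_inverse_warp
  have "decaying (\<lambda>p. exp \<bar>height (fst p)\<bar> * m p)"
    by (intro decaying_mult_continuous alg_inverse_warp continuous_intros isCont_height_fst)
  then have D: "((\<lambda>q. exp \<bar>height (fst q)\<bar> * m q * (\<Prod>l\<leftarrow>ls. hder l (foot (fst q)))) \<longlongrightarrow> 0) (at p within W)"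
    if "p \<notin> W" for p ls using that unfolding decaying_def by blast
  show ?case unfolding decaying_def
  proof (intro allI impI)
    fix p ls assume "p \<notin> W"
    have bd: "norm (1 / warp q * m q * (\<Prod>l\<leftarrow>ls. hder l (foot (fst q))))
        \<le> norm (exp \<bar>height (fst q)\<bar> * m q * (\<Prod>l\<leftarrow>ls. hder l (foot (fst q))))" if "q \<in> W" for q
    proof -
      have "1 / warp q \<le> 1 / exp (- \<bar>height (fst q)\<bar>)"
        using warp_ge[OF that] by (intro divide_left_mono) (auto simp: warp_pos[OF that])
      then have "\<bar>1 / warp q\<bar> \<le> \<bar>exp \<bar>height (fst q)\<bar>\<bar>"
        using warp_pos[OF that] by (simp add: exp_minus inverse_eq_divide)
      then show ?thesis unfolding real_norm_def abs_mult by (intro mult_right_mono) auto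
    qed
    show "((\<lambda>q. 1 / warp q * m q * (\<Prod>l\<leftarrow>ls. hder l (foot (fst q)))) \<longlongrightarrow> 0) (at p within W)"
    proof (rule Lim_null_comparison[OF _ tendsto_norm_zero[OF D[OF \<open>p \<notin> W\<close>, of ls]]])
      show "\<forall>\<^sub>F q in at p within W. norm (1 / warp q * m q * (\<Prod>l\<leftarrow>ls. hder l (foot (fst q))))
        \<le> norm (exp \<bar>height (fst q)\<bar> * m q * (\<Prod>l\<leftarrow>ls. hder l (foot (fst q))))"
        unfolding eventually_at_filter by (intro always_eventually allI impI bd)
    qed
  qed
next
  case (alg_add c d)
  show ?case unfolding decaying_def
  proof (intro allI impI)
    fix p ls assume p: "p \<notin> W"
    have "((\<lambda>q. c q * m q * (\<Prod>l\<leftarrow>ls. hder l (foot (fst q))) + d q * m q * (\<Prod>l\<leftarrow>ls. hder l (foot (fst q)))) \<longlongrightarrow> 0 + 0) (at p within W)"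
      using alg_add.IH(1)[OF alg_add.prems] alg_add.IH(2)[OF alg_add.prems] p unfolding decaying_def
      by (intro tendsto_add) blast+
    then show "((\<lambda>q. (c q + d q) * m q * (\<Prod>l\<leftarrow>ls. hder l (foot (fst q)))) \<longlongrightarrow> 0) (at p within W)"
      by (simp add: distrib_right)
  qed
next
  case (alg_mult c d)
  from alg_mult.IH(1)[OF alg_mult.IH(2)[OF alg_mult.prems]] show ?case by (simp add: mult.assoc)
next
  case (alg_fder k)
  then show ?case by (intro decaying_mult_continuous isCont_o2[OF isCont_foot_fst DERIV_isCont[OF dfder]])
next
  case alg_inverse_fst_lift
  then show ?case by (intro decaying_mult_continuous continuous_intros) (auto simp: add_nonneg_eq_0_iff)
qed (intro decaying_mult_continuous isCont_mink_frame isCont_height_fst continuous_intros; assumption)+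

section \<open>The ideal generated by the derivatives of \<open>f\<close>\<close>

inductive ideal :: "(complex \<times> real \<Rightarrow> real) \<Rightarrow> bool" where
  ideal_base: "alg c \<Longrightarrow> ideal (\<lambda>p. fder k (foot (fst p)) * c p)"
| ideal_add: "ideal A \<Longrightarrow> ideal B \<Longrightarrow> ideal (\<lambda>p. A p + B p)"

lemma ideal_imp_alg: "ideal A \<Longrightarrow> alg A"
  by (induction rule: ideal.induct) (intro alg_add alg_mult alg_fder; assumption)+

lemma ideal_mult: "ideal A \<Longrightarrow> alg c \<Longrightarrow> ideal (\<lambda>p. c p * A p)"
proof (induction rule: ideal.induct)
  case (ideal_base d k)
  from ideal.ideal_base[OF alg_mult[OF ideal_base(2,1)], of k] show ?case by (simp add: mult_ac)
next
  case (ideal_add A B)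
  then show ?case using ideal.ideal_add by (simp add: distrib_left)
qed

lemma ideal_mult': "ideal A \<Longrightarrow> alg c \<Longrightarrow> ideal (\<lambda>p. A p * c p)"
  using ideal_mult[of A c] by (simp add: mult.commute)

lemma ideal_minus: "ideal A \<Longrightarrow> ideal (\<lambda>p. - A p)"
  using ideal_mult[OF _ alg_const[of "-1"]] by simp

lemma ideal_diff: "ideal A \<Longrightarrow> ideal B \<Longrightarrow> ideal (\<lambda>p. A p - B p)"
  using ideal_add[OF _ ideal_minus, of A B] by simp

lemma ideal_off_W: "ideal A \<Longrightarrow> p \<notin> W \<Longrightarrow> A p = 0"
  by (induction rule: ideal.induct) (auto simp: W_def fder_zero)

lemma decaying_fder: "decaying (\<lambda>p. fder k (foot (fst p)))"
  unfolding decaying_def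
proof (intro allI impI)
  fix p ls assume "p \<notin> W"
  then have x: "foot (fst p) \<notin> S" by (simp add: W_def)
  have "filterlim (\<lambda>q. foot (fst q)) (at (foot (fst p)) within S) (at p within W)"
    unfolding filterlim_at
  proof
    show "\<forall>\<^sub>F q in at p within W. foot (fst q) \<in> S \<and> foot (fst q) \<noteq> foot (fst p)"
      unfolding eventually_at_filter using x by (intro always_eventually) (auto simp: W_def)
    show "((\<lambda>q. foot (fst q)) \<longlongrightarrow> foot (fst p)) (at p within W)"
      using isCont_foot_fst[of p] by (auto simp: isCont_def intro: tendsto_within_subset)
  qed
  from filterlim_compose[OF decay[OF x] this]
  show "((\<lambda>q. fder k (foot (fst q)) * (\<Prod>l\<leftarrow>ls. hder l (foot (fst q)))) \<longlongrightarrow> 0) (at p within W)" .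
qed

lemma ideal_tendsto: "ideal A \<Longrightarrow> p \<notin> W \<Longrightarrow> (A \<longlongrightarrow> 0) (at p within W)"
proof (induction rule: ideal.induct)
  case (ideal_base c k)
  have "decaying (\<lambda>p. c p * fder k (foot (fst p)))"
    by (rule decaying_mult_alg[OF ideal_base(1) decaying_fder])
  then have "((\<lambda>q. c q * fder k (foot (fst q)) * (\<Prod>l\<leftarrow>[]. hder l (foot (fst q)))) \<longlongrightarrow> 0) (at p within W)"
    using ideal_base(2) unfolding decaying_def by blast
  then show ?case by (simp add: mult.commute)
next
  case (ideal_add A B)
  then show ?case using tendsto_add[of A 0 _ B 0] by simp
qed

text \<open>On \<open>W\<close> the product rule stays in the ideal, because differentiating
  \<open>fder k\<close> at the foot point yields \<open>fder (Suc k)\<close> times an element of the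
  algebra. Off \<open>W\<close> the derivative is zero by
  \<open>has_derivative_zero_extension\<close>, and so is the formula, which therefore serves at
  every point.\<close>

lemma ideal_derivative:
  assumes "ideal A"
  shows "\<exists>A'. (\<forall>a. ideal (A' a)) \<and> (\<forall>p. (A has_derivative (\<lambda>a. A' a p)) (at p))"
proof -
  have "\<exists>A'. (\<forall>a. ideal (A' a)) \<and> (\<forall>p\<in>W. (A has_derivative (\<lambda>a. A' a p)) (at p))"
    using assms
  proof induction
    case (ideal_base c k)
    obtain c' where c': "\<And>a. alg (c' a)" "\<And>p. p \<in> W \<Longrightarrow> (c has_derivative (\<lambda>a. c' a p)) (at p)"
      using alg_derivative[OF ideal_base] by metis
    show ?case
    proof (intro exI conjI allI ballI)
      show "((\<lambda>p. fder k (foot (fst p)) * c p) has_derivative (\<lambda>a. fder k (foot (fst p)) * c' a p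
          + fder (Suc k) (foot (fst p)) * (\<tau> (fst p) (fst a) / warp p) * c p)) (at p)" if "p \<in> W" for p
        by (rule has_derivative_mult[OF dfoot_comp[OF that dfder] c'(2)[OF that]])
      show "ideal (\<lambda>p. fder k (foot (fst p)) * c' a p
          + fder (Suc k) (foot (fst p)) * (\<tau> (fst p) (fst a) / warp p) * c p)" for a
        unfolding mult.assoc by (intro ideal.ideal_add ideal.ideal_base alg_mult alg_over_warp alg_\<tau> c' ideal_base)
    qed
  next
    case (ideal_add A B)
    then obtain A' B' where "\<And>a. ideal (A' a)" "\<And>p. p \<in> W \<Longrightarrow> (A has_derivative (\<lambda>a. A' a p)) (at p)"
      "\<And>a. ideal (B' a)" "\<And>p. p \<in> W \<Longrightarrow> (B has_derivative (\<lambda>a. B' a p)) (at p)" by metis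
    then show ?case
      by (intro exI[of _ "\<lambda>a p. A' a p + B' a p"] conjI allI ballI) (auto intro: ideal.ideal_add has_derivative_add)
  qed
  then obtain A' where A': "\<And>a. ideal (A' a)" "\<And>p. p \<in> W \<Longrightarrow> (A has_derivative (\<lambda>a. A' a p)) (at p)"
    by metis
  have "isCont A p" for p
  proof (cases "p \<in> W")
    case True
    show ?thesis using has_derivative_continuous[OF A'(2)[OF True]] .
  next
    case False
    have "(A \<longlongrightarrow> 0) (at p within (W \<union> - W))"
      unfolding Lim_within_Un
    proof
      show "(A \<longlongrightarrow> 0) (at p within W)" by (rule ideal_tendsto[OF assms False])
      have "\<forall>\<^sub>F q in at p within - W. A q = 0"
        using ideal_off_W[OF assms] by (auto simp: eventually_at_filter)
      then show "(A \<longlongrightarrow> 0) (at p within - W)" by (rule tendsto_eventually)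
    qed
    then show ?thesis using ideal_off_W[OF assms False] by (simp add: isCont_def)
  qed
  then have cont: "continuous_on UNIV A" by (simp add: continuous_on_eq_continuous_at)
  have "(A has_derivative (\<lambda>a. A' a p)) (at p)" for p
  proof (cases "p \<in> W")
    case False
    have "(A has_derivative (\<lambda>_. 0)) (at p)"
      by (rule has_derivative_zero_extension[OF open_W cont ideal_off_W[OF assms] A'(2) ideal_tendsto[OF A'(1) False] False])
    then show ?thesis using ideal_off_W[OF A'(1) False] by simp
  qed (rule A')
  with A' show ?thesis by blast
qed

end

text \<open>Contains the coefficients of the product metric, which need not vanish off
  \<open>W\<close> and so cannot be put into the ideal. The generators avoid \<open>foot\<close> and
  are differentiable on the whole space.\<close>

inductive base_alg :: "(complex \<times> real \<Rightarrow> real) \<Rightarrow> bool" where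
  base_const: "base_alg (\<lambda>p. r)"
| base_inner: "base_alg (\<lambda>p. fst p \<bullet> a)"
| base_inverse: "base_alg (\<lambda>p. 1 / (1 + fst p \<bullet> fst p))"
| base_add: "base_alg c \<Longrightarrow> base_alg d \<Longrightarrow> base_alg (\<lambda>p. c p + d p)"
| base_mult: "base_alg c \<Longrightarrow> base_alg d \<Longrightarrow> base_alg (\<lambda>p. c p * d p)"

lemma base_alg_derivative:
  assumes "base_alg c"
  shows "\<exists>c'. (\<forall>a. base_alg (c' a)) \<and> (\<forall>p. (c has_derivative (\<lambda>a. c' a p)) (at p))"
  using assms
proof induction
  case (base_const r)
  show ?case by (rule exI[of _ "\<lambda>a p. 0"]) (auto intro: base_alg.base_const)
next
  case (base_inner b)
  show ?case
    by (rule exI[of _ "\<lambda>a p. fst a \<bullet> b"]) (auto intro: base_alg.base_const intro!: derivative_eq_intros)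
next
  case base_inverse
  have "((\<lambda>p. 1 / (1 + fst p \<bullet> fst p)) has_derivative
      (\<lambda>a. (-2) * (fst p \<bullet> fst a) * (1 / (1 + fst p \<bullet> fst p)) * (1 / (1 + fst p \<bullet> fst p)))) (at p)" for p :: "complex \<times> real"
    by (auto intro!: derivative_eq_intros ext simp: inner_commute divide_simps)
  then show ?case
    by (intro exI[of _ "\<lambda>a p. (-2) * (fst p \<bullet> fst a) * (1 / (1 + fst p \<bullet> fst p)) * (1 / (1 + fst p \<bullet> fst p))"] conjI allI)
      (intro base_alg.intros, blast)
next
  case (base_add c d)
  then obtain c' d' where "\<And>a. base_alg (c' a)" "\<And>p. (c has_derivative (\<lambda>a. c' a p)) (at p)"
    "\<And>a. base_alg (d' a)" "\<And>p. (d has_derivative (\<lambda>a. d' a p)) (at p)" by metis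
  then show ?case
    by (intro exI[of _ "\<lambda>a p. c' a p + d' a p"] conjI allI ballI) (auto intro: base_alg.base_add has_derivative_add)
next
  case (base_mult c d)
  then obtain c' d' where cd: "\<And>a. base_alg (c' a)" "\<And>p. (c has_derivative (\<lambda>a. c' a p)) (at p)"
    "\<And>a. base_alg (d' a)" "\<And>p. (d has_derivative (\<lambda>a. d' a p)) (at p)" by metis
  show ?case
  proof (intro exI[of _ "\<lambda>a p. c p * d' a p + c' a p * d p"] conjI allI)
    show "base_alg (\<lambda>p. c p * d' a p + c' a p * d p)" for a
      by (intro base_alg.base_add base_alg.base_mult cd base_mult.hyps)
    show "((\<lambda>p. c p * d p) has_derivative (\<lambda>a. c p * d' a p + c' a p * d p)) (at p)" for p
      by (rule has_derivative_mult[OF cd(2,4)])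
  qed
qed

lemma base_alg_hyp_metric: "base_alg (\<lambda>p. hyp_metric (fst p) a b)"
proof -
  have "base_alg (\<lambda>p. a \<bullet> b + (-1) * ((fst p \<bullet> a) * (fst p \<bullet> b) * (1 / (1 + fst p \<bullet> fst p))))"
    by (intro base_alg.intros)
  then show ?thesis by (simp add: hyp_metric_def)
qed

text \<open>Both summands have derivatives of their own kind, so the sums form a class to which
  \<open>smooth_coinduct\<close> applies.\<close>

lemma (in fermi_smooth) smooth_base_plus_ideal:
  assumes "base_alg B" "ideal A"
  shows "smooth (\<lambda>p. B p + A p)"
proof (rule smooth_coinduct[where K = "{F. \<exists>B A. base_alg B \<and> ideal A \<and> F = (\<lambda>p. B p + A p)}"])
  fix F assume "F \<in> {F. \<exists>B A. base_alg B \<and> ideal A \<and> F = (\<lambda>p. B p + A p)}"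
  then obtain B A where BA: "base_alg B" "ideal A" and F: "F = (\<lambda>p. B p + A p)" by auto
  obtain B' A' where B: "\<And>a. base_alg (B' a)" "\<And>p. (B has_derivative (\<lambda>a. B' a p)) (at p)"
    and A: "\<And>a. ideal (A' a)" "\<And>p. (A has_derivative (\<lambda>a. A' a p)) (at p)"
    using base_alg_derivative[OF BA(1)] ideal_derivative[OF BA(2)] by metis
  show "\<exists>F'. (\<forall>a. (\<lambda>p. F' p a) \<in> {F. \<exists>B A. base_alg B \<and> ideal A \<and> F = (\<lambda>p. B p + A p)}) \<and>
      (\<forall>p. (F has_derivative F' p) (at p))"
    unfolding F
    by (rule exI[of _ "\<lambda>p a. B' a p + A' a p"]) (use A B has_derivative_add in blast)
qed (use assms in auto)

section \<open>The metric and its curvature\<close>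

text \<open>A vector orthogonal to \<open>lift y\<close> is tangent to the hyperboloid, hence
  determined by its spatial part.\<close>

lemma dlift_snd:
  assumes "mink v (lift y) = 0"
  shows "dlift y (snd v) = v"
proof -
  have "sqrt (1 + y \<bullet> y) > 0" by simp
  then show ?thesis
    using assms by (auto simp: mink_def lift_def dlift_def prod_eq_iff inner_commute field_simps)
qed

text \<open>Gauss's formula: the tangential part is the Levi-Civita derivative of the constant
  field, the other term is normal.\<close>

lemma has_derivative_dlift:
  "((\<lambda>y. dlift y b) has_derivative (\<lambda>a. dlift y (- hyp_metric y a b *\<^sub>R y) + hyp_metric y a b *\<^sub>R lift y)) (at y)"
proof -
  define z where "z = sqrt (1 + y \<bullet> y)"
  have z: "z > 0" "z * z = 1 + y \<bullet> y" by (simp_all add: z_def)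
  have yy: "y \<bullet> y = z * z - 1" using z by simp
  have d: "((\<lambda>y. sqrt (1 + y \<bullet> y)) has_derivative (\<lambda>a. (y \<bullet> a) / z)) (at y)"
    using bounded_linear.has_derivative[OF bounded_linear_fst has_derivative_lift[of y]]
    by (simp add: lift_def dlift_def z_def)
  have i: "((\<lambda>y. y \<bullet> b) has_derivative (\<lambda>a. a \<bullet> b)) (at y)"
    by (auto intro!: derivative_eq_intros)
  have "((\<lambda>y. y \<bullet> b / sqrt (1 + y \<bullet> y)) has_derivative (\<lambda>a. hyp_metric y a b / z)) (at y)"
  proof (rule has_derivative_eq_rhs[OF has_derivative_divide'[OF i d]])
    show "(\<lambda>h. (h \<bullet> b * sqrt (1 + y \<bullet> y) - y \<bullet> b * (y \<bullet> h / z)) / (sqrt (1 + y \<bullet> y) * sqrt (1 + y \<bullet> y)))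
        = (\<lambda>a. hyp_metric y a b / z)"
      using z(1) unfolding z_def[symmetric] hyp_metric_def z(2)[symmetric] by (auto simp: field_simps)
  qed simp
  from has_derivative_Pair[OF this has_derivative_const[of b]]
  have "((\<lambda>y. dlift y b) has_derivative (\<lambda>a. (hyp_metric y a b / z, 0))) (at y)"
    by (simp add: dlift_def)
  then show ?thesis
    by (rule has_derivative_eq_rhs)
      (use z(1) in \<open>auto simp: dlift_def lift_def z_def[symmetric] yy field_simps\<close>)
qed

text \<open>The product rule for a field of linear forms evaluated on a moving vector; expansion in
  a basis reduces it to derivatives at fixed vectors.\<close>

lemma has_derivative_apply_linear:
  fixes \<theta> :: "'a::euclidean_space \<Rightarrow> 'a \<Rightarrow> real" and V :: "'a \<Rightarrow> 'a"
  assumes lin: "\<And>p. linear (\<theta> p)" "\<And>a. linear (D a)"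
    and \<theta>: "\<And>v. ((\<lambda>p. \<theta> p v) has_derivative (\<lambda>a. D a v)) (at p)"
    and V: "(V has_derivative V') (at p)"
  shows "((\<lambda>p. \<theta> p (V p)) has_derivative (\<lambda>a. D a (V p) + \<theta> p (V' a))) (at p)"
proof -
  have rep: "L v = (\<Sum>e\<in>Basis. (v \<bullet> e) * L e)" if "linear L" for L :: "'a \<Rightarrow> real" and v
  proof -
    have "L v = L (\<Sum>e\<in>Basis. (v \<bullet> e) *\<^sub>R e)" by (simp add: euclidean_representation)
    also have "\<dots> = (\<Sum>e\<in>Basis. (v \<bullet> e) * L e)" using that by (simp add: linear_sum linear_cmul)
    finally show ?thesis .
  qed
  have "((\<lambda>p. \<Sum>e\<in>Basis. (V p \<bullet> e) * \<theta> p e) has_derivative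
     (\<lambda>a. \<Sum>e\<in>Basis. (V p \<bullet> e) * D a e + (V' a \<bullet> e) * \<theta> p e)) (at p)"
    by (intro has_derivative_sum has_derivative_mult \<theta> has_derivative_inner_left V)
  then show ?thesis
    unfolding rep[OF lin(1), symmetric] by (rule has_derivative_eq_rhs)
      (auto simp: sum.distrib rep[OF lin(1), of _ "V' _"] rep[OF lin(2), of _ "V _"])
qed

context fermi_smooth
begin

lemma linear_\<tau>: "linear (\<tau> y)" and linear_\<nu>: "linear (\<nu> y)"
  unfolding \<tau>_def[abs_def] \<nu>_def[abs_def]
  by (intro linear_compose[OF linear_dlift, unfolded o_def] bounded_linear.linear[OF mink.bounded_linear_right])+

lemma mink_U_dlift: "mink (U (foot y)) (dlift y a) = cosh (height y) * \<nu> y a"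
  by (simp add: \<nu>_eq)

lemma mink_G_dlift: "mink (G (foot y)) (dlift y a) = - sinh (height y) * \<nu> y a"
proof -
  have "cosh (height y) * mink (G (foot y)) (dlift y a) + sinh (height y) * mink (U (foot y)) (dlift y a) = 0"
    using mink_lift_dlift[of y a] by (subst (asm) lift_eq) (simp add: mink_simps)
  then have "cosh (height y) * (mink (G (foot y)) (dlift y a) + sinh (height y) * \<nu> y a) = 0"
    unfolding mink_U_dlift by (simp add: algebra_simps)
  then show ?thesis by (simp add: eq_neg_iff_add_eq_0)
qed

text \<open>The products of a tangent vector with \<open>G\<close> and \<open>U\<close> are
  \<open>- sinh (height y)\<close> and \<open>cosh (height y)\<close> times \<open>\<nu>\<close>, so
  together they contribute a single product of values of \<open>\<nu>\<close>.\<close>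

lemma hyp_metric_eq: "hyp_metric y a b = \<tau> y a * \<tau> y b + \<nu> y a * \<nu> y b"
proof -
  have c: "cosh (height y) * cosh (height y) = 1 + sinh (height y) * sinh (height y)"
    using cosh_square_eq[of "height y"] by (simp add: power2_eq_square)
  have m: "mink (dlift y v) (G (foot y)) = - sinh (height y) * \<nu> y v"
    "mink (dlift y v) (T (foot y)) = \<tau> y v" "mink (dlift y v) (U (foot y)) = cosh (height y) * \<nu> y v" for v
    using mink_G_dlift mink_U_dlift by (simp_all add: \<tau>_def mink_commute[of "dlift y v"])
  have "hyp_metric y a b = - (sinh (height y) * sinh (height y)) * (\<nu> y a * \<nu> y b) + \<tau> y a * \<tau> y b
      + (cosh (height y) * cosh (height y)) * (\<nu> y a * \<nu> y b)"
    using mink_expansion[of "dlift y a" "dlift y b" "foot y"] unfolding m mink_dlift by simp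
  then show ?thesis unfolding c by (simp add: algebra_simps)
qed

definition e1 :: "complex \<Rightarrow> complex" where "e1 y = snd (T (foot y))"
definition e2 :: "complex \<Rightarrow> complex" where
  "e2 y = snd (sinh (height y) *\<^sub>R G (foot y) + cosh (height y) *\<^sub>R U (foot y))"

lemma frame_dual [simp]: "\<tau> y (e1 y) = 1" "\<nu> y (e1 y) = 0" "\<tau> y (e2 y) = 0" "\<nu> y (e2 y) = 1"
proof -
  have c: "cosh (height y) * cosh (height y) = 1 + sinh (height y) * sinh (height y)"
    using cosh_square_eq[of "height y"] by (simp add: power2_eq_square)
  have 1: "dlift y (e1 y) = T (foot y)"
    unfolding e1_def by (rule dlift_snd) (subst lift_eq, simp add: mink_simps)
  have 2: "dlift y (e2 y) = sinh (height y) *\<^sub>R G (foot y) + cosh (height y) *\<^sub>R U (foot y)"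
    unfolding e2_def by (rule dlift_snd) (subst lift_eq, simp add: mink_simps)
  show "\<tau> y (e1 y) = 1" "\<nu> y (e1 y) = 0" "\<tau> y (e2 y) = 0" "\<nu> y (e2 y) = 1"
    using c by (simp_all add: \<tau>_def \<nu>_def 1 2 mink_simps)
qed

definition \<Gamma>0 :: "complex \<Rightarrow> complex \<Rightarrow> complex \<Rightarrow> complex" where
  "\<Gamma>0 y a b = - hyp_metric y a b *\<^sub>R y"

text \<open>\<open>wu\<close> is the u-derivative of \<open>warp\<close>. The connection form is
  \<open>qc\<close> times \<open>\<tau>\<close>, the form f dx is \<open>mc\<close> times
  \<open>\<tau>\<close>, and \<open>kc\<close> is the \<open>\<tau>\<close> component of the
  derivative of \<open>mc\<close>.\<close>

definition wu where "wu p = sinh (height (fst p)) - deriv H (foot (fst p)) * cosh (height (fst p))"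
  for p :: "complex \<times> real"
definition qc where "qc p = wu p / warp p"
definition mc where "mc p = f (foot (fst p)) / warp p"
definition kc where "kc p = deriv f (foot (fst p)) / warp p ^ 2
  + f (foot (fst p)) * hder 1 (foot (fst p)) * sinh (height (fst p)) / warp p ^ 3"

lemma dT: "x \<in> S \<Longrightarrow> (T has_vector_derivative G x + deriv H x *\<^sub>R U x) (at x)"
  and dU: "x \<in> S \<Longrightarrow> (U has_vector_derivative - deriv H x *\<^sub>R T x) (at x)"
proof -
  assume x: "x \<in> S"
  have "(cos (\<theta> x) * cos (\<theta> x)) *\<^sub>R G x + (sin (\<theta> x) * sin (\<theta> x)) *\<^sub>R G x = G x"
    unfolding scaleR_add_left[symmetric] by (simp flip: power2_eq_square)
  note cs = this
  have c: "((\<lambda>x. cos (\<theta> x)) has_real_derivative - sin (\<theta> x) * deriv H x) (at x)"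
    "((\<lambda>x. sin (\<theta> x)) has_real_derivative cos (\<theta> x) * deriv H x) (at x)"
    by (auto intro!: derivative_eq_intros d\<theta>[OF x])
  have P: "(P has_vector_derivative cos (\<theta> x) *\<^sub>R G x) (at x)" "(Q has_vector_derivative sin (\<theta> x) *\<^sub>R G x) (at x)"
    using dP dQ by (simp_all add: \<theta>_def)
  show "(T has_vector_derivative G x + deriv H x *\<^sub>R U x) (at x)"
    unfolding T_def[abs_def] U_def
    by (rule has_vector_derivative_eq_rhs[OF has_vector_derivative_add[OF
        has_vector_derivative_scaleR[OF c(1) P(1)] has_vector_derivative_scaleR[OF c(2) P(2)]]])
      (subst cs[symmetric], simp add: algebra_simps)
  show "(U has_vector_derivative - deriv H x *\<^sub>R T x) (at x)"
    unfolding U_def[abs_def] T_def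
    by (rule has_vector_derivative_eq_rhs[OF has_vector_derivative_diff[OF
        has_vector_derivative_scaleR[OF c(1) P(2)] has_vector_derivative_scaleR[OF c(2) P(1)]]])
      (simp add: algebra_simps)
qed

lemma ddlift_fst:
  "((\<lambda>p. dlift (fst p) b) has_derivative (\<lambda>a. dlift (fst p) (\<Gamma>0 (fst p) (fst a) b) + hyp_metric (fst p) (fst a) b *\<^sub>R lift (fst p))) (at p)"
  for p :: "complex \<times> real"
  using has_derivative_compose[OF bounded_linear_imp_has_derivative[OF bounded_linear_fst] has_derivative_dlift]
  by (simp add: \<Gamma>0_def)

lemma foot_vector_comp:
  assumes "p \<in> W" "(k has_vector_derivative k') (at (foot (fst p)))"
  shows "((\<lambda>p. k (foot (fst p))) has_derivative (\<lambda>a. (\<tau> (fst p) (fst a) / warp p) *\<^sub>R k')) (at p)"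
  using has_derivative_compose[OF dfoot_W[OF assms(1)] assms(2)[unfolded has_vector_derivative_def]] .

text \<open>Apart from the Christoffel term, the covariant derivative of \<open>\<tau>\<close> is
  \<open>- qc\<close> times the tensor product of \<open>\<tau>\<close> and \<open>\<nu>\<close>;
  with \<open>d\<nu>\<close> this is the structure equation of the hyperbolic coframe.\<close>

lemma d\<tau>:
  assumes p: "p \<in> W"
  shows "((\<lambda>p. \<tau> (fst p) b) has_derivative (\<lambda>a. \<tau> (fst p) (\<Gamma>0 (fst p) (fst a) b) - qc p * \<tau> (fst p) (fst a) * \<nu> (fst p) b)) (at p)"
proof -
  have x: "foot (fst p) \<in> S" using p by (simp add: W_def)
  have z: "mink (T (foot y)) (lift y) = 0" for y using foot_zero[of y] by (simp add: mink_commute)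
  show ?thesis
    unfolding \<tau>_def[of _ b]
    by (rule has_derivative_eq_rhs[OF mink.FDERIV[OF foot_vector_comp[OF p dT[OF x]] ddlift_fst]])
      (auto simp: mink_simps z mink_G_dlift mink_U_dlift \<tau>_def[symmetric] qc_def wu_def diff_divide_distrib algebra_simps)
qed

lemma d\<nu>:
  assumes p: "p \<in> W"
  shows "((\<lambda>p. \<nu> (fst p) b) has_derivative (\<lambda>a. \<nu> (fst p) (\<Gamma>0 (fst p) (fst a) b) + qc p * \<tau> (fst p) (fst a) * \<tau> (fst p) b)) (at p)"
proof -
  have x: "foot (fst p) \<in> S" using p by (simp add: W_def)
  define N where "N p = sinh (height (fst p)) *\<^sub>R G (foot (fst p)) + cosh (height (fst p)) *\<^sub>R U (foot (fst p))"
    for p :: "complex \<times> real"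
  have z: "mink (N p) (lift (fst p)) = 0" by (subst lift_eq) (simp add: N_def mink_simps)
  have hd: "((\<lambda>p. cosh (height (fst p))) has_derivative (\<lambda>a. sinh (height (fst p)) * \<nu> (fst p) (fst a))) (at p)"
    "((\<lambda>p. sinh (height (fst p))) has_derivative (\<lambda>a. cosh (height (fst p)) * \<nu> (fst p) (fst a))) (at p)"
    by (rule dheight_comp; auto intro!: derivative_eq_intros)+
  have G': "(G has_vector_derivative T x) (at x)" for x using dG by (simp add: T_def \<theta>_def)
  have "(N has_derivative (\<lambda>a. \<nu> (fst p) (fst a) *\<^sub>R lift (fst p) + (wu p * (\<tau> (fst p) (fst a) / warp p)) *\<^sub>R T (foot (fst p)))) (at p)"
    unfolding N_def[abs_def]
    by (rule has_derivative_eq_rhs[OF has_derivative_add[OF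
       has_derivative_scaleR[OF hd(2) foot_vector_comp[OF p G']]
       has_derivative_scaleR[OF hd(1) foot_vector_comp[OF p dU[OF x]]]]], rule ext, subst lift_eq)
      (simp add: wu_def algebra_simps)
  from mink.FDERIV[OF this ddlift_fst[of b p]] show ?thesis
    unfolding N_def \<nu>_def[of _ b, symmetric]
    by (rule has_derivative_eq_rhs)
      (auto simp: mink_simps z[unfolded N_def mink_simps] \<tau>_def[symmetric] \<nu>_def qc_def algebra_simps)
qed

lemma dwarp': "p \<in> W \<Longrightarrow> (warp has_derivative (\<lambda>a. wu p * \<nu> (fst p) (fst a)
     - hder 1 (foot (fst p)) * sinh (height (fst p)) / warp p * \<tau> (fst p) (fst a))) (at p)"
  using dwarp unfolding wu_def .

lemma dmc:
  assumes p: "p \<in> W"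
  shows "(mc has_derivative (\<lambda>a. kc p * \<tau> (fst p) (fst a) - mc p * qc p * \<nu> (fst p) (fst a))) (at p)"
proof -
  have w: "warp p \<noteq> 0" using warp_pos[OF p] by simp
  have "((\<lambda>p. f (foot (fst p))) has_derivative (\<lambda>a. deriv f (foot (fst p)) * (\<tau> (fst p) (fst a) / warp p))) (at p)"
    by (rule dfoot_comp[OF p]) (use dfder[of 0] in simp)
  from has_derivative_divide'[OF this dwarp'[OF p] w] show ?thesis
    unfolding mc_def[abs_def]
    by (rule has_derivative_eq_rhs)
      (use w in \<open>auto simp: kc_def qc_def field_simps power2_eq_square power3_eq_cube\<close>)
qed

definition qc1 where "qc1 p = hder 1 (foot (fst p)) * (qc p * sinh (height (fst p)) - cosh (height (fst p))) / warp p ^ 2"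

text \<open>The coefficient \<open>1 - qc * qc\<close> is the Riccati equation for
  \<open>warp\<close>, whose second u-derivative is \<open>warp\<close> itself; this is where the
  curvature -1 enters.\<close>

lemma dqc:
  assumes p: "p \<in> W"
  shows "(qc has_derivative (\<lambda>a. qc1 p * \<tau> (fst p) (fst a) + (1 - qc p * qc p) * \<nu> (fst p) (fst a))) (at p)"
proof -
  have w: "warp p \<noteq> 0" using warp_pos[OF p] by simp
  have x: "foot (fst p) \<in> S" using p by (simp add: W_def)
  from dfoot_comp[OF p dhder[OF this, of 0]]
  have 1: "((\<lambda>p. deriv H (foot (fst p))) has_derivative (\<lambda>a. hder 1 (foot (fst p)) * (\<tau> (fst p) (fst a) / warp p))) (at p)"
    by simp
  have 2: "((\<lambda>p. cosh (height (fst p))) has_derivative (\<lambda>a. sinh (height (fst p)) * \<nu> (fst p) (fst a))) (at p)"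
    "((\<lambda>p. sinh (height (fst p))) has_derivative (\<lambda>a. cosh (height (fst p)) * \<nu> (fst p) (fst a))) (at p)"
    by (rule dheight_comp; auto intro!: derivative_eq_intros)+
  have "(wu has_derivative (\<lambda>a. warp p * \<nu> (fst p) (fst a) - hder 1 (foot (fst p)) * (\<tau> (fst p) (fst a) / warp p) * cosh (height (fst p)))) (at p)"
    unfolding wu_def[abs_def]
    by (rule has_derivative_eq_rhs[OF has_derivative_diff[OF 2(2) has_derivative_mult[OF 1 2(1)]]])
      (auto simp: algebra_simps warp_def)
  from has_derivative_divide'[OF this dwarp'[OF p] w] show ?thesis
    unfolding qc_def[abs_def]
    by (rule has_derivative_eq_rhs)
      (use w in \<open>auto simp: qc1_def qc_def field_simps power2_eq_square power3_eq_cube\<close>)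
qed

section \<open>The coframe and the metric\<close>

text \<open>The form f dx. Written through \<open>mc\<close> it is defined at every point and
  vanishes off \<open>W\<close>, where dx need not exist.\<close>

definition al where "al p a = mc p * \<tau> (fst p) (fst a)" for p a :: "complex \<times> real"
definition th1 where "th1 p a = \<tau> (fst p) (fst a)" for p a :: "complex \<times> real"
definition th2 where "th2 p a = \<nu> (fst p) (fst a) - snd p * al p a" for p a :: "complex \<times> real"
definition th3 where "th3 p a = snd a + height (fst p) * al p a" for p a :: "complex \<times> real"
definition met :: "(complex \<times> real) tensor2" where
  "met p a b = th1 p a * th1 p b + th2 p a * th2 p b + th3 p a * th3 p b"

lemma linear_th: "linear (al p)" "linear (th1 p)" "linear (th2 p)" "linear (th3 p)"
  by (rule linearI; simp add: al_def th1_def th2_def th3_def linear_add[OF linear_\<tau>] linear_add[OF linear_\<nu>]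
      linear_cmul[OF linear_\<tau>] linear_cmul[OF linear_\<nu>] algebra_simps)+

lemma mc_off_W: "p \<notin> W \<Longrightarrow> mc p = 0" and kc_off_W: "p \<notin> W \<Longrightarrow> kc p = 0"
  using fder_zero[of "foot (fst p)" 0] fder_zero[of "foot (fst p)" 1] by (auto simp: mc_def kc_def W_def)

lemma symmetric_met: "symmetric_tensor met"
proof -
  have "linear (\<lambda>b. met p a b)" "linear (\<lambda>a. met p a b)" for p a b
    unfolding met_def
    by (rule linearI; simp add: linear_add[OF linear_th(2)] linear_add[OF linear_th(3)] linear_add[OF linear_th(4)]
      linear_cmul[OF linear_th(2)] linear_cmul[OF linear_th(3)] linear_cmul[OF linear_th(4)] algebra_simps)+
  then show ?thesis by (simp add: symmetric_tensor_def bilinear_def met_def mult.commute)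
qed

lemma th_injective:
  assumes "th1 p a = 0" "th2 p a = 0" "th3 p a = 0"
  shows "a = 0"
proof -
  have "al p a = 0" using assms(1) by (simp add: al_def th1_def)
  then have "hyp_metric (fst p) (fst a) (fst a) = 0" "snd a = 0"
    using assms by (simp_all add: hyp_metric_eq th1_def th2_def th3_def)
  then show ?thesis using hyp_metric_pos[of "fst a" "fst p"] by (auto simp: prod_eq_iff)
qed

lemma th_eqI:
  assumes "th1 p a = th1 p b" "th2 p a = th2 p b" "th3 p a = th3 p b"
  shows "a = b"
  using th_injective[of p "a - b"] assms linear_th[of p] by (simp add: linear_diff)

lemma met_pos: "a \<noteq> 0 \<Longrightarrow> met p a a > 0"
proof -
  assume "a \<noteq> 0"
  then have "th1 p a \<noteq> 0 \<or> th2 p a \<noteq> 0 \<or> th3 p a \<noteq> 0" using th_injective by blast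
  then have "0 < th1 p a * th1 p a + th2 p a * th2 p a \<or> 0 < th3 p a * th3 p a"
    unfolding sum_squares_gt_zero_iff by (auto simp: zero_less_mult_iff)
  moreover have "0 \<le> th1 p a * th1 p a + th2 p a * th2 p a" "0 \<le> th3 p a * th3 p a" by simp_all
  ultimately show ?thesis unfolding met_def by linarith
qed

text \<open>Every term has a factor \<open>al\<close>; this is the part of the metric that the ideal
  has to control.\<close>

definition corr where "corr p a b = - (snd p * (al p a * \<nu> (fst p) (fst b) + \<nu> (fst p) (fst a) * al p b))
   + snd p * snd p * (al p a * al p b) + height (fst p) * (al p a * snd b + snd a * al p b)
   + height (fst p) * height (fst p) * (al p a * al p b)" for p a b :: "complex \<times> real"

lemma met_eq: "met p a b = (hyp_metric (fst p) (fst a) (fst b) + snd a * snd b) + corr p a b"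
  by (simp add: met_def corr_def th1_def th2_def th3_def hyp_metric_eq algebra_simps)

lemma ideal_fder: "ideal (\<lambda>p. fder k (foot (fst p)))"
  using ideal_base[OF alg_const[of 1]] by simp

lemma ideal_f: "ideal (\<lambda>p. f (foot (fst p)))" and ideal_deriv_f: "ideal (\<lambda>p. deriv f (foot (fst p)))"
  using ideal_fder[of 0] ideal_fder[of 1] by simp_all

lemma ideal_over_warp: "ideal A \<Longrightarrow> ideal (\<lambda>p. A p / warp p ^ k)"
  using ideal_mult'[OF _ alg_power[OF alg_inverse_warp], of A k] by (simp add: power_one_over)

lemma ideal_mc: "ideal mc"
  using ideal_over_warp[OF ideal_f, of 1] by (simp add: mc_def[abs_def])

lemma ideal_kc: "ideal kc"
  unfolding kc_def[abs_def]
  by (intro ideal_add ideal_over_warp ideal_mult' ideal_deriv_f ideal_f alg_intros)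

lemma ideal_al: "ideal (\<lambda>p. al p a)"
  unfolding al_def by (intro ideal_mult' ideal_mc alg_intros)

lemma ideal_corr: "ideal (\<lambda>p. corr p a b)"
  unfolding corr_def
  by (intro ideal_add ideal_minus ideal_mult[OF ideal_add] ideal_mult[OF ideal_mult'] ideal_mult ideal_mult'
      ideal_al ideal_imp_alg[OF ideal_al] alg_intros)

lemma smooth_met: "smooth (\<lambda>p. met p a b)"
proof -
  have "base_alg (\<lambda>p. hyp_metric (fst p) (fst a) (fst b) + snd a * snd b)"
    by (intro base_alg.base_add base_alg.base_const base_alg_hyp_metric)
  from smooth_base_plus_ideal[OF this ideal_corr] show ?thesis unfolding met_eq .
qed

lemma smooth_riemannian_met: "smooth_riemannian_metric met"
  unfolding smooth_riemannian_metric_def using symmetric_met met_pos smooth_met by blast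

lemma continuous_met: "continuous_tensor met"
  unfolding continuous_tensor_def using smooth_met by (metis smooth_def C_k.simps(1))

sublocale continuous_metric met
  by unfold_locales (use symmetric_met met_pos continuous_met in auto)

subsection \<open>The Levi-Civita connection\<close>

text \<open>The connection forms of the coframe are \<open>\<omega>\<^sub>1\<^sub>2 = qc * th1\<close>, \<open>\<omega>\<^sub>2\<^sub>3 = - al\<close> and \<open>\<omega>\<^sub>1\<^sub>3 = 0\<close>. The functions
  \<open>A1\<close>, \<open>A2\<close>, \<open>A3\<close> are the components of the difference between the connection of \<open>met\<close>
  and that of the product metric; \<open>kap\<close> is the covariant derivative of \<open>al\<close> for the latter.\<close>

definition kap where "kap p a b = kc p * th1 p a * th1 p b
  - mc p * qc p * (\<nu> (fst p) (fst a) * th1 p b + th1 p a * \<nu> (fst p) (fst b))" for p a b :: "complex \<times> real"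
definition A1 where "A1 p a b = - (snd p * qc p * mc p * th1 p a * th1 p b)" for p a b :: "complex \<times> real"
definition A2 where "A2 p a b = - (snd p * kap p a b) - mc p * (snd a * th1 p b + snd b * th1 p a)
  - height (fst p) * mc p * mc p * th1 p a * th1 p b - snd p * snd p * mc p * mc p * qc p * th1 p a * th1 p b"
  for p a b :: "complex \<times> real"
definition A3 where "A3 p a b = height (fst p) * kap p a b
  + mc p * (\<nu> (fst p) (fst a) * th1 p b + th1 p a * \<nu> (fst p) (fst b))
  - snd p * mc p * mc p * th1 p a * th1 p b + height (fst p) * snd p * mc p * mc p * qc p * th1 p a * th1 p b"
  for p a b :: "complex \<times> real"
definition Adiff where "Adiff p a b = (A1 p a b *\<^sub>R e1 (fst p) + A2 p a b *\<^sub>R e2 (fst p), A3 p a b)"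
  for p a b :: "complex \<times> real"
definition \<Gamma> where "\<Gamma> p a b = (\<Gamma>0 (fst p) (fst a) (fst b), 0) + Adiff p a b"
  for p a b :: "complex \<times> real"

text \<open>The \<open>D\<close> functions are the derivatives in direction \<open>a\<close> of the
  coframe on a constant vector \<open>b\<close>, as \<open>dth1\<close>, \<open>dth2\<close> and
  \<open>dth3\<close> confirm.\<close>

definition D1 where "D1 p a b = \<tau> (fst p) (\<Gamma>0 (fst p) (fst a) (fst b)) - qc p * th1 p a * \<nu> (fst p) (fst b)"
  for p a b :: "complex \<times> real"
definition Dal where "Dal p a b = mc p * \<tau> (fst p) (\<Gamma>0 (fst p) (fst a) (fst b)) + kap p a b"
  for p a b :: "complex \<times> real"
definition D2 where "D2 p a b = \<nu> (fst p) (\<Gamma>0 (fst p) (fst a) (fst b)) + qc p * th1 p a * th1 p b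
  - (snd a * al p b + snd p * Dal p a b)" for p a b :: "complex \<times> real"
definition D3 where "D3 p a b = \<nu> (fst p) (fst a) * al p b + height (fst p) * Dal p a b"
  for p a b :: "complex \<times> real"

lemma dth1: "p \<in> W \<Longrightarrow> ((\<lambda>p. th1 p b) has_derivative (\<lambda>a. D1 p a b)) (at p)"
  using d\<tau>[of p "fst b"] by (simp add: th1_def D1_def)

lemma dal:
  assumes p: "p \<in> W"
  shows "((\<lambda>p. al p b) has_derivative (\<lambda>a. Dal p a b)) (at p)"
  unfolding al_def
  by (rule has_derivative_eq_rhs[OF has_derivative_mult[OF dmc[OF p] d\<tau>[OF p, of "fst b"]]])
    (auto simp: Dal_def kap_def th1_def algebra_simps)

lemma dth2:
  assumes p: "p \<in> W"
  shows "((\<lambda>p. th2 p b) has_derivative (\<lambda>a. D2 p a b)) (at p)"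
  unfolding th2_def
  by (rule has_derivative_eq_rhs[OF has_derivative_diff[OF d\<nu>[OF p, of "fst b"]
      has_derivative_mult[OF bounded_linear_imp_has_derivative[OF bounded_linear_snd] dal[OF p, of b]]]])
    (auto simp: D2_def th1_def algebra_simps)

lemma dth3:
  assumes p: "p \<in> W"
  shows "((\<lambda>p. th3 p b) has_derivative (\<lambda>a. D3 p a b)) (at p)"
  unfolding th3_def
  by (rule has_derivative_eq_rhs[OF has_derivative_add[OF has_derivative_const
      has_derivative_mult[OF dheight_fst dal[OF p, of b]]]])
    (auto simp: D3_def algebra_simps)

lemma al_th1: "al p a = mc p * th1 p a"
  by (simp add: al_def th1_def)

text \<open>First structure equation: the coframe on the covariant derivative of \<open>b\<close> is
  its plain derivative plus skew connection forms. This justifies the guess for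
  \<open>\<Gamma>\<close>: skewness yields compatibility, and \<open>\<Gamma>_sym\<close> is
  vanishing torsion.\<close>

lemma \<Gamma>_components:
  "th1 p (\<Gamma> p a b) = D1 p a b + qc p * th1 p a * th2 p b"
  "th2 p (\<Gamma> p a b) = D2 p a b - qc p * th1 p a * th1 p b - al p a * th3 p b"
  "th3 p (\<Gamma> p a b) = D3 p a b + al p a * th2 p b"
proof -
  define g1 g2 where "g1 = \<tau> (fst p) (\<Gamma>0 (fst p) (fst a) (fst b))" and "g2 = \<nu> (fst p) (\<Gamma>0 (fst p) (fst a) (fst b))"
  have t: "\<tau> (fst p) (fst (\<Gamma> p a b)) = g1 + A1 p a b" "\<nu> (fst p) (fst (\<Gamma> p a b)) = g2 + A2 p a b"
    "snd (\<Gamma> p a b) = A3 p a b"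
    by (simp_all add: \<Gamma>_def Adiff_def g1_def g2_def linear_add[OF linear_\<tau>] linear_add[OF linear_\<nu>]
        linear_cmul[OF linear_\<tau>] linear_cmul[OF linear_\<nu>])
  show "th1 p (\<Gamma> p a b) = D1 p a b + qc p * th1 p a * th2 p b"
    unfolding th1_def[of p "\<Gamma> p a b"] t unfolding D1_def g1_def[symmetric] A1_def th2_def al_def th1_def[symmetric]
    by (simp add: algebra_simps)
  show "th2 p (\<Gamma> p a b) = D2 p a b - qc p * th1 p a * th1 p b - al p a * th3 p b"
    unfolding th2_def[of p "\<Gamma> p a b"] th3_def al_def[of p] t unfolding D2_def Dal_def g1_def[symmetric] g2_def[symmetric] A1_def A2_def th1_def[symmetric]
    by (simp add: al_th1 algebra_simps)
  show "th3 p (\<Gamma> p a b) = D3 p a b + al p a * th2 p b"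
    unfolding th3_def[of p "\<Gamma> p a b"] th2_def al_def[of p] t unfolding D3_def Dal_def g1_def[symmetric] g2_def[symmetric] A1_def A3_def th1_def[symmetric]
    by (simp add: al_th1 algebra_simps)
qed

lemma \<Gamma>_sym: "\<Gamma> p a b = \<Gamma> p b a"
  by (simp add: \<Gamma>_def \<Gamma>0_def Adiff_def A1_def A2_def A3_def kap_def hyp_metric_commute[of _ "fst a"] algebra_simps)

lemma Adiff_off_W: "p \<notin> W \<Longrightarrow> Adiff p a b = 0"
  by (simp add: Adiff_def A1_def A2_def A3_def kap_def mc_off_W kc_off_W zero_prod_def)

lemma met_off_W: "p \<notin> W \<Longrightarrow> met p a b = hyp_metric (fst p) (fst a) (fst b) + snd a * snd b"
  by (simp add: met_eq corr_def al_def mc_off_W)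

text \<open>On \<open>W\<close> the connection forms cancel by skewness. Off \<open>W\<close> the
  derivative of \<open>corr\<close> and the tensor \<open>Adiff\<close> vanish, and the formula is
  that of the product metric.\<close>

lemma compatible_met:
  "((\<lambda>q. met q b c) has_derivative (\<lambda>a. met p (\<Gamma> p a b) c + met p b (\<Gamma> p a c))) (at p)"
proof (cases "p \<in> W")
  case True
  show ?thesis
    unfolding met_def
    by (rule has_derivative_eq_rhs[OF has_derivative_add[OF has_derivative_add[OF
        has_derivative_mult[OF dth1[OF True, of b] dth1[OF True, of c]]
        has_derivative_mult[OF dth2[OF True, of b] dth2[OF True, of c]]]
        has_derivative_mult[OF dth3[OF True, of b] dth3[OF True, of c]]]])
      (rule ext, simp add: \<Gamma>_components algebra_simps)
next
  case False
  obtain A' where A': "\<And>a. ideal (A' a)" "\<And>p. ((\<lambda>p. corr p b c) has_derivative (\<lambda>a. A' a p)) (at p)"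
    using ideal_derivative[OF ideal_corr[of b c]] by metis
  have "((\<lambda>p. hyp_metric (fst p) (fst b) (fst c)) has_derivative
     (\<lambda>a. hyp_metric (fst p) (\<Gamma>0 (fst p) (fst a) (fst b)) (fst c) + hyp_metric (fst p) (fst b) (\<Gamma>0 (fst p) (fst a) (fst c)))) (at p)"
    using has_derivative_compose[OF bounded_linear_imp_has_derivative[OF bounded_linear_fst] has_derivative_hyp_metric]
    by (simp add: \<Gamma>0_def)
  from has_derivative_add[OF has_derivative_add[OF this has_derivative_const[of "snd b * snd c"]] A'(2)[of p]]
  show ?thesis unfolding met_eq[symmetric]
    by (rule has_derivative_eq_rhs)
      (simp add: met_off_W[OF False] \<Gamma>_def Adiff_off_W[OF False] ideal_off_W[OF A'(1) False])
qed

lemma christoffel_met: "christoffel met p a b = \<Gamma> p a b"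
  by (rule christoffel_koszul[where g = met, OF bilinear_g pos_g g_commute \<Gamma>_sym compatible_met])

end

context fermi_smooth
begin

subsection \<open>Curvature\<close>

lemma alg_isCont: "alg c \<Longrightarrow> p \<in> W \<Longrightarrow> isCont c p"
  using alg_derivative[of c] has_derivative_continuous by blast

text \<open>The derivatives of an element of the algebra are again in it, hence continuous on
  \<open>W\<close>, so Schwarz's theorem applies.\<close>

lemma alg_second_derivative:
  assumes c: "alg c" and c': "\<And>q. q \<in> W \<Longrightarrow> (c has_derivative (\<lambda>a. c' q a)) (at q)"
  obtains c'' where "\<And>a p. p \<in> W \<Longrightarrow> ((\<lambda>q. c' q a) has_derivative (\<lambda>b. c'' p b a)) (at p)"
    "\<And>a b p. p \<in> W \<Longrightarrow> c'' p a b = c'' p b a"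
proof -
  obtain d where d: "\<And>a. alg (d a)" "\<And>p. p \<in> W \<Longrightarrow> (c has_derivative (\<lambda>a. d a p)) (at p)"
    using alg_derivative[OF c] by metis
  have dc: "d a q = c' q a" if "q \<in> W" for a q
    using has_derivative_unique[OF d(2)[OF that] c'[OF that]] by metis
  have "\<forall>a. \<exists>e. (\<forall>b. alg (e b)) \<and> (\<forall>p\<in>W. (d a has_derivative (\<lambda>b. e b p)) (at p))"
    using alg_derivative[OF d(1)] by blast
  then obtain e where e: "\<And>a b. alg (e a b)" "\<And>a p. p \<in> W \<Longrightarrow> (d a has_derivative (\<lambda>b. e a b p)) (at p)"
    by metis
  show thesis
  proof (rule that[of "\<lambda>p b a. e a b p"])
    fix a b :: "complex \<times> real" and p assume p: "p \<in> W"
    show "((\<lambda>q. c' q a) has_derivative (\<lambda>b. e a b p)) (at p)"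
      by (rule has_derivative_transform_within_open[OF e(2)[OF p] open_W p]) (rule dc)
    show "e b a p = e a b p"
      by (rule second_derivative_symmetric[where F = c and F' = "\<lambda>q a. d a q" and W = W and Fa = "\<lambda>q b'. e b b' q" and a = b
            and Fb = "\<lambda>q b'. e a b' q" and b = a])
        (use open_W p d e alg_isCont in auto)
  qed
qed

lemma alg_th: "alg (\<lambda>p. th1 p a)" "alg (\<lambda>p. th2 p a)" "alg (\<lambda>p. th3 p a)"
  unfolding th1_def th2_def th3_def by (intro alg_intros ideal_imp_alg[OF ideal_al])+

lemma ideal_A: "ideal (\<lambda>p. A1 p a b)" "ideal (\<lambda>p. A2 p a b)" "ideal (\<lambda>p. A3 p a b)"
proof -
  have q: "alg qc" unfolding qc_def[abs_def] wu_def by (intro alg_intros)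
  have k: "ideal (\<lambda>p. kap p a b)"
    unfolding kap_def by (intro ideal_diff ideal_mult' ideal_kc ideal_mc q alg_intros alg_th)
  have m: "alg mc" by (rule ideal_imp_alg[OF ideal_mc])
  show "ideal (\<lambda>p. A1 p a b)"
    unfolding A1_def by (intro ideal_minus ideal_mult' ideal_mult[OF ideal_mc] q alg_intros alg_th)
  show "ideal (\<lambda>p. A2 p a b)"
    unfolding A2_def
    by (intro ideal_diff ideal_minus ideal_mult[OF k] ideal_mult' ideal_mult[OF ideal_mc] ideal_mc m q alg_intros alg_th)
  show "ideal (\<lambda>p. A3 p a b)"
    unfolding A3_def
    by (intro ideal_diff ideal_add ideal_mult[OF k] ideal_mult' ideal_mult[OF ideal_mc] ideal_mc m q alg_intros alg_th)
qed

lemma alg_inner_frame: "alg (\<lambda>p. e1 (fst p) \<bullet> d)" "alg (\<lambda>p. e2 (fst p) \<bullet> d)"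
proof -
  have i: "snd v \<bullet> d = mink (0, d) v" for v by (simp add: mink_def inner_commute)
  show "alg (\<lambda>p. e1 (fst p) \<bullet> d)" "alg (\<lambda>p. e2 (fst p) \<bullet> d)"
    unfolding e1_def e2_def i mink_simps by (intro alg_intros)+
qed

lemma ideal_Adiff: "ideal (\<lambda>p. Adiff p a b \<bullet> d)"
  unfolding Adiff_def
  by (simp add: inner_prod_def inner_simps)
    (intro ideal_add ideal_mult' ideal_A alg_inner_frame alg_const)

text \<open>The components of \<open>Adiff\<close> lie in the ideal. This is what gives the
  Christoffel symbols a derivative off \<open>W\<close>, equal there to that of the product.\<close>

lemma Adiff_derivative:
  obtains A' where "\<And>p. ((\<lambda>p. Adiff p b c) has_derivative A' p) (at p)" "\<And>p a. p \<notin> W \<Longrightarrow> A' p a = 0"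
proof -
  have "\<forall>d. \<exists>A'. (\<forall>a. ideal (A' a)) \<and> (\<forall>p. ((\<lambda>p. Adiff p b c \<bullet> d) has_derivative (\<lambda>a. A' a p)) (at p))"
    using ideal_derivative[OF ideal_Adiff] by blast
  then obtain A' where A': "\<And>d a. ideal (A' d a)" "\<And>d p. ((\<lambda>p. Adiff p b c \<bullet> d) has_derivative (\<lambda>a. A' d a p)) (at p)"
    by metis
  show thesis
  proof (rule that[of "\<lambda>p a. \<Sum>d\<in>Basis. A' d a p *\<^sub>R d"])
    fix p
    have "((\<lambda>p. \<Sum>d\<in>Basis. (Adiff p b c \<bullet> d) *\<^sub>R d) has_derivative (\<lambda>a. \<Sum>d\<in>Basis. A' d a p *\<^sub>R d)) (at p)"
      by (intro has_derivative_sum has_derivative_scaleR_left A')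
    then show "((\<lambda>p. Adiff p b c) has_derivative (\<lambda>a. \<Sum>d\<in>Basis. A' d a p *\<^sub>R d)) (at p)"
      by (simp add: euclidean_representation)
  qed (simp add: ideal_off_W[OF A'(1)])
qed

definition D\<Gamma>0 :: "complex \<Rightarrow> complex \<Rightarrow> complex \<Rightarrow> complex \<Rightarrow> complex" where
  "D\<Gamma>0 y a b c = - (hyp_metric y (\<Gamma>0 y a b) c + hyp_metric y b (\<Gamma>0 y a c)) *\<^sub>R y - hyp_metric y b c *\<^sub>R a"

lemma d\<Gamma>0: "((\<lambda>y. \<Gamma>0 y b c) has_derivative (\<lambda>a. D\<Gamma>0 y a b c)) (at y)"
  unfolding \<Gamma>0_def[of _ b c]
  by (rule has_derivative_eq_rhs[OF has_derivative_scaleR[OF has_derivative_minus[OF has_derivative_hyp_metric] has_derivative_ident]])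
    (auto simp: D\<Gamma>0_def \<Gamma>0_def algebra_simps)

lemma \<Gamma>_derivative:
  obtains V where "\<And>p. ((\<lambda>p. \<Gamma> p b c) has_derivative V p) (at p)"
    "\<And>p a. p \<notin> W \<Longrightarrow> V p a = (D\<Gamma>0 (fst p) (fst a) (fst b) (fst c), 0)"
proof -
  obtain A' where A': "\<And>p. ((\<lambda>p. Adiff p b c) has_derivative A' p) (at p)" "\<And>p a. p \<notin> W \<Longrightarrow> A' p a = 0"
    by (rule Adiff_derivative[of b c]) blast
  show thesis
  proof (rule that[of "\<lambda>p a. (D\<Gamma>0 (fst p) (fst a) (fst b) (fst c), 0) + A' p a"])
    fix p :: "complex \<times> real"
    have "((\<lambda>p. \<Gamma>0 (fst p) (fst b) (fst c)) has_derivative (\<lambda>a. D\<Gamma>0 (fst p) (fst a) (fst b) (fst c))) (at p)"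
      by (rule has_derivative_compose[OF bounded_linear_imp_has_derivative[OF bounded_linear_fst] d\<Gamma>0])
    from has_derivative_add[OF has_derivative_Pair[OF this has_derivative_const] A'(1)]
    show "((\<lambda>p. \<Gamma> p b c) has_derivative (\<lambda>a. (D\<Gamma>0 (fst p) (fst a) (fst b) (fst c), 0) + A' p a)) (at p)"
      unfolding \<Gamma>_def .
  qed (simp add: A')
qed

lemma riem_curv_met:
  assumes "((\<lambda>p. \<Gamma> p b c) has_derivative Vb) (at p)" "((\<lambda>p. \<Gamma> p a c) has_derivative Va) (at p)"
  shows "riem_curv met p a b c = Vb a - Va b + \<Gamma> p a (\<Gamma> p b c) - \<Gamma> p b (\<Gamma> p a c)"
  unfolding riem_curv_def christoffel_met[abs_def]
  using frechet_derivative_at[OF assms(1)] frechet_derivative_at[OF assms(2)]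
  by (simp add: christoffel_met)

text \<open>The part of the metric orthogonal to \<open>vert\<close>, on which all curvature
  lives.\<close>

definition gh where "gh p a b = th1 p a * th1 p b + th2 p a * th2 p b"
text \<open>The coordinate field of v, dual to \<open>th3\<close>; it spans the kernel of the Ricci
  tensor.\<close>

definition vert :: "complex \<times> real" where "vert = (0, 1)"
lemma vert_nonzero: "vert \<noteq> 0"
  by (simp add: vert_def zero_prod_def)

definition proj where "proj p a = a - th3 p a *\<^sub>R vert" for p a :: "complex \<times> real"

lemma th_vert [simp]: "th1 p vert = 0" "th2 p vert = 0" "th3 p vert = 1"
  by (simp_all add: vert_def th1_def th2_def th3_def al_def linear_0[OF linear_\<tau>] linear_0[OF linear_\<nu>])

lemma th_linear_simps:
  "th1 p (a + b) = th1 p a + th1 p b" "th2 p (a + b) = th2 p a + th2 p b" "th3 p (a + b) = th3 p a + th3 p b"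
  "th1 p (a - b) = th1 p a - th1 p b" "th2 p (a - b) = th2 p a - th2 p b" "th3 p (a - b) = th3 p a - th3 p b"
  "th1 p (- a) = - th1 p a" "th2 p (- a) = - th2 p a" "th3 p (- a) = - th3 p a"
  "th1 p (r *\<^sub>R a) = r * th1 p a" "th2 p (r *\<^sub>R a) = r * th2 p a" "th3 p (r *\<^sub>R a) = r * th3 p a"
  using linear_th[of p] by (simp_all add: linear_add linear_diff linear_neg linear_cmul)

lemma linear_D: "linear (D1 p a)" "linear (D2 p a)" "linear (D3 p a)"
proof -
  have z: "linear (\<Gamma>0 y v)" for y v
    unfolding \<Gamma>0_def[abs_def]
    by (rule linearI; simp add: bilinear_radd[OF bilinear_hyp_metric] bilinear_rmul[OF bilinear_hyp_metric] algebra_simps)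
  show "linear (D1 p a)" "linear (D2 p a)" "linear (D3 p a)"
    by (rule linearI; simp add: D1_def D2_def D3_def Dal_def kap_def th_linear_simps al_th1 linear_add[OF z] linear_cmul[OF z]
      linear_add[OF linear_\<tau>] linear_add[OF linear_\<nu>] linear_cmul[OF linear_\<tau>] linear_cmul[OF linear_\<nu>] algebra_simps)+
qed

lemma th_proj [simp]: "th1 p (proj p a) = th1 p a" "th2 p (proj p a) = th2 p a" "th3 p (proj p a) = 0"
  by (simp_all add: proj_def th_linear_simps)

text \<open>Cartan's second structure equation: the only nonzero curvature form is \<open>\<Omega>\<^sub>1\<^sub>2 = th2 \<and> th1\<close>.\<close>

lemma curvature_on_W:
  assumes p: "p \<in> W"
  shows "riem_curv met p a b c = - (gh p b c *\<^sub>R proj p a - gh p a c *\<^sub>R proj p b)"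
proof -
  obtain Vb where Vb: "((\<lambda>p. \<Gamma> p b c) has_derivative Vb) (at p)" using \<Gamma>_derivative[of b c] by metis
  obtain Va where Va: "((\<lambda>p. \<Gamma> p a c) has_derivative Va) (at p)" using \<Gamma>_derivative[of a c] by metis
  obtain E1 where E1: "\<And>a p. p \<in> W \<Longrightarrow> ((\<lambda>q. D1 q a c) has_derivative (\<lambda>b. E1 p b a)) (at p)"
    "\<And>a b p. p \<in> W \<Longrightarrow> E1 p a b = E1 p b a"
    by (rule alg_second_derivative[where c = "\<lambda>q. th1 q c" and c' = "\<lambda>q a. D1 q a c", OF alg_th(1) dth1]) blast+
  obtain E2 where E2: "\<And>a p. p \<in> W \<Longrightarrow> ((\<lambda>q. D2 q a c) has_derivative (\<lambda>b. E2 p b a)) (at p)"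
    "\<And>a b p. p \<in> W \<Longrightarrow> E2 p a b = E2 p b a"
    by (rule alg_second_derivative[where c = "\<lambda>q. th2 q c" and c' = "\<lambda>q a. D2 q a c", OF alg_th(2) dth2]) blast+
  obtain E3 where E3: "\<And>a p. p \<in> W \<Longrightarrow> ((\<lambda>q. D3 q a c) has_derivative (\<lambda>b. E3 p b a)) (at p)"
    "\<And>a b p. p \<in> W \<Longrightarrow> E3 p a b = E3 p b a"
    by (rule alg_second_derivative[where c = "\<lambda>q. th3 q c" and c' = "\<lambda>q a. D3 q a c", OF alg_th(3) dth3]) blast+
  \<comment> \<open>The derivative of the connection form \<open>qc * th1\<close> in direction
    \<open>a\<close>.\<close>
  define Dom where "Dom a b = (qc1 p * th1 p a + (1 - qc p * qc p) * \<nu> (fst p) (fst a)) * th1 p b + qc p * D1 p a b" for a b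
  have dom: "((\<lambda>q. qc q * th1 q b) has_derivative (\<lambda>a. Dom a b)) (at p)" for b
    by (rule has_derivative_eq_rhs[OF has_derivative_mult[OF dqc[OF p] dth1[OF p, of b]]])
      (auto simp: Dom_def th1_def)
  have \<Gamma>1: "((\<lambda>q. th1 q (\<Gamma> q b c)) has_derivative (\<lambda>a. E1 p a b + (qc p * th1 p b * D2 p a c + Dom a b * th2 p c))) (at p)" for b
    unfolding \<Gamma>_components by (intro has_derivative_add E1 p has_derivative_mult dom dth2)
  have \<Gamma>2: "((\<lambda>q. th2 q (\<Gamma> q b c)) has_derivative (\<lambda>a. E2 p a b - (qc p * th1 p b * D1 p a c + Dom a b * th1 p c)
      - (al p b * D3 p a c + Dal p a b * th3 p c))) (at p)" for b
    unfolding \<Gamma>_components by (intro has_derivative_diff E2 p has_derivative_mult dom dth1 dth3 dal)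
  have \<Gamma>3: "((\<lambda>q. th3 q (\<Gamma> q b c)) has_derivative (\<lambda>a. E3 p a b + (al p b * D2 p a c + Dal p a b * th2 p c))) (at p)" for b
    unfolding \<Gamma>_components by (intro has_derivative_add E3 p has_derivative_mult dth2 dal)
  \<comment> \<open>The coframe on \<open>\<Gamma> p b c\<close> is differentiated in two ways, by
    the product rule for forms and by the structure equation.\<close>
  have V1: "D1 p a (\<Gamma> p b c) + th1 p (V a) = E1 p a b + (qc p * th1 p b * D2 p a c + Dom a b * th2 p c)"
    and V2: "D2 p a (\<Gamma> p b c) + th2 p (V a) = E2 p a b - (qc p * th1 p b * D1 p a c + Dom a b * th1 p c)
      - (al p b * D3 p a c + Dal p a b * th3 p c)"
    and V3: "D3 p a (\<Gamma> p b c) + th3 p (V a) = E3 p a b + (al p b * D2 p a c + Dal p a b * th2 p c)"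
    if V: "((\<lambda>p. \<Gamma> p b c) has_derivative V) (at p)" for a b V
    using has_derivative_unique[OF has_derivative_apply_linear[OF linear_th(2) linear_D(1) dth1[OF p] V] \<Gamma>1[of b]]
      has_derivative_unique[OF has_derivative_apply_linear[OF linear_th(3) linear_D(2) dth2[OF p] V] \<Gamma>2[of b]]
      has_derivative_unique[OF has_derivative_apply_linear[OF linear_th(4) linear_D(3) dth3[OF p] V] \<Gamma>3[of b]]
    by metis+
  note V = V1[OF Vb, of a] V2[OF Vb, of a] V3[OF Vb, of a] V1[OF Va, of b] V2[OF Va, of b] V3[OF Va, of b]
  have \<Gamma>sym: "\<tau> (fst p) (\<Gamma>0 (fst p) (fst b) (fst a)) = \<tau> (fst p) (\<Gamma>0 (fst p) (fst a) (fst b))"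
    by (simp add: \<Gamma>0_def hyp_metric_commute[of _ "fst a"])
  \<comment> \<open>The form \<open>al\<close> is closed, being f(x) dx.\<close>
  have Dals: "Dal p b a = Dal p a b" unfolding Dal_def kap_def \<Gamma>sym by (simp add: algebra_simps)
  \<comment> \<open>The exterior derivative of \<open>qc * th1\<close>: the factor
    \<open>1 - qc * qc\<close> from \<open>dqc\<close> is completed to 1 by the \<open>qc\<close>
    term of \<open>D1\<close>.\<close>
  have Doms: "Dom a b - Dom b a = \<nu> (fst p) (fst a) * th1 p b - \<nu> (fst p) (fst b) * th1 p a"
    unfolding Dom_def D1_def \<Gamma>sym by (simp add: algebra_simps)
  have nu: "\<nu> (fst p) (fst v) = th2 p v + snd p * mc p * th1 p v" for v by (simp add: th2_def al_th1)
  note R = riem_curv_met[OF Vb Va]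
  show ?thesis
  proof (rule th_eqI[of p])
    \<comment> \<open>The second derivatives \<open>E1\<close> cancel by symmetry, and the products
      of connection forms because all these forms are multiples of \<open>th1\<close>.\<close>
    have "th1 p (riem_curv met p a b c) = (Dom a b - Dom b a) * th2 p c"
      unfolding R th_linear_simps \<Gamma>_components(1)[of p _ "\<Gamma> p _ _"] \<Gamma>_components(2)
      using V(1,4) E1(2)[OF p, of a b] by (simp add: al_th1 algebra_simps)
    then show "th1 p (riem_curv met p a b c) = th1 p (- (gh p b c *\<^sub>R proj p a - gh p a c *\<^sub>R proj p b))"
      unfolding Doms nu by (simp add: gh_def th_linear_simps algebra_simps)
    have "th2 p (riem_curv met p a b c) = - (Dom a b - Dom b a) * th1 p c"
      unfolding R th_linear_simps \<Gamma>_components(2)[of p _ "\<Gamma> p _ _"] \<Gamma>_components(1,3)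
      using V(2,5) E2(2)[OF p, of a b] Dals by (simp add: algebra_simps)
    then show "th2 p (riem_curv met p a b c) = th2 p (- (gh p b c *\<^sub>R proj p a - gh p a c *\<^sub>R proj p b))"
      unfolding Doms nu by (simp add: gh_def th_linear_simps algebra_simps)
    have "th3 p (riem_curv met p a b c) = 0"
      unfolding R th_linear_simps \<Gamma>_components(3)[of p _ "\<Gamma> p _ _"] \<Gamma>_components(2)
      using V(3,6) E3(2)[OF p, of a b] Dals by (simp add: al_th1 algebra_simps)
    then show "th3 p (riem_curv met p a b c) = th3 p (- (gh p b c *\<^sub>R proj p a - gh p a c *\<^sub>R proj p b))"
      by (simp add: gh_def th_linear_simps)
  qed
qed

text \<open>Here \<open>Adiff\<close> and its derivative vanish, so the curvature is that of the
  product of the hyperbolic plane and a line.\<close>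

lemma curvature_off_W:
  assumes p: "p \<notin> W"
  shows "riem_curv met p a b c = - (gh p b c *\<^sub>R proj p a - gh p a c *\<^sub>R proj p b)"
proof -
  have al0: "al p v = 0" for v by (simp add: al_def mc_off_W[OF p])
  have gh: "gh p v w = hyp_metric (fst p) (fst v) (fst w)" for v w
    by (simp add: gh_def th1_def th2_def al0 hyp_metric_eq)
  have proj: "proj p v = (fst v, 0)" for v
    by (simp add: proj_def vert_def th3_def al0 prod_eq_iff)
  have \<Gamma>: "\<Gamma> p v w = (\<Gamma>0 (fst p) (fst v) (fst w), 0)" for v w
    by (simp add: \<Gamma>_def Adiff_off_W[OF p])
  obtain Vb where Vb: "((\<lambda>p. \<Gamma> p b c) has_derivative Vb) (at p)"
    "\<And>a. Vb a = (D\<Gamma>0 (fst p) (fst a) (fst b) (fst c), 0)" using \<Gamma>_derivative[of b c] p by metis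
  obtain Va where Va: "((\<lambda>p. \<Gamma> p a c) has_derivative Va) (at p)"
    "\<And>b. Va b = (D\<Gamma>0 (fst p) (fst b) (fst a) (fst c), 0)" using \<Gamma>_derivative[of a c] p by metis
  show ?thesis
    unfolding riem_curv_met[OF Vb(1) Va(1)] Vb(2) Va(2) \<Gamma> gh proj
    by (simp add: D\<Gamma>0_def \<Gamma>0_def prod_eq_iff bilinear_lmul[OF bilinear_hyp_metric] bilinear_rmul[OF bilinear_hyp_metric]
        bilinear_lneg[OF bilinear_hyp_metric] bilinear_rneg[OF bilinear_hyp_metric]
        hyp_metric_commute[of _ "fst b" "fst a"] hyp_metric_commute[of _ "fst p"] algebra_simps)
qed

lemma curvature: "riem_curv met p a b c = - (gh p b c *\<^sub>R proj p a - gh p a c *\<^sub>R proj p b)"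
  using curvature_on_W curvature_off_W by blast

lemma linear_gh: "linear (\<lambda>a. gh p a c)"
  by (rule linearI; simp add: gh_def th_linear_simps algebra_simps)

lemma linear_representation:
  fixes L :: "'a::euclidean_space \<Rightarrow> real"
  assumes "linear L"
  shows "(\<Sum>e\<in>Basis. L e * (v \<bullet> e)) = L v"
proof -
  have "L v = L (\<Sum>e\<in>Basis. (v \<bullet> e) *\<^sub>R e)" by (simp add: euclidean_representation)
  also have "\<dots> = (\<Sum>e\<in>Basis. L e * (v \<bullet> e))" using assms by (simp add: linear_sum linear_cmul mult.commute)
  finally show ?thesis by simp
qed

section \<open>The Ricci tensor and its eigenvalues\<close>

text \<open>The projection \<open>proj\<close> has trace 3 - 1 = 2, so the trace of the curvature is
  \<open>- 2 * gh p b c + gh p b c\<close>.\<close>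

lemma ricci_met: "ricci met p b c = - gh p b c"
proof -
  have 3: "(\<Sum>e\<in>(Basis::(complex \<times> real) set). e \<bullet> e) = 3" by simp
  have "ricci met p b c = (\<Sum>e\<in>Basis. - gh p b c * (e \<bullet> e) + gh p b c * (th3 p e * (vert \<bullet> e)) + gh p e c * (proj p b \<bullet> e))"
    unfolding ricci_def curvature
    by (rule sum.cong[OF refl]) (simp add: proj_def[of p "_ :: complex \<times> real"] inner_simps algebra_simps)
  also have "\<dots> = - gh p b c * 3 + gh p b c * th3 p vert + gh p (proj p b) c"
    unfolding sum.distrib sum_distrib_left[symmetric] 3 linear_representation[OF linear_th(4)]
      linear_representation[OF linear_gh] ..
  also have "gh p (proj p b) c = gh p b c" by (simp add: gh_def th_linear_simps)
  finally show ?thesis by simp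
qed

lemma ricci_op_met: "ricci_op met p b = - proj p b"
  unfolding ricci_op_def ricci_met
proof (rule the_equality)
  show *: "\<forall>c. met p (- proj p b) c = - gh p b c"
    by (simp add: met_def gh_def th_linear_simps)
  fix w assume w: "\<forall>c. met p w c = - gh p b c"
  have "met p (w - - proj p b) c = 0" for c
    unfolding bilinear_lsub[OF bilinear_g] using spec[OF w, of c] spec[OF *, of c] by simp
  from this[of "w - - proj p b"] have "w - - proj p b = 0"
    using met_pos[of "w - - proj p b" p] by (metis order_less_irrefl)
  then show "w = - proj p b" by (simp add: eq_neg_iff_add_eq_0)
qed

text \<open>The operator is minus a projection of rank 2: the kernel of \<open>th3\<close> belongs
  to -1 and the line of \<open>vert\<close> to 0. For every other \<open>r\<close> the eigenspace
  has to be zero.\<close>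

lemma has_ricci_eigenvalues_met: "has_ricci_eigenvalues met {# -1, -1, 0 #}"
  unfolding has_ricci_eigenvalues_def ricci_op_met
proof (intro allI)
  fix p :: "complex \<times> real" and r :: real
  define n where "n = vert"
  have n: "n \<noteq> 0" "th3 p n = 1" by (simp_all add: n_def vert_nonzero)
  have eq: "- proj p w = r *\<^sub>R w \<longleftrightarrow> th3 p w *\<^sub>R n = (1 + r) *\<^sub>R w" for w
  proof -
    have "- proj p w = r *\<^sub>R w \<longleftrightarrow> th3 p w *\<^sub>R n - w = r *\<^sub>R w" by (simp add: proj_def n_def)
    also have "\<dots> \<longleftrightarrow> th3 p w *\<^sub>R n = (1 + r) *\<^sub>R w" by (auto simp: algebra_simps)
    finally show ?thesis .
  qed
  consider "r = -1" | "r = 0" | "r \<noteq> -1" "r \<noteq> 0" by blast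
  then show "dim {w. - proj p w = r *\<^sub>R w} = count {# -1, -1, 0 #} r"
  proof cases
    case 1
    \<comment> \<open>The vector representing \<open>th3 p\<close> for the Euclidean product, so
      that the eigenspace is a hyperplane.\<close>
    define d where "d = (\<Sum>e\<in>Basis. th3 p e *\<^sub>R e)"
    have d: "d \<bullet> w = th3 p w" for w
      unfolding d_def inner_sum_left using linear_representation[OF linear_th(4), of p w]
      by (simp add: inner_commute)
    have "{w. - proj p w = r *\<^sub>R w} = {w. d \<bullet> w = 0}"
      unfolding eq d using 1 n by auto
    moreover have "d \<noteq> 0" using d[of n] n by auto
    ultimately show ?thesis using 1 by (simp add: dim_hyperplane)
  next
    case 2
    have "{w. - proj p w = r *\<^sub>R w} = span {n}"
    proof -
      have "w \<in> span {n} \<longleftrightarrow> th3 p w *\<^sub>R n = w" for w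
      proof
        assume "w \<in> span {n}"
        then obtain k where "w = k *\<^sub>R n" by (auto simp: span_singleton)
        then show "th3 p w *\<^sub>R n = w" using n by (simp add: th_linear_simps)
      next
        assume "th3 p w *\<^sub>R n = w"
        then show "w \<in> span {n}" by (metis span_base span_scale singletonI)
      qed
      then show ?thesis unfolding eq using 2 by auto
    qed
    then show ?thesis using 2 n by (simp add: dim_span dim_singleton)
  next
    case 3
    have "w = 0" if "th3 p w *\<^sub>R n = (1 + r) *\<^sub>R w" for w
    proof -
      have "th3 p (th3 p w *\<^sub>R n) = th3 p ((1 + r) *\<^sub>R w)" using that by simp
      then have "th3 p w = 0" using 3 n by (simp add: th_linear_simps algebra_simps)
      then show ?thesis using that 3 by (simp add: add_eq_0_iff)
    qed
    then have "{w. - proj p w = r *\<^sub>R w} \<subseteq> {0}" unfolding eq by blast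
    then have "dim {w. - proj p w = r *\<^sub>R w} = 0" by (simp only: dim_eq_0)
    then show ?thesis using 3 by simp
  qed
qed

end

context fermi_smooth
begin

subsection \<open>Completeness\<close>

lemma abs_th1_le: "\<bar>th1 p a\<bar> \<le> sqrt (met p a a)"
proof -
  have "(th1 p a)\<^sup>2 \<le> met p a a" by (simp add: met_def power2_eq_square)
  then show ?thesis by (metis real_sqrt_abs real_sqrt_le_iff)
qed

text \<open>Brings differentiable functions under the growth hypothesis of
  \<open>arclen_lipschitz\<close>.\<close>

lemma has_derivative_imp_growth:
  fixes F :: "complex \<times> real \<Rightarrow> real"
  assumes "(F has_derivative F') (at p)" "\<And>a. \<bar>F' a\<bar> \<le> K * sqrt (met p a a)" "e > 0"
  shows "\<forall>\<^sub>F q in nhds p. \<bar>F q - F p\<bar> \<le> K * sqrt (met p (q - p) (q - p)) + e * norm (q - p)"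
proof -
  have "\<exists>d>0. \<forall>q. norm (q - p) < d \<longrightarrow> norm (F q - F p - F' (q - p)) \<le> e * norm (q - p)"
    using assms(1,3) unfolding has_derivative_at_alt by blast
  then have "\<forall>\<^sub>F q in nhds p. norm (F q - F p - F' (q - p)) \<le> e * norm (q - p)"
    unfolding eventually_nhds_metric dist_norm by simp
  then show ?thesis
  proof eventually_elim
    case (elim q)
    then show ?case using assms(2)[of "q - p"] by simp
  qed
qed

text \<open>The summand 1 keeps the square root differentiable at u = v = 0.\<close>

definition rho where "rho p = sqrt (1 + height (fst p) * height (fst p) + snd p * snd p)"
  for p :: "complex \<times> real"

lemma rho_ge: "\<bar>height (fst p)\<bar> \<le> rho p" "\<bar>snd p\<bar> \<le> rho p"
  unfolding rho_def by (rule real_le_rsqrt, simp add: power2_eq_square)+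

text \<open>The rotation term of the metric drops out of \<open>u du + v dv\<close>.\<close>

lemma rho_derivative:
  obtains r' where "(rho has_derivative r') (at p)" "\<And>a. \<bar>r' a\<bar> \<le> sqrt (met p a a)"
proof -
  define u v where "u = height (fst p)" and "v = snd p"
  define r where "r = rho p"
  have pos: "1 + u * u + v * v > 0" by (simp add: add_pos_nonneg)
  have r: "r > 0" "r * r = 1 + u * u + v * v"
    using pos by (simp_all add: r_def rho_def u_def v_def)
  have h: "((\<lambda>p. height (fst p)) has_derivative (\<lambda>a. \<nu> (fst p) (fst a))) (at p)" by (rule dheight_fst)
  have s: "(snd has_derivative snd) (at p)" by (rule bounded_linear_imp_has_derivative[OF bounded_linear_snd])
  have "((\<lambda>p. 1 + height (fst p) * height (fst p) + snd p * snd p) has_derivative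
     (\<lambda>a. 2 * (u * \<nu> (fst p) (fst a) + v * snd a))) (at p)"
    by (rule has_derivative_eq_rhs[OF has_derivative_add[OF has_derivative_add[OF has_derivative_const
        has_derivative_mult[OF h h]] has_derivative_mult[OF s s]]]) (auto simp: u_def v_def algebra_simps)
  moreover have "(sqrt has_derivative (*) (1 / (2 * r))) (at (1 + height (fst p) * height (fst p) + snd p * snd p))"
    using DERIV_real_sqrt[OF pos] r
    by (simp add: has_field_derivative_def r_def rho_def u_def v_def inverse_eq_divide mult.commute)
  ultimately have "((\<lambda>p. sqrt (1 + height (fst p) * height (fst p) + snd p * snd p)) has_derivative
     (\<lambda>a. 1 / (2 * r) * (2 * (u * \<nu> (fst p) (fst a) + v * snd a)))) (at p)"
    by (rule has_derivative_compose)
  then have "(rho has_derivative (\<lambda>a. (u * th2 p a + v * th3 p a) / r)) (at p)"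
    unfolding rho_def[abs_def, symmetric]
    by (rule has_derivative_eq_rhs) (use r in \<open>auto simp: th2_def th3_def u_def v_def field_simps\<close>)
  moreover have "\<bar>(u * th2 p a + v * th3 p a) / r\<bar> \<le> sqrt (met p a a)" for a
  proof -
    define x y where "x = th2 p a" and "y = th3 p a"
    have "(u * x + v * y)\<^sup>2 + (u * y - v * x)\<^sup>2 = (u * u + v * v) * (x * x + y * y)"
      by (simp add: power2_eq_square algebra_simps)
    then have "(u * x + v * y)\<^sup>2 \<le> (u * u + v * v) * (x * x + y * y)"
      by (metis le_add_same_cancel1 zero_le_power2)
    also have "\<dots> \<le> (r * r) * met p a a"
      unfolding r(2) met_def x_def y_def by (intro mult_mono) auto
    finally have "((u * x + v * y) / r)\<^sup>2 \<le> met p a a"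
      using r(1) by (simp add: power_divide power2_eq_square field_simps)
    then show ?thesis unfolding x_def y_def by (metis real_sqrt_abs real_sqrt_le_iff)
  qed
  ultimately show thesis by (rule that)
qed

text \<open>\<open>foot\<close> need not be differentiable at \<open>p\<close>, but with frozen
  coefficients \<open>c * foot - s * H\<close> is, with derivative \<open>th1 p\<close>. As
  \<open>H\<close> has Lipschitz constant 1, the increment of this combination dominates
  \<open>c - \<bar>s\<bar> \<ge> exp (- R)\<close> times that of \<open>foot\<close>.\<close>

lemma foot_growth:
  assumes R: "\<bar>height (fst p)\<bar> \<le> R" and e: "e > 0"
  shows "\<forall>\<^sub>F q in nhds p. \<bar>foot (fst q) - foot (fst p)\<bar> \<le> exp R * sqrt (met p (q - p) (q - p)) + e * norm (q - p)"
proof -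
  define c s where "c = cosh (height (fst p))" and "s = sinh (height (fst p))"
  define F where "F q = c * foot (fst q) - s * H (foot (fst q))" for q :: "complex \<times> real"
  have "(F has_derivative th1 p) (at p)"
    using has_derivative_compose[OF bounded_linear_imp_has_derivative[OF bounded_linear_fst] dfoot_combination[of "fst p"]]
    unfolding F_def[abs_def] c_def s_def th1_def[abs_def] .
  \<comment> \<open>The factor \<open>exp (- R)\<close> in the remainder anticipates the final
    multiplication by \<open>exp R\<close>.\<close>
  then have "\<forall>\<^sub>F q in nhds p. \<bar>F q - F p\<bar> \<le> 1 * sqrt (met p (q - p) (q - p)) + (e * exp (- R)) * norm (q - p)"
    by (rule has_derivative_imp_growth) (use abs_th1_le e in auto)
  then show ?thesis
  proof eventually_elim
    case (elim q)
    define d \<eta> where "d = foot (fst q) - foot (fst p)" and "\<eta> = H (foot (fst q)) - H (foot (fst p))"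
    have "exp (- R) \<le> exp (- \<bar>height (fst p)\<bar>)" using R by simp
    also have "\<dots> \<le> c - \<bar>s\<bar>" unfolding c_def s_def by (rule exp_height_le)
    finally have "exp (- R) * \<bar>d\<bar> \<le> (c - \<bar>s\<bar>) * \<bar>d\<bar>" by (rule mult_right_mono) simp
    also have "\<dots> \<le> \<bar>c * d - s * \<eta>\<bar>"
    proof -
      have "\<bar>s * \<eta>\<bar> \<le> \<bar>s\<bar> * \<bar>d\<bar>"
        unfolding abs_mult d_def \<eta>_def by (intro mult_left_mono abs_H_diff) simp
      moreover have "\<bar>c * d\<bar> = c * \<bar>d\<bar>" by (simp add: abs_mult c_def)
      ultimately show ?thesis by (simp add: algebra_simps)
    qed
    also have "c * d - s * \<eta> = F q - F p" by (simp add: F_def d_def \<eta>_def algebra_simps)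
    finally have "exp (- R) * \<bar>d\<bar> \<le> sqrt (met p (q - p) (q - p)) + (e * exp (- R)) * norm (q - p)"
      using elim by simp
    then have "exp R * (exp (- R) * \<bar>d\<bar>) \<le> exp R * (sqrt (met p (q - p) (q - p)) + (e * exp (- R)) * norm (q - p))"
      by (rule mult_left_mono) simp
    also have "\<dots> = exp R * sqrt (met p (q - p) (q - p)) + (exp R * exp (- R)) * (e * norm (q - p))"
      by (simp only: distrib_left mult_ac)
    also have "exp R * (exp (- R) * \<bar>d\<bar>) = (exp R * exp (- R)) * \<bar>d\<bar>" by (simp only: mult.assoc)
    also have "exp R * exp (- R) = 1" by (simp flip: exp_add)
    finally show ?case by (simp add: d_def)
  qed
qed

theorem riem_complete_met: "riem_complete met"
proof (rule riem_complete_criterion)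
  fix p :: "complex \<times> real" and r :: real
  \<comment> \<open>\<open>rho\<close> grows at most by the length, which bounds
    \<open>height\<close> and the last coordinate by \<open>R\<close>; the Lipschitz bound
    \<open>exp R\<close> for \<open>foot\<close> there bounds its change by \<open>M\<close>.
    \<open>K\<close> is the image of this box under the continuous coordinates.\<close>
  define R M where "R = rho p + r" and "M = exp R * r"
  define K where "K = (\<lambda>z. (\<Phi> (fst z) (fst (snd z)), snd (snd z))) `
     ({foot (fst p) - M..foot (fst p) + M} \<times> ({-R..R} \<times> {-R..R}))"
  have "continuous_on A (\<lambda>z::real \<times> real \<times> real. \<Phi> (fst z) (fst (snd z)))" for A
    by (rule continuous_on_compose2[OF continuous_\<Phi>[of UNIV], of A "\<lambda>z. (fst z, fst (snd z))", simplified])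
      (intro continuous_intros)
  then have "compact K"
    unfolding K_def by (intro compact_continuous_image continuous_intros compact_Times compact_Icc)
  moreover have "c t \<in> K" if c: "arclen met c L" "c 0 = p" "L \<le> r" and t: "t \<in> {0..1}" for c L t
  proof -
    have rho: "rho (c s) \<le> R" if s: "s \<in> {0..1}" for s
    proof -
      have "\<bar>rho (c s) - rho (c 0)\<bar> \<le> 1 * L"
      proof (rule arclen_lipschitz[OF c(1), where \<Omega> = UNIV])
        show "isCont rho p" for p using rho_derivative[of p] has_derivative_continuous by metis
        show "\<forall>\<^sub>F q in nhds p. \<bar>rho q - rho p\<bar> \<le> 1 * sqrt (met p (q - p) (q - p)) + e * norm (q - p)"
          if "e > 0" for p e
        proof -
          obtain r' where "(rho has_derivative r') (at p)" "\<And>a. \<bar>r' a\<bar> \<le> sqrt (met p a a)"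
            by (rule rho_derivative[of p]) blast
          then show ?thesis using has_derivative_imp_growth[of rho r' p 1 e] that by simp
        qed
      qed (use s in auto)
      then show ?thesis using c by (simp add: R_def)
    qed
    have "\<bar>foot (fst (c t)) - foot (fst (c 0))\<bar> \<le> exp R * L"
    proof (rule arclen_lipschitz[OF c(1), where \<Omega> = "{p. \<bar>height (fst p)\<bar> \<le> R}" and F = "\<lambda>p. foot (fst p)"])
      show "c s \<in> {p. \<bar>height (fst p)\<bar> \<le> R}" if "s \<in> {0..1}" for s
        using rho[OF that] rho_ge(1)[of "c s"] by simp
    qed (use foot_growth isCont_foot_fst t in auto)
    also have "exp R * L \<le> M" unfolding M_def using c by (intro mult_left_mono) auto
    finally have "foot (fst (c t)) \<in> {foot (fst p) - M..foot (fst p) + M}" using c by (auto simp: abs_le_iff)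
    moreover have "height (fst (c t)) \<in> {-R..R}" "snd (c t) \<in> {-R..R}"
      using rho[OF t] rho_ge[of "c t"] by (auto simp: abs_le_iff)
    ultimately show ?thesis
      unfolding K_def by (intro image_eqI[of _ _ "(foot (fst (c t)), height (fst (c t)), snd (c t))"]) auto
  qed
  ultimately show "\<exists>K. compact K \<and> (\<forall>c L. arclen met c L \<and> c 0 = p \<and> L \<le> r \<longrightarrow> (\<forall>t\<in>{0..1}. c t \<in> K))"
    by blast
qed

subsection \<open>The coordinate expression\<close>

definition chart :: "real \<times> real \<times> real \<Rightarrow> complex \<times> real" where
  "chart = (\<lambda>(x, u, v). (\<Phi> x u, v))"

definition dchart :: "real \<Rightarrow> real \<Rightarrow> real \<times> real \<times> real \<Rightarrow> complex \<times> real" where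
  "dchart x u = (\<lambda>(dx, du, dv). (((cosh u - deriv H x * sinh u) * dx) *\<^sub>R e1 (\<Phi> x u) + du *\<^sub>R e2 (\<Phi> x u), dv))"

text \<open>By the Frenet equations the x-derivative of cosh u G + sinh u U is cosh u - h sinh u
  times \<open>T\<close>, the origin of the first term of the metric.\<close>

lemma dchart:
  assumes x: "x \<in> S"
  shows "(chart has_derivative dchart x u) (at (x, u, v))"
proof -
  have f: "(fst has_derivative fst) (at (x, u, v))"
    by (rule bounded_linear_imp_has_derivative[OF bounded_linear_fst])
  have s: "(snd has_derivative snd) (at (x, u, v))"
    by (rule bounded_linear_imp_has_derivative[OF bounded_linear_snd])
  have fs: "((\<lambda>z. fst (snd z)) has_derivative (\<lambda>z. fst (snd z))) (at (x, u, v))"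
    using has_derivative_compose[OF s bounded_linear_imp_has_derivative[OF bounded_linear_fst]] by simp
  have ss: "((\<lambda>z. snd (snd z)) has_derivative (\<lambda>z. snd (snd z))) (at (x, u, v))"
    using has_derivative_compose[OF s bounded_linear_imp_has_derivative[OF bounded_linear_snd]] by simp
  have G': "(G has_vector_derivative T x) (at x)" using dG by (simp add: T_def \<theta>_def)
  have g: "((\<lambda>z. G (fst z)) has_derivative (\<lambda>z. fst z *\<^sub>R T x)) (at (x, u, v))"
    using has_derivative_compose[OF f, of G "\<lambda>r. r *\<^sub>R T x"] G' by (simp add: has_vector_derivative_def)
  have w: "((\<lambda>z. U (fst z)) has_derivative (\<lambda>z. fst z *\<^sub>R (- deriv H x *\<^sub>R T x))) (at (x, u, v))"
    using has_derivative_compose[OF f, of U "\<lambda>r. r *\<^sub>R (- deriv H x *\<^sub>R T x)"] dU[OF x]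
    by (simp add: has_vector_derivative_def)
  have cs: "(cosh has_real_derivative sinh u) (at u)" "(sinh has_real_derivative cosh u) (at u)"
    by (auto intro!: derivative_eq_intros)
  have c: "((\<lambda>z. cosh (fst (snd z))) has_derivative (\<lambda>z. sinh u * fst (snd z))) (at (x, u, v))"
    using has_derivative_compose[OF fs, of cosh "\<lambda>r. sinh u * r"]
      cs(1) by (simp add: has_field_derivative_def)
  have sh: "((\<lambda>z. sinh (fst (snd z))) has_derivative (\<lambda>z. cosh u * fst (snd z))) (at (x, u, v))"
    using has_derivative_compose[OF fs, of sinh "\<lambda>r. cosh u * r"]
      cs(2) by (simp add: has_field_derivative_def)
  have "((\<lambda>z. cosh (fst (snd z)) *\<^sub>R G (fst z) + sinh (fst (snd z)) *\<^sub>R U (fst z)) has_derivative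
      (\<lambda>z. ((cosh u - deriv H x * sinh u) * fst z) *\<^sub>R T x + fst (snd z) *\<^sub>R (sinh u *\<^sub>R G x + cosh u *\<^sub>R U x))) (at (x, u, v))"
    by (rule has_derivative_eq_rhs[OF has_derivative_add[OF has_derivative_scaleR[OF c g] has_derivative_scaleR[OF sh w]]])
      (auto simp: algebra_simps)
  from has_derivative_Pair[OF bounded_linear.has_derivative[OF bounded_linear_snd this] ss]
  moreover have "e1 (\<Phi> x u) = snd (T x)" "e2 (\<Phi> x u) = snd (sinh u *\<^sub>R G x + cosh u *\<^sub>R U x)"
    by (simp_all add: e1_def e2_def)
  ultimately show ?thesis
    unfolding chart_def dchart_def case_prod_unfold by (simp add: \<Phi>_def)
qed

lemma met_dchart:
  assumes x: "x \<in> S"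
  shows "met (chart (x, u, v)) (dchart x u (dx, du, dv)) (dchart x u (dx, du, dv)) =
    (cosh u - deriv H x * sinh u)\<^sup>2 * dx\<^sup>2 + (du - f x * v * dx)\<^sup>2 + (dv + f x * u * dx)\<^sup>2"
proof -
  define p where "p = chart (x, u, v)"
  define a where "a = dchart x u (dx, du, dv)"
  define w where "w = cosh u - deriv H x * sinh u"
  have p: "p \<in> W" "foot (fst p) = x" "height (fst p) = u" "snd p = v" "fst p = \<Phi> x u"
    using x by (simp_all add: p_def chart_def W_def)
  have w: "warp p = w" by (simp add: warp_def p w_def)
  have "w > 0" using warp_pos[OF p(1)] w by simp
  have \<tau>: "\<tau> (fst p) (fst a) = w * dx" and \<nu>: "\<nu> (fst p) (fst a) = du" and s: "snd a = dv"
    unfolding a_def dchart_def w_def[symmetric] p(5)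
    by (simp_all add: linear_add[OF linear_\<tau>] linear_add[OF linear_\<nu>] linear_cmul[OF linear_\<tau>] linear_cmul[OF linear_\<nu>])
  have "al p a = f x * dx" using \<open>w > 0\<close> by (simp add: al_def mc_def p(2) w \<tau>)
  then have "met p a a = (w * dx) * (w * dx) + (du - v * (f x * dx)) * (du - v * (f x * dx))
     + (dv + u * (f x * dx)) * (dv + u * (f x * dx))"
    by (simp add: met_def th1_def th2_def th3_def \<tau> \<nu> s p(3,4))
  then show ?thesis unfolding p_def a_def w_def[symmetric] by (simp add: power2_eq_square algebra_simps)
qed

text \<open>Over \<open>W\<close> the coordinates are regular because \<open>warp\<close> is
  nonzero; this lets the coordinate formula determine a tensor on all tangent vectors.\<close>

lemma dchart_surj:
  assumes p: "p \<in> W"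
  obtains z where "dchart (foot (fst p)) (height (fst p)) z = a"
proof -
  have w: "warp p \<noteq> 0" using warp_pos[OF p] by simp
  define v where "v = \<tau> (fst p) (fst a) *\<^sub>R e1 (fst p) + \<nu> (fst p) (fst a) *\<^sub>R e2 (fst p)"
  have "\<tau> (fst p) (v - fst a) = 0" "\<nu> (fst p) (v - fst a) = 0"
    by (simp_all add: v_def linear_diff[OF linear_\<tau>] linear_diff[OF linear_\<nu>] linear_add[OF linear_\<tau>] linear_add[OF linear_\<nu>]
        linear_cmul[OF linear_\<tau>] linear_cmul[OF linear_\<nu>])
  then have "hyp_metric (fst p) (v - fst a) (v - fst a) = 0" by (simp add: hyp_metric_eq)
  then have "v = fst a" using hyp_metric_pos[of "v - fst a" "fst p"] by fastforce
  then have "dchart (foot (fst p)) (height (fst p)) (\<tau> (fst p) (fst a) / warp p, \<nu> (fst p) (fst a), snd a) = a"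
    using w by (simp add: dchart_def warp_def[symmetric] v_def prod_eq_iff)
  then show thesis by (rule that)
qed

text \<open>A point is approached by keeping \<open>height\<close> and the last coordinate while its
  foot point moves through the dense set \<open>S\<close>.\<close>

lemma closure_W: "closure W = UNIV"
proof -
  have "p \<in> closure W" for p
  proof -
    have "continuous_on (closure S) (\<lambda>x. (\<Phi> x (height (fst p)), snd p))"
      by (intro continuous_intros continuous_on_compose2[OF continuous_\<Phi>[of UNIV], of _ "\<lambda>x. (x, height (fst p))", simplified])
    then have "(\<lambda>x. (\<Phi> x (height (fst p)), snd p)) ` closure S \<subseteq> closure W"
      by (rule image_closure_subset) (auto simp: W_def intro: closure_subset[THEN subsetD])
    then have "(\<Phi> (foot (fst p)) (height (fst p)), snd p) \<in> closure W" using dense_S by blast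
    then show ?thesis by simp
  qed
  then show ?thesis by blast
qed

lemma chart_eq: "chart (foot (fst p), height (fst p), snd p) = p"
  by (simp add: chart_def)

text \<open>The formula fixes the quadratic form on \<open>W\<close>, polarization the tensor there,
  and continuity with the density of \<open>W\<close> the tensor everywhere.\<close>

theorem extends_coord_formula_iff:
  assumes coords: "coords \<gamma> = chart"
  shows "extends_coord_formula f (deriv H) S \<gamma> g' \<longleftrightarrow> g' = met"
proof
  assume "g' = met"
  then show "extends_coord_formula f (deriv H) S \<gamma> g'"
    unfolding extends_coord_formula_def coords using symmetric_met continuous_met dchart met_dchart by blast
next
  assume g': "extends_coord_formula f (deriv H) S \<gamma> g'"
  then have sym: "symmetric_tensor g'" and cont: "continuous_tensor g'"
    by (simp_all add: extends_coord_formula_def)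
  have quad: "g' p a a = met p a a" if p: "p \<in> W" for p a
  proof -
    define x u v where "x = foot (fst p)" and "u = height (fst p)" and "v = snd p"
    have x: "x \<in> S" using p by (simp add: W_def x_def)
    have pc: "chart (x, u, v) = p" by (simp add: x_def u_def v_def chart_eq)
    obtain D where D: "(chart has_derivative D) (at (x, u, v))"
      "\<And>dx du dv. g' (chart (x, u, v)) (D (dx, du, dv)) (D (dx, du, dv)) =
       (cosh u - deriv H x * sinh u)\<^sup>2 * dx\<^sup>2 + (du - f x * v * dx)\<^sup>2 + (dv + f x * u * dx)\<^sup>2"
      using g' x unfolding extends_coord_formula_def coords by metis
    have "D = dchart x u" by (rule has_derivative_unique[OF D(1) dchart[OF x]])
    moreover obtain z where "dchart x u z = a" using dchart_surj[OF p] unfolding x_def u_def by metis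
    moreover obtain dx du dv where "z = (dx, du, dv)" by (cases z)
    ultimately show ?thesis using D(2)[of dx du dv] met_dchart[OF x, of u v dx du dv] pc by simp
  qed
  have W: "g' p a b = met p a b" if p: "p \<in> W" for p a b
  proof -
    have "2 * g p a b = g p (a + b) (a + b) - g p a a - g p b b" if "symmetric_tensor g"
      for g :: "(complex \<times> real) tensor2"
    proof -
      have bil: "bilinear (g p)" and com: "g p b a = g p a b"
        using that unfolding symmetric_tensor_def by blast+
      show ?thesis by (simp add: bilinear_ladd[OF bil] bilinear_radd[OF bil] com)
    qed
    from this[OF sym] this[OF symmetric_met] show ?thesis using quad[OF p] by simp
  qed
  have "g' p a b = met p a b" for p a b
  proof -
    have "closed {p. g' p a b = met p a b}"
      using cont continuous_met unfolding continuous_tensor_def by (intro closed_Collect_eq) blast+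
    then have "closure W \<subseteq> {p. g' p a b = met p a b}" by (rule closure_minimal[rotated]) (use W in blast)
    then show ?thesis using closure_W by auto
  qed
  then show "g' = met" by (intro ext)
qed

end

theorem theorem3:
  fixes f H :: "real \<Rightarrow> real" and S :: "real set" and \<gamma> :: "real \<Rightarrow> complex"
  assumes "smooth_real_on UNIV f"
    and "1-lipschitz_on UNIV H"
    and "open S" and "closure S = UNIV" and "smooth_real_on S H"
    and "\<And>(k::nat) (ls::nat list) x\<^sub>0. x\<^sub>0 \<notin> S \<Longrightarrow>
      ((\<lambda>x. (deriv ^^ k) f x * (\<Prod>l\<leftarrow>ls. (deriv ^^ l) (deriv H) x)) \<longlongrightarrow> 0) (at x\<^sub>0 within S)"
    and "curve_with_turning_angle H \<gamma>"
  shows "\<exists>g :: (complex \<times> real) tensor2.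
    (\<forall>g'. extends_coord_formula f (deriv H) S \<gamma> g' \<longleftrightarrow> g' = g) \<and>
    smooth_riemannian_metric g \<and> riem_complete g \<and> has_ricci_eigenvalues g {# -1, -1, 0 #}"
proof -
  obtain G P Q where F:
    "\<And>x. (G has_vector_derivative cos (H x - H 0) *\<^sub>R P x + sin (H x - H 0) *\<^sub>R Q x) (at x)"
    "\<And>x. (P has_vector_derivative cos (H x - H 0) *\<^sub>R G x) (at x)"
    "\<And>x. (Q has_vector_derivative sin (H x - H 0) *\<^sub>R G x) (at x)"
    "\<And>x. mink (G x) (G x) = -1" "\<And>x. mink (P x) (P x) = 1" "\<And>x. mink (Q x) (Q x) = 1"
    "\<And>x. mink (G x) (P x) = 0" "\<And>x. mink (G x) (Q x) = 0" "\<And>x. mink (P x) (Q x) = 0"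
    "\<And>x. fst (G x) > 0"
    and coords: "\<And>x u v. coords \<gamma> (x, u, v) = (snd (cosh u *\<^sub>R G x +
       sinh u *\<^sub>R (cos (H x - H 0) *\<^sub>R Q x - sin (H x - H 0) *\<^sub>R P x)), v)"
    using frame_along_curve[OF assms(7)] by blast
  interpret fermi_smooth H G P Q f S
    by unfold_locales (fact assms F)+
  have "coords \<gamma> = chart"
    by (rule ext) (auto simp: coords chart_def \<Phi>_def U_def \<theta>_def)
  then show ?thesis
    using extends_coord_formula_iff smooth_riemannian_met riem_complete_met has_ricci_eigenvalues_met
    by blast
qed

end
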